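(* Let $d\ge 1$, and let $\alpha,\beta\in\mathbb{R}^d$ with $\alpha_j,\beta_j\ge -1/2$ for all $j$. Suppose $\hat A\in C^{3k-1}[0,\infty)^d$ for some integer $k\ge 1$, $\operatorname{supp}\hat A\subset[0,2]^d$, and for every $1\le \ell\le d$ and every $t\in[0,2]^d$ of the form $t=(t_1,\dots,t_{\ell-1},0,t_{\ell+1},\dots,t_d)$ we have $D_\ell^m\hat A(t)=0$ for $m=1,2,\dots,3k-1$. Then the kernels $$\Lambda_n(x,y)=\sum_{\nu\in\mathbb{N}_0^d}\hat A\Big(\frac{\nu}{n}\Big)\tilde P_\nu^{(\alpha,\beta)}(x)\tilde P_\nu^{(\alpha,\beta)}(y),\quad n\ge 1,$$ satisfy $$|\Lambda_n(x,y)|\le\frac{c\,n^d}{\sqrt{W_{\alpha,\beta}(n;x)}\sqrt{W_{\alpha,\beta}(n;y)}}\big(1+n\rho(x,y)\big)^{-k},\quad x,y\in[-1,1]^d,$$ where the constant $c$ depends on $k,d,\alpha,\beta$ and $\|D_\ell^{3k-1}\hat A\|_\infty$, $\ell=1,\dots,d$, but not on $x,y$ and $n$. Consequently, for an admissible cutoff function $\hat A$ and any $k>0$, the estimate $$|\Lambda_n(x,y)|\le\frac{c\,n^d}{\sqrt{W_{\alpha,\beta}(n;x)}\sqrt{W_{\alpha,\beta}(n;y)}}\big(1+n\rho(x,y)\big)^{-k},\quad x,y\in[-1,1]^d,\ n\ge1,$$ holds with a constant $c$ independent of $x,y$ and $n$.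
   Context: $D_\ell^m=\partial^m/\partial t_\ell^m$; $\mathbb{N}_0=\{0,1,2,\dots\}$; cutoff functions are complex-valued. For scalars $a,b\ge-1/2$, $\tilde P_n^{(a,b)}$ is the $n$th degree Jacobi polynomial normalized in $L^2([-1,1],(1-t)^a(1+t)^b)$. For multi-indices, $\tilde P_\nu^{(\alpha,\beta)}(x)=\prod_{j=1}^d\tilde P_{\nu_j}^{(\alpha_j,\beta_j)}(x_j)$. For $n\ge 1$, $W_{\alpha,\beta}(n;x)=\prod_{j=1}^d(1-x_j+n^{-2})^{\alpha_j+1/2}(1+x_j+n^{-2})^{\beta_j+1/2}$. The distance on $[-1,1]^d$ is $\rho(x,y)=\max_{1\le j\le d}|\arccos x_j-\arccos y_j|$. A function $\hat A\in C^\infty[0,\infty)^d$ is admissible (of first kind) if $\operatorname{supp}\hat A\subset[0,2]^d$ and for each $1\le k\le d$ and each $t\in[0,\infty)^d$ with $t_k=0$ we have $D_k^m\hat A(t)=0$ for $m=1,2,\dots$. *)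

theory Defs
  imports "HOL-Analysis.Analysis"
begin

text \<open>Vectors in $d$ dimensions are indexed by a finite type \<open>'d\<close> with $d$ elements.
  A function on the orthant $[0,\infty)^d$ is represented by a total function on
  \<^typ>\<open>real^'d\<close>; all notions below depend on its values on the orthant only.\<close>

definition orthant :: "(real^'d) set" where
  "orthant = {t. \<forall>j. 0 \<le> t $ j}"

definition cube :: "real \<Rightarrow> real \<Rightarrow> (real^'d) set" where
  "cube a b = {t. \<forall>j. a \<le> t $ j \<and> t $ j \<le> b}"

definition coord_upd :: "real^'d \<Rightarrow> 'd \<Rightarrow> real \<Rightarrow> real^'d" where
  "coord_upd t l s = (\<chi> j. if j = l then s else t $ j)"

text \<open>Partial derivatives on the orthant: one-sided where $t_l = 0$, two-sided where $t_l > 0$.\<close>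

definition partial_deriv :: "'d \<Rightarrow> (real^'d \<Rightarrow> complex) \<Rightarrow> real^'d \<Rightarrow> complex" where
  "partial_deriv l f t =
     vector_derivative (\<lambda>s. f (coord_upd t l s)) (at (t $ l) within {0..})"

definition has_partial_on_orthant :: "'d \<Rightarrow> (real^'d \<Rightarrow> complex) \<Rightarrow> bool" where
  "has_partial_on_orthant l f \<longleftrightarrow>
     (\<forall>t\<in>orthant. (\<lambda>s. f (coord_upd t l s)) differentiable (at (t $ l) within {0..}))"

definition pd :: "'d \<Rightarrow> nat \<Rightarrow> (real^'d \<Rightarrow> complex) \<Rightarrow> real^'d \<Rightarrow> complex" where
  "pd l m f = (partial_deriv l ^^ m) f"

text \<open>All partial derivatives, mixed ones included, of order at most $m$ exist and are
  continuous on the orthant.\<close>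

fun Ck_orthant :: "nat \<Rightarrow> (real^'d \<Rightarrow> complex) \<Rightarrow> bool" where
  "Ck_orthant 0 f \<longleftrightarrow> continuous_on orthant f"
| "Ck_orthant (Suc m) f \<longleftrightarrow> continuous_on orthant f \<and>
     (\<forall>l. has_partial_on_orthant l f \<and> Ck_orthant m (partial_deriv l f))"

definition supp_orthant :: "(real^'d \<Rightarrow> complex) \<Rightarrow> (real^'d) set" where
  "supp_orthant f = closure {t \<in> orthant. f t \<noteq> 0}"

definition sup_norm_orthant :: "(real^'d \<Rightarrow> complex) \<Rightarrow> real" where
  "sup_norm_orthant f = (SUP t\<in>orthant. norm (f t))"

definition admissible :: "(real^'d \<Rightarrow> complex) \<Rightarrow> bool" where
  "admissible A \<longleftrightarrow>
     (\<forall>m. Ck_orthant m A) \<and> supp_orthant A \<subseteq> cube 0 2 \<and>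
     (\<forall>l. \<forall>t\<in>orthant. t $ l = 0 \<longrightarrow> (\<forall>m\<ge>1. pd l m A t = 0))"

text \<open>The classical Jacobi polynomial $P_n^{(a,b)}$, by the explicit formula (4.3.2) of
  Szego's "Orthogonal Polynomials", valid for all $a, b > -1$.\<close>

definition jacobi :: "nat \<Rightarrow> real \<Rightarrow> real \<Rightarrow> real \<Rightarrow> real" where
  "jacobi n a b t = (\<Sum>s\<le>n. ((real n + a) gchoose (n - s)) * ((real n + b) gchoose s) *
     ((t - 1) / 2) ^ s * ((t + 1) / 2) ^ (n - s))"

definition jacobi_weight :: "real \<Rightarrow> real \<Rightarrow> real \<Rightarrow> real" where
  "jacobi_weight a b t = (1 - t) powr a * (1 + t) powr b"

definition jacobi_normalized :: "nat \<Rightarrow> real \<Rightarrow> real \<Rightarrow> real \<Rightarrow> real" where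
  "jacobi_normalized n a b t =
     jacobi n a b t /
       sqrt (set_lebesgue_integral lborel {-1..1} (\<lambda>s. (jacobi n a b s)\<^sup>2 * jacobi_weight a b s))"

definition jacobi_prod :: "real^'d \<Rightarrow> real^'d \<Rightarrow> nat^'d \<Rightarrow> real^'d \<Rightarrow> real" where
  "jacobi_prod \<alpha> \<beta> \<nu> x = (\<Prod>j\<in>UNIV. jacobi_normalized (\<nu> $ j) (\<alpha> $ j) (\<beta> $ j) (x $ j))"

definition W :: "real^'d \<Rightarrow> real^'d \<Rightarrow> nat \<Rightarrow> real^'d \<Rightarrow> real" where
  "W \<alpha> \<beta> n x = (\<Prod>j\<in>UNIV.
     (1 - x $ j + 1 / (real n)\<^sup>2) powr (\<alpha> $ j + 1/2) *
     (1 + x $ j + 1 / (real n)\<^sup>2) powr (\<beta> $ j + 1/2))"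

definition rho :: "real^'d \<Rightarrow> real^'d \<Rightarrow> real" where
  "rho x y = (MAX j. \<bar>arccos (x $ j) - arccos (y $ j)\<bar>)"

text \<open>For $n \ge 1$ and a cutoff function with support in $[0,2]^d$ only finitely many terms
  of this sum are nonzero.\<close>

definition Lambda_kernel ::
    "(real^'d \<Rightarrow> complex) \<Rightarrow> real^'d \<Rightarrow> real^'d \<Rightarrow> nat \<Rightarrow> real^'d \<Rightarrow> real^'d \<Rightarrow> complex" where
  "Lambda_kernel A \<alpha> \<beta> n x y =
     (\<Sum>\<^sub>\<infinity>\<nu>\<in>(UNIV :: (nat^'d) set). A (\<chi> j. real (\<nu> $ j) / real n) *
        complex_of_real (jacobi_prod \<alpha> \<beta> \<nu> x) * complex_of_real (jacobi_prod \<alpha> \<beta> \<nu> y))"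

end

theory Submission
  imports Defs "HOL-Computational_Algebra.Polynomial"
begin

text \<open>The idea is finite propagation speed for the Jacobi operator \<open>L\<close>, whose shifted eigenvalues are the
  squares \<open>(\<nu> + \<sigma>)\<^sup>2\<close> with \<open>2 \<sigma> = \<alpha> + \<beta> + 1\<close>. In one variable the kernel is that of a multiplier
  \<open>A\<close>, and multiplying it \<open>K\<close> times by \<open>Q(x) - Q(y)\<close> amounts to taking the \<open>K\<close>-fold commutator of
  \<open>A\<close> with multiplication by \<open>Q\<close>. For a Chebyshev polynomial \<open>Q\<close> of degree \<open>m\<close>, energy estimates for
  the wave equation bound the commutator with \<open>cos (t sqrt (L + \<sigma>\<^sup>2))\<close> by a multiple of \<open>min(1, t m)^K\<close>;
  the vanishing derivatives at the origin make \<open>A\<close> a cosine series with coefficients \<open>O(j^-K)\<close>, and for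
  \<open>K = k + 1\<close> summation gives the norm bound \<open>O((m/n)^k)\<close>. A Fejer kernel argument supplies some \<open>m\<close> of order
  at most \<open>1/\<rho>\<close> with \<open>\<bar>Q(x) - Q(y)\<bar> \<ge> 1/8\<close>. The passage from \<open>L\<^sup>2\<close> norms to pointwise values
  is the upper bound \<open>n / w(n; x)\<close> for the inverse Christoffel function. In several variables this is
  applied to a coordinate that realizes \<open>\<rho>(x, y)\<close>.\<close>

section \<open>Jacobi weights and the Jacobi operator\<close>

text \<open>Multiplication by \<open>x - y\<close> would lose decay near the endpoints, where cos is
  flat and \<open>x - y\<close> can be as small as the order of \<open>rho^2\<close>. A Chebyshev
  polynomial \<open>Q\<close> of degree about \<open>1 / rho\<close> oscillates at the scale
  \<open>rho\<close> on the whole interval, and the quantity that its commutators with the operator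
  see, \<open>(1 - x^2) Q'^2\<close>, is at most \<open>m^2\<close> up to the endpoints. All
  operators act on polynomials, where every spectral sum is finite, so the wave equation is treated
  as a finite system of ordinary differential equations. The shift displaces the origin: as a
  function of the frequency \<open>mu\<close> the cutoff starts at \<open>mu = sg\<close>, not at 0.
  It is continued to the left by a constant, and the vanishing derivatives make this continuation
  and its even reflection smooth enough for the decay of the cosine coefficients. The order
  \<open>K\<close> exceeds \<open>k\<close> by one because the sum over \<open>j\<close> of
  \<open>min (1, j * eps)^K / j^K\<close> is of order \<open>eps^(K - 1)\<close>.\<close>

lemma jacobi_weight_integrable:
  assumes "a > -1" "b > -1"
  shows "set_integrable lborel {-1..1} (jacobi_weight a b)"
proof -
  have "set_integrable lborel {0..1} (\<lambda>t. t powr ((b+1)-1) * (1-t) powr ((a+1)-1))"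
    by (rule integrable_Beta) (use assms in auto)
  hence "integrable lborel (\<lambda>t. indicator {0..1} t *\<^sub>R (t powr b * (1-t) powr a))"
    by (simp add: set_integrable_def)
  \<comment> \<open>The substitution \<open>s = (1 + t) / 2\<close> carries \<open>[-1, 1]\<close>
    to the interval of the Beta integral; the powers of 2 that it produces are restored by the
    factor \<open>2 powr (a + b)\<close>.\<close>
  from lborel_integrable_real_affine[OF this, of "1/2" "1/2"]
  have "integrable lborel (\<lambda>t. indicator {0..1} (1/2+1/2*t) *\<^sub>R ((1/2+1/2*t) powr b * (1-(1/2+1/2*t)) powr a))"
    by simp
  hence "integrable lborel (\<lambda>t. 2 powr (a+b) * (indicator {0..1} (1/2+1/2*t) *\<^sub>R ((1/2+1/2*t) powr b * (1-(1/2+1/2*t)) powr a)))"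
    by (rule integrable_mult_right)
  also have "(\<lambda>t. 2 powr (a+b) * (indicator {0..1} (1/2+1/2*t) *\<^sub>R ((1/2+1/2*t) powr b * (1-(1/2+1/2*t)) powr a)))
     = (\<lambda>t::real. indicator {-1..1} t *\<^sub>R jacobi_weight a b t)"
  proof
    fix t :: real
    show "2 powr (a+b) * (indicator {0..1} (1/2+1/2*t) *\<^sub>R ((1/2+1/2*t) powr b * (1-(1/2+1/2*t)) powr a))
      = indicator {-1..1} t *\<^sub>R jacobi_weight a b t"
    proof (cases "t \<in> {-1..1}")
      case True
      have 1: "1/2+1/2*t = (1+t)/2" and 2: "1-(1+t)/2 = (1-t)/2"
        by (simp_all add: field_simps)
      have "1/2+1/2*t \<in> {0..1}" using True by auto
      hence i: "indicator {0..1} (1/2+1/2*t) = (1::real)" by simp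
      show ?thesis
        unfolding i 1 2 using True
        by (simp add: jacobi_weight_def powr_divide powr_add)
    next
      case False
      have "1/2+1/2*t \<notin> {0..1}" using False by auto
      then show ?thesis using False by (subst (1 2) indicator_simps(2)) simp_all
    qed
  qed
  finally show ?thesis by (simp add: set_integrable_def)
qed

lemma jacobi_weight_nonneg [simp]: "0 \<le> jacobi_weight a b t"
  by (simp add: jacobi_weight_def)

lemma jacobi_weight_pos: "\<lbrakk>-1 < t; t < 1\<rbrakk> \<Longrightarrow> 0 < jacobi_weight a b t"
  by (simp add: jacobi_weight_def)

section \<open>The weighted integral and the inner product on polynomials\<close>

definition wint :: "real \<Rightarrow> real \<Rightarrow> (real \<Rightarrow> real) \<Rightarrow> real" where
  "wint a b f = set_lebesgue_integral lborel {-1..1} (\<lambda>s. f s * jacobi_weight a b s)"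

text \<open>The bound \<open>-1/2\<close> makes the exponents \<open>a + 1/2\<close> and
  \<open>b + 1/2\<close> of \<open>wn\<close> nonnegative, and likewise
  \<open>sg = (a + b + 1) / 2\<close>, so that all frequencies \<open>mu\<close> are
  nonnegative.\<close>

locale jacobi_param =
  fixes a b :: real
  assumes a_ge: "a \<ge> -1/2" and b_ge: "b \<ge> -1/2"
begin

lemma weighted_integrable:
  assumes "continuous_on {-1..1} f"
  shows "set_integrable lborel {-1..1} (\<lambda>s. f s * jacobi_weight a b s)"
proof -
  have wi: "set_integrable lborel {-1..1} (jacobi_weight a b)"
    using jacobi_weight_integrable a_ge b_ge by auto
  obtain K where K: "\<And>x. x \<in> {-1..1} \<Longrightarrow> \<bar>f x\<bar> \<le> K"
    using compact_imp_bounded[OF compact_continuous_image[OF assms compact_Icc]]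
    by (fastforce simp: bounded_iff)
  have m1: "(\<lambda>x. indicator {-1..1} x *\<^sub>R f x) \<in> borel_measurable lborel"
    using borel_measurable_continuous_on_indicator[OF _ assms] by simp
  have m2: "(\<lambda>x. indicator {-1..1} x *\<^sub>R jacobi_weight a b x) \<in> borel_measurable lborel"
    using wi unfolding set_integrable_def by (rule borel_measurable_integrable)
  have eq: "(\<lambda>x. indicator {-1..1} x *\<^sub>R (f x * jacobi_weight a b x))
     = (\<lambda>x. (indicator {-1..1} x *\<^sub>R f x) * (indicator {-1..1} x *\<^sub>R jacobi_weight a b x))"
    by (auto simp: indicator_def fun_eq_iff)
  show ?thesis
    unfolding set_integrable_def
  proof (rule Bochner_Integration.integrable_bound)
    show "integrable lborel (\<lambda>x. K * (indicator {-1..1} x *\<^sub>R jacobi_weight a b x))"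
      using wi unfolding set_integrable_def by (rule integrable_mult_right)
    show "(\<lambda>x. indicator {-1..1} x *\<^sub>R (f x * jacobi_weight a b x)) \<in> borel_measurable lborel"
      unfolding eq using m1 m2 by measurable
    show "AE x in lborel. norm (indicator {-1..1} x *\<^sub>R (f x * jacobi_weight a b x))
       \<le> norm (K * (indicator {-1..1} x *\<^sub>R jacobi_weight a b x))"
    proof (intro AE_I2)
      fix x :: real
      show "norm (indicator {-1..1} x *\<^sub>R (f x * jacobi_weight a b x))
       \<le> norm (K * (indicator {-1..1} x *\<^sub>R jacobi_weight a b x))"
        using K[of x] by (auto simp: indicator_def abs_mult intro!: mult_right_mono)
    qed
  qed
qed

lemma wint_add:
  assumes "continuous_on {-1..1} f" "continuous_on {-1..1} g"
  shows "wint a b (\<lambda>x. f x + g x) = wint a b f + wint a b g"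
  using set_integral_add(2)[OF weighted_integrable[OF assms(1)] weighted_integrable[OF assms(2)]]
  by (simp add: wint_def algebra_simps)

lemma wint_cmult: "wint a b (\<lambda>x. c * f x) = c * wint a b f"
  by (simp add: wint_def mult.assoc)

lemma wint_mono:
  assumes "continuous_on {-1..1} f" "continuous_on {-1..1} g"
    and "\<And>x. x \<in> {-1..1} \<Longrightarrow> f x \<le> g x"
  shows "wint a b f \<le> wint a b g"
  unfolding wint_def
  by (rule set_integral_mono[OF weighted_integrable[OF assms(1)] weighted_integrable[OF assms(2)]])
     (auto intro!: mult_right_mono assms)

lemma wint_nonneg:
  assumes "\<And>x. x \<in> {-1..1} \<Longrightarrow> 0 \<le> f x"
  shows "0 \<le> wint a b f"
  unfolding wint_def set_lebesgue_integral_def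
  by (rule integral_nonneg_AE) (use assms in \<open>auto simp: indicator_def\<close>)

lemma wint_eq_integral:
  assumes "continuous_on {-1..1} f"
  shows "(\<lambda>s. f s * jacobi_weight a b s) integrable_on {-1..1}"
    and "wint a b f = integral {-1..1} (\<lambda>s. f s * jacobi_weight a b s)"
  unfolding wint_def using set_borel_integral_eq_integral[OF weighted_integrable[OF assms]] by auto

definition ip :: "real poly \<Rightarrow> real poly \<Rightarrow> real" where
  "ip p q = wint a b (\<lambda>x. poly p x * poly q x)"

lemma continuous_on_poly' [continuous_intros]: "continuous_on S (poly (p :: real poly))"
  by (simp add: continuous_on_poly)

lemma ip_commute: "ip p q = ip q p"
  by (simp add: ip_def mult.commute)

lemma ip_add_left: "ip (p + r) q = ip p q + ip r q"
  unfolding ip_def by (subst wint_add[symmetric]) (auto intro!: continuous_intros simp: algebra_simps)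

lemma ip_smult_left: "ip (smult c p) q = c * ip p q"
  unfolding ip_def by (subst wint_cmult[symmetric]) (simp add: algebra_simps)

lemma ip_add_right: "ip q (p + r) = ip q p + ip q r"
  by (metis ip_add_left ip_commute)

lemma ip_smult_right: "ip q (smult c p) = c * ip q p"
  by (metis ip_smult_left ip_commute)

lemma ip_minus_left: "ip (- p) q = - ip p q"
  using ip_smult_left[of "-1" p q] by simp

lemma ip_minus_right: "ip q (- p) = - ip q p"
  using ip_smult_right[of q "-1" p] by simp

lemma ip_diff_left: "ip (p - r) q = ip p q - ip r q"
  using ip_add_left[of p "-r" q] by (simp add: ip_minus_left)

lemma ip_diff_right: "ip q (p - r) = ip q p - ip q r"
  by (metis ip_diff_left ip_commute)

lemma ip_zero [simp]: "ip 0 q = 0" "ip q 0 = 0"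
  using ip_smult_left[of 0 0 q] ip_smult_right[of q 0 0] by simp_all

lemma ip_sum_left: "ip (\<Sum>i\<in>I. f i) q = (\<Sum>i\<in>I. ip (f i) q)"
  by (induction I rule: infinite_finite_induct) (auto simp: ip_add_left)

lemma ip_mult: "ip (g * p) q = ip p (g * q)"
  by (simp add: ip_def algebra_simps)

lemma ip_nonneg: "0 \<le> ip p p"
  unfolding ip_def by (rule wint_nonneg) simp

text \<open>If the integral were 0, the polynomial would vanish almost everywhere on the open
  interval, where the weight is positive; but its finitely many roots form a null set and the
  interval does not.\<close>

lemma ip_pos:
  assumes "p \<noteq> 0"
  shows "0 < ip p p"
proof (rule ccontr)
  assume "\<not> 0 < ip p p"
  hence z: "ip p p = 0" using ip_nonneg[of p] by simp
  let ?f = "\<lambda>x. indicator {-1..1} x *\<^sub>R (poly p x * poly p x * jacobi_weight a b x)"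
  have "set_integrable lborel {-1..1} (\<lambda>x. poly p x * poly p x * jacobi_weight a b x)"
    by (rule weighted_integrable) (intro continuous_intros)
  hence i: "integrable lborel ?f" by (simp add: set_integrable_def)
  have "integral\<^sup>L lborel ?f = 0"
    using z by (simp add: ip_def wint_def set_lebesgue_integral_def)
  hence "AE x in lborel. ?f x = 0"
    by (subst (asm) integral_nonneg_eq_0_iff_AE[OF i]) (auto simp: indicator_def)
  moreover have "AE x in lborel. x \<notin> {x. poly p x = 0}"
    by (rule AE_not_in) (use poly_roots_finite[OF assms] in \<open>auto intro: finite_imp_null_set_lborel\<close>)
  ultimately have "AE x in lborel. x \<notin> {-1<..<1::real}"
  proof eventually_elim
    case (elim x)
    then show ?case using jacobi_weight_pos[of x a b]
      by (cases "x \<in> {-1<..<1}") (auto simp: indicator_def)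
  qed
  hence "emeasure lborel {-1<..<1::real} = 0"
    by (subst (asm) AE_iff_null_sets[symmetric]) auto
  thus False by simp
qed

definition nrm :: "real poly \<Rightarrow> real" where "nrm p = sqrt (ip p p)"

lemma nrm_nonneg [simp]: "0 \<le> nrm p"
  by (simp add: nrm_def ip_nonneg)

lemma nrm_sq: "(nrm p)\<^sup>2 = ip p p"
  by (simp add: nrm_def ip_nonneg)

lemma nrm_zero [simp]: "nrm 0 = 0"
  by (simp add: nrm_def)

lemma nrm_smult: "nrm (smult c p) = \<bar>c\<bar> * nrm p"
  by (simp add: nrm_def ip_smult_left ip_smult_right real_sqrt_mult flip: mult.assoc)

lemma nrm_minus [simp]: "nrm (- p) = nrm p"
  by (simp add: nrm_def ip_minus_left ip_minus_right)

lemma ip_Cauchy_Schwarz: "\<bar>ip p q\<bar> \<le> nrm p * nrm q"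
proof (cases "q = 0")
  case False
  hence q: "0 < ip q q" by (rule ip_pos)
  define c where "c = ip p q / ip q q"
  have "0 \<le> ip (p - smult c q) (p - smult c q)" by (rule ip_nonneg)
  also have "\<dots> = ip p p - (ip p q)\<^sup>2 / ip q q"
    using q unfolding c_def
    by (simp add: ip_diff_left ip_diff_right ip_smult_left ip_smult_right ip_commute[of q p] field_simps power2_eq_square)
  finally have "(ip p q)\<^sup>2 \<le> ip p p * ip q q" using q by (simp add: field_simps)
  hence "sqrt ((ip p q)\<^sup>2) \<le> sqrt (ip p p * ip q q)" by (rule real_sqrt_le_mono)
  thus ?thesis by (simp add: nrm_def real_sqrt_mult)
qed simp

lemma nrm_triangle: "nrm (p + q) \<le> nrm p + nrm q"
proof -
  have "ip (p+q) (p+q) \<le> (nrm p + nrm q)\<^sup>2"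
    using ip_Cauchy_Schwarz[of p q]
    by (simp add: ip_add_left ip_add_right power2_sum nrm_sq ip_commute[of q p])
  thus ?thesis unfolding nrm_def[of "p+q"]
    by (simp add: real_le_lsqrt)
qed

lemma nrm_diff: "nrm (p - q) \<le> nrm p + nrm q"
  using nrm_triangle[of p "-q"] by simp

lemma nrm_mult_le:
  assumes "\<And>x. x \<in> {-1..1} \<Longrightarrow> \<bar>poly g x\<bar> \<le> c"
  shows "nrm (g * p) \<le> c * nrm p"
proof -
  have c: "0 \<le> c" using assms[of 0] by auto
  have "ip (g*p) (g*p) \<le> c\<^sup>2 * ip p p"
    unfolding ip_def
  proof (subst wint_cmult[symmetric], rule wint_mono)
    fix x :: real assume x: "x \<in> {-1..1}"
    have "(poly g x)\<^sup>2 \<le> c\<^sup>2" using power_mono[OF assms[OF x], of 2] by simp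
    hence "(poly g x)\<^sup>2 * (poly p x)\<^sup>2 \<le> c\<^sup>2 * (poly p x)\<^sup>2" by (rule mult_right_mono) simp
    thus "poly (g * p) x * poly (g * p) x \<le> c\<^sup>2 * (poly p x * poly p x)"
      by (simp add: power2_eq_square algebra_simps)
  qed (auto intro!: continuous_intros)
  hence "sqrt (ip (g*p) (g*p)) \<le> sqrt (c\<^sup>2 * ip p p)" by (rule real_sqrt_le_mono)
  thus ?thesis using c by (simp add: nrm_def real_sqrt_mult)
qed

section \<open>The Jacobi operator in divergence form\<close>

definition Lop :: "real poly \<Rightarrow> real poly" where
  "Lop p = - ([:1, 0, -1:] * pderiv (pderiv p) + [:b - a, - (a + b + 2):] * pderiv p)"

lemma Lop_add: "Lop (p + q) = Lop p + Lop q"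
  by (rule iffD1[OF poly_eq_poly_eq_iff], rule ext) (simp add: Lop_def pderiv_add algebra_simps)

lemma Lop_smult: "Lop (smult c p) = smult c (Lop p)"
  by (rule iffD1[OF poly_eq_poly_eq_iff], rule ext) (simp add: Lop_def pderiv_smult algebra_simps)

lemma Lop_zero [simp]: "Lop 0 = 0"
  by (simp add: Lop_def)

lemma Lop_diff: "Lop (p - q) = Lop p - Lop q"
  by (rule iffD1[OF poly_eq_poly_eq_iff], rule ext) (simp add: Lop_def pderiv_diff algebra_simps)

lemma Lop_sum: "Lop (\<Sum>i\<in>I. f i) = (\<Sum>i\<in>I. Lop (f i))"
  by (induction I rule: infinite_finite_induct) (auto simp: Lop_add)

text \<open>Sturm-Liouville form of \<open>Lop\<close>: the weight is the integrating factor that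
  absorbs the first-order term. The minus sign in \<open>Lop\<close> makes its quadratic form
  nonnegative.\<close>

lemma flux_has_derivative:
  assumes "-1 < t" "t < 1"
  shows "((\<lambda>t. (1-t) powr (a+1) * (1+t) powr (b+1) * poly (pderiv p) t) has_real_derivative
    - poly (Lop p) t * jacobi_weight a b t) (at t)"
proof -
  have t: "1 - t > 0" "1 + t > 0" using assms by auto
  have P: "(1-t) powr (a+1) = (1-t) * (1-t) powr a" "(1+t) powr (b+1) = (1+t) * (1+t) powr b"
    "(1-t) powr (a+1-1) = (1-t) powr a" "(1+t) powr (b+1-1) = (1+t) powr b"
    using t by (simp_all add: powr_add)
  have "((\<lambda>t. (1-t) powr (a+1) * (1+t) powr (b+1) * poly (pderiv p) t) has_real_derivative
      (((a+1) * (1-t) powr (a+1-1) * (0-1)) * (1+t) powr (b+1) + (1-t) powr (a+1) * ((b+1) * (1+t) powr (b+1-1) * (0+1)))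
      * poly (pderiv p) t + (1-t) powr (a+1) * (1+t) powr (b+1) * poly (pderiv (pderiv p)) t) (at t)"
    using t by (auto intro!: derivative_eq_intros poly_DERIV simp: algebra_simps)
  thus ?thesis unfolding P jacobi_weight_def Lop_def
    by (rule DERIV_cong) (simp add: algebra_simps)
qed

text \<open>Integration by parts. The flux carries the positive exponents \<open>a + 1\<close> and
  \<open>b + 1\<close>, so it vanishes at both endpoints; differentiability is asked for in the open
  interval only, because the weight itself may blow up at the endpoints.\<close>

lemma ip_Lop: "ip (Lop p) q = ip ([:1, 0, -1:] * pderiv p) (pderiv q)"
proof -
  let ?w = "jacobi_weight a b"
  let ?F = "\<lambda>x. (1-x) powr (a+1) * (1+x) powr (b+1) * poly (pderiv p) x * poly q x"
  let ?f = "\<lambda>x. poly ([:1, 0, -1:] * pderiv p) x * poly (pderiv q) x - poly (Lop p) x * poly q x"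
  have pos: "0 < a + 1" "0 < b + 1" using a_ge b_ge by auto
  have c: "continuous_on {-1..1} ?F"
    using pos by (auto intro!: continuous_intros continuous_on_powr')
  have d: "(?F has_vector_derivative (?f x * ?w x)) (at x)" if "x \<in> {-1<..<1}" for x
  proof -
    have x: "1 - x > 0" "1 + x > 0" using that by auto
    hence P: "(1-x) powr (a+1) = (1-x) * (1-x) powr a" "(1+x) powr (b+1) = (1+x) * (1+x) powr b"
      by (simp_all add: powr_add)
    have "(?F has_real_derivative (- poly (Lop p) x * ?w x) * poly q x
        + poly (pderiv q) x * ((1-x) powr (a+1) * (1+x) powr (b+1) * poly (pderiv p) x)) (at x)"
      by (rule DERIV_mult[OF flux_has_derivative poly_DERIV]) (use that in auto)
    hence "(?F has_real_derivative ?f x * ?w x) (at x)"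
      by (rule DERIV_cong) (simp only: P jacobi_weight_def, simp add: algebra_simps)
    thus ?thesis by (simp add: has_real_derivative_iff_has_vector_derivative)
  qed
  have cf: "continuous_on {-1..1} ?f" by (intro continuous_intros)
  have "((\<lambda>x. ?f x * ?w x) has_integral (?F 1 - ?F (-1))) {-1..1}"
    by (rule fundamental_theorem_of_calculus_interior[OF _ c d]) auto
  hence "integral {-1..1} (\<lambda>x. ?f x * ?w x) = 0" using pos by (simp add: integral_unique)
  hence "wint a b ?f = 0" using wint_eq_integral(2)[OF cf] by simp
  moreover have "wint a b ?f = wint a b (\<lambda>x. poly ([:1, 0, -1:] * pderiv p) x * poly (pderiv q) x)
     + wint a b (\<lambda>x. (-1) * (poly (Lop p) x * poly q x))"
    by (subst wint_add[symmetric]) (auto intro!: continuous_intros simp: algebra_simps)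
  ultimately show ?thesis unfolding wint_cmult ip_def by simp
qed

lemma ip_Lop_commute: "ip (Lop p) q = ip p (Lop q)"
  by (metis ip_Lop ip_commute ip_mult)

end

section \<open>Jacobi polynomials as an orthonormal eigenbasis\<close>

lemma poly_ext: "(\<And>x. poly p x = poly q x) \<Longrightarrow> p = (q :: real poly)"
  using poly_eq_poly_eq_iff by blast

context jacobi_param
begin

definition lam :: "nat \<Rightarrow> real" where "lam n = real n * (real n + a + b + 1)"

text \<open>\<open>pu\<close> and \<open>pv\<close> are the two linear factors of the explicit
  formula for \<open>jacobi\<close>. Since \<open>1 - x^2 = -4 * pu * pv\<close>, their monomials
  are well adapted to \<open>Lop\<close>.\<close>

definition pu :: "real poly" where "pu = [:-1/2, 1/2:]"
definition pv :: "real poly" where "pv = [:1/2, 1/2:]"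

text \<open>Multiplying by \<open>pu * pv\<close> keeps the exponents \<open>s\<close> and
  \<open>r\<close> intact, which avoids \<open>s - 1\<close> and \<open>r - 1\<close> and the case
  distinction at 0.\<close>

lemma pderiv_pu_pv_power:
  "pderiv (pu ^ s * pv ^ r) * (pu * pv) = smult (1/2) ((smult (real s) pv + smult (real r) pu) * (pu ^ s * pv ^ r))"
proof -
  have 1: "pderiv pu = [:1/2:]" "pderiv pv = [:1/2:]" by (simp_all add: pu_def pv_def pderiv_pCons)
  have 2: "pderiv (pu ^ s) * pu = smult (real s/2) (pu ^ s)"
    by (cases s) (simp_all add: pderiv_power_Suc 1 algebra_simps del: power_Suc, simp add: power_Suc)
  have 3: "pderiv (pv ^ r) * pv = smult (real r/2) (pv ^ r)"
    by (cases r) (simp_all add: pderiv_power_Suc 1 algebra_simps del: power_Suc, simp add: power_Suc)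
  have "pderiv (pu ^ s * pv ^ r) * (pu * pv) = pu ^ s * pu * (pderiv (pv ^ r) * pv) + pv ^ r * pv * (pderiv (pu ^ s) * pu)"
    by (simp add: pderiv_mult algebra_simps)
  also have "\<dots> = smult (1/2) ((smult (real s) pv + smult (real r) pu) * (pu ^ s * pv ^ r))"
    unfolding 2 3 by (rule poly_ext) (simp add: field_simps)
  finally show ?thesis .
qed

text \<open>After division by \<open>pu * pv\<close> the three terms on the right are the monomials
  with exponents \<open>(s - 1, r + 1)\<close>, \<open>(s + 1, r - 1)\<close> and
  \<open>(s, r)\<close>: on monomials of fixed total degree \<open>Lop\<close> is tridiagonal. The
  proof differentiates \<open>pderiv_pu_pv_power\<close> once more and eliminates both
  derivatives.\<close>

lemma Lop_pu_pv:
  "Lop (pu ^ s * pv ^ r) * (pu * pv) =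
     (smult (real s * (real s + a)) (pv\<^sup>2) + smult (real r * (real r + b)) (pu\<^sup>2)
      + smult (2 * real s * real r + (b+1) * real s + (a+1) * real r) (pu * pv)) * (pu ^ s * pv ^ r)"
proof (rule poly_ext)
  fix x :: real
  let ?f = "pu ^ s * pv ^ r"
  define F where "F = poly ?f x"
  define F1 where "F1 = poly (pderiv ?f) x"
  define F2 where "F2 = poly (pderiv (pderiv ?f)) x"
  define U where "U = poly pu x"
  define V where "V = poly pv x"
  have 1: "pderiv pu = [:1/2:]" "pderiv pv = [:1/2:]" by (simp_all add: pu_def pv_def pderiv_pCons)
  have UV: "1 - x\<^sup>2 = -4 * (U * V)" "b - a - (a+b+2) * x = - 2 * ((b+1) * U + (a+1) * V)"
    unfolding U_def V_def pu_def pv_def by (simp_all add: field_simps power2_eq_square)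
  have e1: "F1 * (U * V) = 1/2 * ((s * V + r * U) * F)"
    using arg_cong[OF pderiv_pu_pv_power[of s r], of "\<lambda>p. poly p x"]
    unfolding F_def F1_def U_def V_def by simp
  have e2: "F2 * (U * V) + F1 * (1/2 * (U + V)) = 1/2 * (1/2 * (s + r) * F + (s * V + r * U) * F1)"
    using arg_cong[OF pderiv_pu_pv_power[of s r], of "\<lambda>p. poly (pderiv p) x"]
    unfolding F_def F1_def F2_def U_def V_def
    by (simp add: pderiv_mult pderiv_smult pderiv_add 1 algebra_simps)
  have "poly (Lop ?f) x = -(-4 * (U * V) * F2 + (- 2 * ((b+1) * U + (a+1) * V)) * F1)"
    unfolding UV[symmetric] F1_def F2_def Lop_def by (simp add: algebra_simps power2_eq_square)
  also have "\<dots> = 4 * (F2 * (U * V)) + 2 * ((b+1) * U + (a+1) * V) * F1" by (simp add: algebra_simps)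
  also have "\<dots> = (s + r) * F + 2 * (s * V + r * U) * F1 - 2 * (U + V) * F1 + 2 * ((b+1) * U + (a+1) * V) * F1"
  proof -
    have "4 * (F2 * (U * V)) = 4 * (F2 * (U * V) + F1 * (1/2 * (U + V))) - 2 * (U + V) * F1"
      by (simp add: algebra_simps)
    also have "\<dots> = (s + r) * F + 2 * (s * V + r * U) * F1 - 2 * (U + V) * F1"
      unfolding e2 by (simp add: algebra_simps)
    finally show ?thesis by simp
  qed
  finally have "poly (Lop ?f) x * (U * V) =
    (s + r) * F * (U * V) + (2 * (s * V + r * U) - 2 * (U + V) + 2 * ((b+1) * U + (a+1) * V)) * (F1 * (U * V))"
    by (simp add: algebra_simps)
  also have "\<dots> = (real s * (real s + a) * V^2 + real r * (real r + b) * U^2 + (2 * real s * real r + (b + 1) * real s + (a + 1) * real r) * (U * V)) * F"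
    unfolding e1 by (simp add: algebra_simps power2_eq_square)
  finally show "poly (Lop ?f * (pu * pv)) x = poly ((smult (real s * (real s + a)) (pv\<^sup>2) + smult (real r * (real r + b)) (pu\<^sup>2)
      + smult (2 * real s * real r + (b+1) * real s + (a+1) * real r) (pu * pv)) * ?f) x"
    unfolding F_def U_def V_def by simp
qed

definition jc :: "nat \<Rightarrow> nat \<Rightarrow> real" where
  "jc n s = ((real n + a) gchoose (n - s)) * ((real n + b) gchoose s)"

definition jacp :: "nat \<Rightarrow> real poly" where
  "jacp n = (\<Sum>s\<le>n. smult (jc n s) (pu ^ s * pv ^ (n - s)))"

lemma poly_jacp: "poly (jacp n) x = jacobi n a b x"
  by (simp add: jacp_def jacobi_def jc_def poly_sum pu_def pv_def field_simps)

text \<open>The absorption identities for binomial coefficients give the ratio of consecutive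
  coefficients; it is exactly the ratio needed to shift the off-diagonal terms of
  \<open>Lop_pu_pv\<close> by one index.\<close>

lemma jc_Suc:
  assumes "s < n"
  shows "jc n (Suc s) * (real (Suc s) * (real (Suc s) + a)) = jc n s * (real (n - s) * (real n + b - real s))"
proof -
  obtain k where k: "n - s = Suc k" using assms by (metis Suc_diff_Suc)
  hence n: "real n = real s + real k + 1" using assms by linarith
  have k': "n - Suc s = k" using k by simp
  have 1: "((real n + a) gchoose k) * (real n + a - real k) = (real k + 1) * ((real n + a) gchoose (Suc k))"
    using gbinomial_absorb_comp[of "real n + a" k] gbinomial_absorption[of k "real n + a"]
    by (simp add: mult.commute add.commute)
  have 2: "((real n + b) gchoose (Suc s)) * real (Suc s) = ((real n + b) gchoose s) * (real n + b - real s)"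
    using gbinomial_absorb_comp[of "real n + b" s] gbinomial_absorption[of s "real n + b"]
    by (simp add: mult.commute)
  have "jc n (Suc s) * (real (Suc s) * (real (Suc s) + a))
     = (((real n + a) gchoose k) * (real n + a - real k)) * (((real n + b) gchoose (Suc s)) * real (Suc s))"
    unfolding jc_def k' n by simp
  also have "\<dots> = jc n s * (real (n - s) * (real n + b - real s))"
    unfolding 1 2 jc_def k by simp
  finally show ?thesis .
qed

text \<open>By \<open>jc_Suc\<close>, one index shift upwards (\<open>A\<close>) and one downwards
  (\<open>B\<close>) move both off-diagonal sums onto the diagonal, where the three coefficients add
  up to \<open>lam n\<close>. The auxiliary factor \<open>pu * pv\<close> is cancelled at the
  end.\<close>

lemma Lop_jacp: "Lop (jacp n) = smult (lam n) (jacp n)"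
proof -
  define T where "T s = pu ^ s * pv ^ (n - s)" for s
  define c where "c s = jc n s" for s
  have pupv: "pu * pv \<noteq> 0" by (simp add: pu_def pv_def)
  have A: "(\<Sum>s\<le>n. smult (c s * (real s * (real s + a))) (pv\<^sup>2 * T s))
      = (\<Sum>s\<le>n. smult (c s * (real (n - s) * (real n + b - real s))) (pu * pv * T s))"
  proof -
    have "(\<Sum>s\<le>n. smult (c s * (real s * (real s + a))) (pv\<^sup>2 * T s))
       = (\<Sum>s<n. smult (c (Suc s) * (real (Suc s) * (real (Suc s) + a))) (pv\<^sup>2 * T (Suc s)))"
      unfolding lessThan_Suc_atMost[symmetric] by (subst sum.lessThan_Suc_shift) simp
    also have "\<dots> = (\<Sum>s<n. smult (c s * (real (n - s) * (real n + b - real s))) (pu * pv * T s))"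
    proof (rule sum.cong[OF refl])
      fix s assume s: "s \<in> {..<n}"
      hence e: "n - s = Suc (n - Suc s)" by auto
      have "pv\<^sup>2 * T (Suc s) = pu * pv * T s"
        unfolding T_def e power_Suc power2_eq_square by (simp only: mult_ac)
      thus "smult (c (Suc s) * (real (Suc s) * (real (Suc s) + a))) (pv\<^sup>2 * T (Suc s))
          = smult (c s * (real (n - s) * (real n + b - real s))) (pu * pv * T s)"
        using jc_Suc[of s n] s unfolding c_def by simp
    qed
    also have "\<dots> = (\<Sum>s\<le>n. smult (c s * (real (n - s) * (real n + b - real s))) (pu * pv * T s))"
      by (simp flip: lessThan_Suc_atMost)
    finally show ?thesis .
  qed
  have B: "(\<Sum>s\<le>n. smult (c s * (real (n-s) * (real (n-s) + b))) (pu\<^sup>2 * T s))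
      = (\<Sum>s\<le>n. smult (c s * (real s * (real s + a))) (pu * pv * T s))"
  proof -
    have "(\<Sum>s\<le>n. smult (c s * (real s * (real s + a))) (pu * pv * T s))
      = (\<Sum>s<n. smult (c (Suc s) * (real (Suc s) * (real (Suc s) + a))) (pu * pv * T (Suc s)))"
      unfolding lessThan_Suc_atMost[symmetric] by (subst sum.lessThan_Suc_shift) simp
    also have "\<dots> = (\<Sum>s<n. smult (c s * (real (n-s) * (real (n-s) + b))) (pu\<^sup>2 * T s))"
    proof (rule sum.cong[OF refl])
      fix s assume s: "s \<in> {..<n}"
      hence e: "n - s = Suc (n - Suc s)" by auto
      have "pu * pv * T (Suc s) = pu\<^sup>2 * T s"
        unfolding T_def e power_Suc power2_eq_square by (simp only: mult_ac)
      moreover have "real n + b - real s = real (n - s) + b" using s by (auto simp: of_nat_diff)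
      ultimately show "smult (c (Suc s) * (real (Suc s) * (real (Suc s) + a))) (pu * pv * T (Suc s))
          = smult (c s * (real (n-s) * (real (n-s) + b))) (pu\<^sup>2 * T s)"
        using jc_Suc[of s n] s unfolding c_def by (simp only: lessThan_iff)
    qed
    also have "\<dots> = (\<Sum>s\<le>n. smult (c s * (real (n-s) * (real (n-s) + b))) (pu\<^sup>2 * T s))"
      by (simp flip: lessThan_Suc_atMost)
    finally show ?thesis by simp
  qed
  have "Lop (jacp n) * (pu * pv) = (\<Sum>s\<le>n. smult (c s) (Lop (T s) * (pu * pv)))"
    by (simp add: jacp_def Lop_sum Lop_smult sum_distrib_right c_def T_def)
  also have "\<dots> = (\<Sum>s\<le>n. smult (c s * (real s * (real s + a))) (pv\<^sup>2 * T s)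
        + smult (c s * (real (n-s) * (real (n-s) + b))) (pu\<^sup>2 * T s)
        + smult (c s * (2 * real s * real (n-s) + (b+1) * real s + (a+1) * real (n-s))) (pu * pv * T s))"
    unfolding T_def Lop_pu_pv by (simp add: smult_add_right distrib_right smult_smult)
  also have "\<dots> = (\<Sum>s\<le>n. smult (c s * (real (n - s) * (real n + b - real s))) (pu * pv * T s)
        + smult (c s * (real s * (real s + a))) (pu * pv * T s)
        + smult (c s * (2 * real s * real (n-s) + (b+1) * real s + (a+1) * real (n-s))) (pu * pv * T s))"
    unfolding sum.distrib A B ..
  also have "\<dots> = (\<Sum>s\<le>n. smult (lam n * c s) (pu * pv * T s))"
  proof (rule sum.cong[OF refl])
    fix s assume "s \<in> {..n}"
    hence r: "real (n - s) = real n - real s" by auto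
    have "c s * (real (n - s) * (real n + b - real s)) + c s * (real s * (real s + a))
        + c s * (2 * real s * real (n-s) + (b+1) * real s + (a+1) * real (n-s)) = lam n * c s"
      unfolding lam_def r by (simp add: algebra_simps)
    thus "smult (c s * (real (n - s) * (real n + b - real s))) (pu * pv * T s)
        + smult (c s * (real s * (real s + a))) (pu * pv * T s)
        + smult (c s * (2 * real s * real (n-s) + (b+1) * real s + (a+1) * real (n-s))) (pu * pv * T s)
        = smult (lam n * c s) (pu * pv * T s)"
      by (simp add: smult_add_left[symmetric])
  qed
  also have "\<dots> = smult (lam n) (jacp n) * (pu * pv)"
    unfolding jacp_def sum_distrib_right c_def T_def
    by (rule poly_ext) (simp add: poly_sum sum_distrib_left sum_distrib_right algebra_simps)
  finally show ?thesis using mult_right_cancel[OF pupv] by blast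
qed

text \<open>At \<open>x = 1\<close> only the term \<open>s = 0\<close> survives, and its generalized
  binomial coefficient is a product of positive factors.\<close>

lemma jacp_nonzero: "jacp n \<noteq> 0"
proof -
  have "poly (jacp n) 1 = (\<Sum>s\<le>n. if s = 0 then jc n 0 else 0)"
    unfolding jacp_def poly_sum by (intro sum.cong) (auto simp: pu_def pv_def)
  also have "\<dots> = jc n 0" by simp
  also have "\<dots> = (real n + a) gchoose n" by (simp add: jc_def)
  also have "\<dots> > 0"
    unfolding gbinomial_prod_rev using a_ge
    by (intro divide_pos_pos prod_pos) auto
  finally show ?thesis by auto
qed

section \<open>Eigenvalues, degrees and the orthonormal expansion\<close>

lemma lam_mono: "m \<le> n \<Longrightarrow> lam m \<le> lam n"
  unfolding lam_def using a_ge b_ge by (intro mult_mono) auto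

lemma lam_strict: "m < n \<Longrightarrow> lam m < lam n"
  unfolding lam_def using a_ge b_ge by (intro mult_strict_mono') auto

lemma lam_nonneg: "0 \<le> lam n"
  unfolding lam_def using a_ge b_ge by auto

lemma lam_inj: "lam m = lam n \<Longrightarrow> m = n"
  using lam_strict[of m n] lam_strict[of n m] by (cases m n rule: linorder_cases) auto

lemma coeff_Lop:
  assumes "coeff p (Suc n) = 0" "coeff p (Suc (Suc n)) = 0"
  shows "coeff (Lop p) n = lam n * coeff p n"
proof -
  consider "n = 0" | "n = 1" | k where "n = Suc (Suc k)"
    by (metis One_nat_def not0_implies_Suc)
  thus ?thesis
  proof cases
    case 1
    show ?thesis using assms unfolding 1 by (simp add: Lop_def lam_def coeff_pderiv)
  next
    case 2
    show ?thesis using assms unfolding 2 by (simp add: Lop_def lam_def coeff_pderiv algebra_simps)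
  next
    case 3
    show ?thesis using assms unfolding 3 by (simp add: Lop_def lam_def coeff_pderiv ring_distribs)
  qed
qed

lemma coeff_Lop_top: "coeff (Lop p) (degree p) = lam (degree p) * lead_coeff p"
  by (rule coeff_Lop) (auto intro: coeff_eq_0)

text \<open>The leading coefficient need not be computed: \<open>Lop\<close> multiplies the top
  coefficient of any polynomial by \<open>lam\<close> of its degree, so an eigenpolynomial for
  \<open>lam n\<close> has degree \<open>n\<close> because \<open>lam\<close> is injective.\<close>

lemma degree_jacp: "degree (jacp n) = n"
proof -
  have "coeff (Lop (jacp n)) (degree (jacp n)) = lam n * lead_coeff (jacp n)"
    by (simp add: Lop_jacp)
  hence "lam (degree (jacp n)) = lam n"
    unfolding coeff_Lop_top using jacp_nonzero by simp
  thus ?thesis by (rule lam_inj)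
qed

definition en :: "nat \<Rightarrow> real poly" where
  "en n = smult (1 / nrm (jacp n)) (jacp n)"

lemma nrm_jacp_pos: "0 < nrm (jacp n)"
  using ip_pos[OF jacp_nonzero] by (simp add: nrm_def)

lemma poly_en: "poly (en n) x = jacobi_normalized n a b x"
proof -
  have "ip (jacp n) (jacp n) = set_lebesgue_integral lborel {-1..1} (\<lambda>s. (jacobi n a b s)\<^sup>2 * jacobi_weight a b s)"
    by (simp add: ip_def wint_def poly_jacp power2_eq_square)
  thus ?thesis by (simp add: en_def jacobi_normalized_def nrm_def poly_jacp)
qed

lemma degree_en: "degree (en n) = n"
  using nrm_jacp_pos[of n] by (simp add: en_def degree_jacp)

lemma Lop_en: "Lop (en n) = smult (lam n) (en n)"
  by (simp add: en_def Lop_smult Lop_jacp)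

lemma ip_en: "ip (en m) (en n) = (if m = n then 1 else 0)"
proof (cases "m = n")
  case True
  then show ?thesis using nrm_jacp_pos[of n]
    by (simp add: en_def ip_smult_left ip_smult_right nrm_sq[of "jacp n", symmetric] power2_eq_square)
next
  case False
  have "lam m * ip (en m) (en n) = lam n * ip (en m) (en n)"
    using ip_Lop_commute[of "en m" "en n"] by (simp add: Lop_en ip_smult_left ip_smult_right)
  thus ?thesis using False lam_inj[of m n] by auto
qed

lemma en_span: "degree p \<le> N \<Longrightarrow> \<exists>c. p = (\<Sum>\<nu>\<le>N. smult (c \<nu>) (en \<nu>))"
proof (induction N arbitrary: p)
  case 0
  obtain d where d: "p = [:d:]" using 0 by (metis degree_eq_zeroE le_zero_eq)
  obtain e where e: "en 0 = [:e:]" using degree_en[of 0] by (metis degree_eq_zeroE)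
  have "e \<noteq> 0" using ip_en[of 0 0] e by (auto simp: pCons_0_0)
  hence "p = smult (d/e) (en 0)" by (simp add: d e)
  thus ?case by (intro exI[of _ "\<lambda>_. d/e"]) simp
next
  case (Suc N)
  define c where "c = coeff p (Suc N) / lead_coeff (en (Suc N))"
  have lc: "lead_coeff (en (Suc N)) \<noteq> 0"
    using degree_en[of "Suc N"] by (metis degree_0 leading_coeff_0_iff nat.distinct(1))
  define r where "r = p - smult c (en (Suc N))"
  have "degree r \<le> Suc N" unfolding r_def
    using Suc.prems by (intro degree_diff_le) (auto simp: degree_en)
  moreover have "coeff r (Suc N) = 0"
    using lc unfolding r_def c_def by (simp add: degree_en)
  ultimately have "degree r \<le> N"
    by (metis coeff_0 le_SucE degree_0 leading_coeff_0_iff zero_le)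
  from Suc.IH[OF this] obtain d where d: "r = (\<Sum>\<nu>\<le>N. smult (d \<nu>) (en \<nu>))" by blast
  have "p = (\<Sum>\<nu>\<le>Suc N. smult ((d(Suc N := c)) \<nu>) (en \<nu>))"
    using d unfolding r_def by (simp add: algebra_simps)
  thus ?case by blast
qed

lemma en_expand:
  assumes "degree p \<le> N"
  shows "p = (\<Sum>\<nu>\<le>N. smult (ip p (en \<nu>)) (en \<nu>))"
proof -
  obtain c where c: "p = (\<Sum>\<nu>\<le>N. smult (c \<nu>) (en \<nu>))" using en_span[OF assms] by blast
  have "ip p (en \<mu>) = c \<mu>" if "\<mu> \<le> N" for \<mu>
    unfolding c using that by (simp add: ip_sum_left ip_smult_left ip_en if_distrib cong: if_cong)
  thus ?thesis using c by (metis (mono_tags, lifting) atMost_iff sum.cong)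
qed

lemma ip_en_zero:
  assumes "degree p < n"
  shows "ip p (en n) = 0"
proof -
  have "ip p (en n) = ip (\<Sum>\<nu>\<le>degree p. smult (ip p (en \<nu>)) (en \<nu>)) (en n)"
    using en_expand[of p "degree p"] by simp
  also have "\<dots> = (\<Sum>\<nu>\<le>degree p. 0)"
    unfolding ip_sum_left ip_smult_left using assms by (intro sum.cong) (auto simp: ip_en)
  finally show ?thesis by simp
qed

lemma ip_parseval:
  assumes "degree p \<le> N"
  shows "ip p q = (\<Sum>\<nu>\<le>N. ip p (en \<nu>) * ip q (en \<nu>))"
  by (subst en_expand[OF assms]) (simp add: ip_sum_left ip_smult_left ip_commute[of q])

lemma ip_Lop_en: "ip (Lop p) (en \<nu>) = lam \<nu> * ip p (en \<nu>)"
  by (simp add: ip_Lop_commute Lop_en ip_smult_right)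

lemma degree_Lop: "degree (Lop p) \<le> degree p"
proof -
  have "Lop p = (\<Sum>\<nu>\<le>degree p. smult (ip p (en \<nu>) * lam \<nu>) (en \<nu>))"
    by (subst en_expand[OF order.refl]) (simp add: Lop_sum Lop_smult Lop_en)
  also have "degree \<dots> \<le> degree p"
    by (rule degree_sum_le) (auto intro: order.trans[OF degree_smult_le] simp: degree_en)
  finally show ?thesis .
qed

text \<open>By \<open>ip_Lop\<close> the left-hand side is the weighted integral of
  \<open>(1 - x^2) p'^2\<close>, so this is an L2 Bernstein inequality; it is immediate in the
  eigenbasis.\<close>

lemma Bernstein_energy:
  assumes "degree p \<le> D"
  shows "ip (Lop p) p \<le> lam D * ip p p"
proof -
  have "ip (Lop p) p = (\<Sum>\<nu>\<le>D. lam \<nu> * (ip p (en \<nu>))\<^sup>2)"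
    using degree_Lop[of p] assms
    by (subst ip_parseval[of _ D]) (auto simp: ip_Lop_en power2_eq_square algebra_simps)
  also have "\<dots> \<le> (\<Sum>\<nu>\<le>D. lam D * (ip p (en \<nu>))\<^sup>2)"
    by (intro sum_mono mult_right_mono lam_mono) auto
  also have "\<dots> = lam D * ip p p"
    by (subst (2) ip_parseval[OF assms]) (simp add: sum_distrib_left power2_eq_square)
  finally show ?thesis .
qed

lemma nrm_Lop:
  assumes "degree p \<le> D"
  shows "nrm (Lop p) \<le> lam D * nrm p"
proof -
  have "ip (Lop p) (Lop p) = (\<Sum>\<nu>\<le>D. (lam \<nu>)\<^sup>2 * (ip p (en \<nu>))\<^sup>2)"
    using degree_Lop[of p] assms
    by (subst ip_parseval[of _ D]) (auto simp: ip_Lop_en power2_eq_square algebra_simps)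
  also have "\<dots> \<le> (\<Sum>\<nu>\<le>D. (lam D)\<^sup>2 * (ip p (en \<nu>))\<^sup>2)"
    by (intro sum_mono mult_right_mono power_mono lam_mono lam_nonneg) auto
  also have "\<dots> = (lam D)\<^sup>2 * ip p p"
    by (subst (2) ip_parseval[OF assms]) (simp add: sum_distrib_left power2_eq_square)
  finally have "sqrt (ip (Lop p) (Lop p)) \<le> sqrt ((lam D)\<^sup>2 * ip p p)" by (rule real_sqrt_le_mono)
  thus ?thesis using lam_nonneg[of D] by (simp add: nrm_def real_sqrt_mult)
qed

end

section \<open>The Christoffel function\<close>

context jacobi_param
begin

lemma lam_le:
  assumes "1 \<le> D" shows "lam D \<le> (a + b + 2) * (real D)\<^sup>2"
proof -
  have Dp: "real D \<ge> 1" using assms by simp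
  have "real D * 1 + (a+b+1) * 1 \<le> real D * 1 + (a+b+1) * real D"
    using a_ge b_ge Dp by (intro add_mono mult_left_mono) auto
  hence "real D + a + b + 1 \<le> (a + b + 2) * real D" by (simp add: algebra_simps)
  hence "lam D \<le> real D * ((a + b + 2) * real D)" unfolding lam_def by (intro mult_left_mono) auto
  thus ?thesis by (simp add: power2_eq_square algebra_simps)
qed

text \<open>A one-dimensional Sobolev inequality on an interval of length \<open>sqrt (1 - x) / (2 * D)\<close>, on which the
  weight is essentially constant.\<close>

lemma interior_bound:
  assumes \<kappa>: "0 < \<kappa>"
  obtains C where "C > 0"
    and "\<And>D p x. \<lbrakk>1 \<le> D; degree p \<le> D; 0 \<le> x; \<kappa> / (real D)\<^sup>2 \<le> 1 - x\<rbrakk>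
      \<Longrightarrow> (poly p x)\<^sup>2 * (1 - x) powr (a + 1/2) \<le> C * real D * ip p p"
proof -
  \<comment> \<open>On \<open>[x - h, x]\<close> the quantity \<open>1 - u\<close> lies between
    \<open>1 - x\<close> and \<open>c1 * (1 - x)\<close>, and \<open>1 + u\<close> between
    \<open>1/2\<close> and \<open>2\<close>. The minima in \<open>c2\<close> and \<open>c3\<close>
    give lower bounds for the two factors of the weight for either sign of \<open>a\<close> and
    \<open>b\<close>.\<close>
  define c1 where "c1 = 1 + 1 / (2 * sqrt \<kappa>)"
  define c2 where "c2 = min 1 (c1 powr a)"
  define c3 where "c3 = min ((1/2) powr b) (2 powr b)"
  have c1: "c1 \<ge> 1" unfolding c1_def using \<kappa> by simp
  have c2: "c2 > 0" unfolding c2_def using c1 by simp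
  have c3: "c3 > 0" unfolding c3_def by simp
  define C where "C = 2 * (7/2 + a + b) / (c2 * c3)"
  have "C > 0" unfolding C_def using a_ge b_ge c2 c3 by (intro divide_pos_pos mult_pos_pos) auto
  moreover have "(poly p x)\<^sup>2 * (1 - x) powr (a + 1/2) \<le> C * real D * ip p p"
    if D: "1 \<le> D" and deg: "degree p \<le> D" and x0: "0 \<le> x" and x1: "\<kappa> / (real D)\<^sup>2 \<le> 1 - x" for D p x
  proof -
    have Dp: "real D \<ge> 1" using D by simp
    have "\<kappa> / (real D)\<^sup>2 > 0" using \<kappa> D by simp
    hence x: "1 - x > 0" using x1 by linarith
    define s where "s = sqrt (1 - x)"
    have s: "s > 0" "s \<le> 1" "s * s = 1 - x" unfolding s_def using x x0 by auto
    define h where "h = s / (2 * D)"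
    have h: "0 < h" unfolding h_def using s Dp by simp
    have "s / (2 * D) \<le> 1 / (2 * 1)" using s Dp by (intro frac_le) auto
    hence h2: "h \<le> 1/2" by (simp add: h_def)
    have h3: "h \<le> (1 - x) / (2 * sqrt \<kappa>)"
    proof -
      have "sqrt (\<kappa> / (real D)\<^sup>2) \<le> s" unfolding s_def using x1 by (rule real_sqrt_le_mono)
      hence "sqrt \<kappa> / D \<le> s" by (simp add: real_sqrt_divide)
      hence "sqrt \<kappa> \<le> s * D" using Dp by (simp add: pos_divide_le_eq)
      hence "sqrt \<kappa> * s \<le> s * D * s" using s by (intro mult_right_mono) auto
      hence "sqrt \<kappa> * s \<le> s * s * D" by (simp add: mult_ac)
      hence "h * (2 * sqrt \<kappa>) \<le> s * s" unfolding h_def using Dp by (simp add: pos_divide_le_eq mult_ac)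
      thus ?thesis unfolding s(3)[symmetric] using \<kappa> by (subst pos_le_divide_eq) auto
    qed
    let ?P = "poly p" and ?P' = "poly (pderiv p)"
    \<comment> \<open>Chosen to dominate the derivative \<open>?g'\<close> below, while its weighted
      integral is \<open>3/2 * ip p p + ip (Lop p) p / D^2\<close>, which
      \<open>Bernstein_energy\<close> bounds by a multiple of \<open>ip p p\<close>.\<close>
    define \<psi> where "\<psi> u = 3/2 * (?P u)\<^sup>2 + (1 - u\<^sup>2) * (?P' u)\<^sup>2 / (real D)\<^sup>2" for u
    define K where "K = c2 * c3 * (1-x) powr a"
    have K: "K > 0" unfolding K_def using c2 c3 x by simp
    \<comment> \<open>The linear factor is 0 at the left end of the interval and \<open>h\<close> at
      \<open>x\<close>, so integrating the derivative isolates \<open>h * (P x)^2\<close>.\<close>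
    let ?g = "\<lambda>u. (u - (x-h)) * (?P u)\<^sup>2"
    let ?g' = "\<lambda>u. (?P u)\<^sup>2 + (u - (x-h)) * (2 * ?P u * ?P' u)"
    have "(?g' has_integral (?g x - ?g (x-h))) {x-h..x}"
    proof (rule fundamental_theorem_of_calculus)
      fix u
      have "(?g has_real_derivative ((1 - 0) * (?P u)\<^sup>2 + (of_nat 2 * (?P' u * ?P u ^ (2 - Suc 0))) * (u - (x-h)))) (at u)"
        by (rule DERIV_mult[OF DERIV_diff[OF DERIV_ident DERIV_const] DERIV_power[OF poly_DERIV]])
      moreover have "(1 - 0) * (?P u)\<^sup>2 + (of_nat 2 * (?P' u * ?P u ^ (2 - Suc 0))) * (u - (x-h)) = ?g' u" by simp
      ultimately have "(?g has_real_derivative ?g' u) (at u)" by (rule DERIV_cong)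
      thus "(?g has_vector_derivative ?g' u) (at u within {x-h..x})"
        unfolding has_real_derivative_iff_has_vector_derivative[symmetric]
        by (rule has_field_derivative_at_within)
    qed (use h in auto)
    hence g: "(?g' has_integral (h * (?P x)\<^sup>2)) {x-h..x}" by simp
    have point: "?g' u \<le> (1/K) * (\<psi> u * jacobi_weight a b u)" if u: "u \<in> {x-h..x}" for u
    proof -
      have u1: "1 - x \<le> 1 - u" "1 - u \<le> c1 * (1-x)" "1/2 \<le> 1 + u" "1 + u \<le> 2" "0 \<le> u - (x-h)" "u - (x-h) \<le> h"
        using u h3 h2 x0 x unfolding c1_def by (auto simp: algebra_simps)
      have w1: "(1-u) powr a \<ge> c2 * (1-x) powr a"
      proof (cases "a \<ge> 0")
        case True
        have "c2 * (1-x) powr a \<le> 1 * (1-x) powr a" unfolding c2_def by (intro mult_right_mono) auto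
        also have "\<dots> \<le> (1-u) powr a" using u1 x True by (simp add: powr_mono2)
        finally show ?thesis .
      next
        case False
        have "c2 * (1-x) powr a \<le> c1 powr a * (1-x) powr a" unfolding c2_def by (intro mult_right_mono) auto
        also have "\<dots> = (c1 * (1-x)) powr a" using c1 x by (simp add: powr_mult)
        also have "\<dots> \<le> (1-u) powr a" using u1 x False by (intro powr_mono2') auto
        finally show ?thesis .
      qed
      have w2: "(1+u) powr b \<ge> c3"
      proof (cases "b \<ge> 0")
        case True
        have "(1/2) powr b \<le> (1+u) powr b" using u1 True by (intro powr_mono2) auto
        thus ?thesis unfolding c3_def by linarith
      next
        case False
        have "2 powr b \<le> (1+u) powr b" using u1 False by (intro powr_mono2') auto
        thus ?thesis unfolding c3_def by linarith
      qed
      have w: "K \<le> jacobi_weight a b u"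
        using mult_mono[OF w1 w2] c3 unfolding K_def jacobi_weight_def by (simp add: mult_ac)
      have uu: "(1 - x) / 2 \<le> 1 - u\<^sup>2"
      proof -
        have "(1 - x) * (1/2) \<le> (1-u) * (1+u)" using u1 x by (intro mult_mono) auto
        thus ?thesis by (simp add: algebra_simps power2_eq_square)
      qed
      \<comment> \<open>The inequality of arithmetic and geometric means, weighted so that
        multiplication by \<open>h = s / (2 * D)\<close> leaves \<open>1/2\<close> in front of
        \<open>P^2\<close> and \<open>(1 - x) / (2 * D^2)\<close> in front of
        \<open>P'^2\<close>.\<close>
      have am: "2 * \<bar>?P u * ?P' u\<bar> \<le> (D/s) * (?P u)\<^sup>2 + (s/D) * (?P' u)\<^sup>2"
      proof -
        have "0 \<le> (D/s) * (\<bar>?P u\<bar> - (s/D) * \<bar>?P' u\<bar>)\<^sup>2" using s Dp by simp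
        also have "\<dots> = (D/s) * \<bar>?P u\<bar>\<^sup>2 + (D/s) * (s/D) * (s/D) * \<bar>?P' u\<bar>\<^sup>2 - 2 * ((D/s) * (s/D)) * (\<bar>?P u\<bar> * \<bar>?P' u\<bar>)"
          by (simp only: power2_eq_square) (simp add: algebra_simps)
        also have "(D/s) * (s/D) = 1" using s Dp by simp
        finally have "0 \<le> (D/s) * (?P u)\<^sup>2 + (s/D) * (?P' u)\<^sup>2 - 2 * \<bar>?P u * ?P' u\<bar>"
          by (simp add: abs_mult)
        thus ?thesis by linarith
      qed
      have "(u - (x-h)) * (2 * ?P u * ?P' u) \<le> (u - (x-h)) * (2 * \<bar>?P u * ?P' u\<bar>)"
        using u1 by (intro mult_left_mono) auto
      also have "\<dots> \<le> h * ((D/s) * (?P u)\<^sup>2 + (s/D) * (?P' u)\<^sup>2)"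
        using u1 am by (intro mult_mono) auto
      also have "\<dots> = 1/2 * (?P u)\<^sup>2 + ((1-x)/2) * (?P' u)\<^sup>2 / (real D)\<^sup>2"
      proof -
        have "h * (D/s) = 1/2" "h * (s/D) = (s * s) / 2 / (real D)\<^sup>2"
          unfolding h_def using s Dp by (auto simp: power2_eq_square)
        note e = this
        have "h * (D/s * X + s/D * Z) = (h * (D/s)) * X + (h * (s/D)) * Z" for X Z
          by (simp only: distrib_left mult.assoc)
        thus ?thesis unfolding e unfolding s(3) by simp
      qed
      also have "\<dots> \<le> 1/2 * (?P u)\<^sup>2 + (1 - u\<^sup>2) * (?P' u)\<^sup>2 / (real D)\<^sup>2"
        using uu by (intro add_left_mono divide_right_mono mult_right_mono) auto
      finally have 1: "?g' u \<le> \<psi> u" unfolding \<psi>_def by simp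
      have "0 \<le> (1 - x) / 2" using x by simp
      hence "0 \<le> 1 - u\<^sup>2" using uu by linarith
      hence "0 \<le> \<psi> u" unfolding \<psi>_def by (intro add_nonneg_nonneg divide_nonneg_nonneg mult_nonneg_nonneg) auto
      hence "\<psi> u * K \<le> \<psi> u * jacobi_weight a b u" using w by (intro mult_left_mono) auto
      hence "\<psi> u \<le> (1/K) * (\<psi> u * jacobi_weight a b u)" using K by (simp add: field_simps)
      thus ?thesis using 1 by linarith
    qed
    have cont: "continuous_on {-1..1} \<psi>" unfolding \<psi>_def[abs_def] by (intro continuous_intros) (use Dp in auto)
    have int: "(\<lambda>u. (1/K) * (\<psi> u * jacobi_weight a b u)) integrable_on {-1..1}"
      using integrable_cmul[OF wint_eq_integral(1)[OF cont], of "1/K"] by simp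
    have int2: "(\<lambda>u. (1/K) * (\<psi> u * jacobi_weight a b u)) integrable_on {x-h..x}"
      by (rule integrable_on_subinterval[OF int]) (use h2 x0 x in auto)
    have "h * (?P x)\<^sup>2 \<le> integral {x-h..x} (\<lambda>u. (1/K) * (\<psi> u * jacobi_weight a b u))"
      using has_integral_le[OF g integrable_integral[OF int2]] point by auto
    also have "\<dots> \<le> integral {-1..1} (\<lambda>u. (1/K) * (\<psi> u * jacobi_weight a b u))"
    proof (rule integral_subset_le[OF _ int2 int])
      show "{x-h..x} \<subseteq> {-1..1}" using h2 x0 x by auto
      show "\<forall>u\<in>{-1..1}. 0 \<le> (1/K) * (\<psi> u * jacobi_weight a b u)"
      proof
        fix u :: real assume "u \<in> {-1..1}"
        hence "u\<^sup>2 \<le> 1" by (auto simp: abs_square_le_1)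
        hence "0 \<le> \<psi> u" unfolding \<psi>_def by (intro add_nonneg_nonneg divide_nonneg_nonneg mult_nonneg_nonneg) auto
        thus "0 \<le> (1/K) * (\<psi> u * jacobi_weight a b u)" using K by simp
      qed
    qed
    also have "\<dots> = wint a b \<psi> / K" unfolding integral_mult_right wint_eq_integral(2)[OF cont] by simp
    also have "wint a b \<psi> = 3/2 * ip p p + ip (Lop p) p / (real D)\<^sup>2"
    proof -
      have "wint a b \<psi> = wint a b (\<lambda>u. 3/2 * (poly p u * poly p u)
           + (1/(real D)\<^sup>2) * (poly ([:1, 0, -1:] * pderiv p) u * poly (pderiv p) u))"
        unfolding \<psi>_def[abs_def] power2_eq_square by (intro arg_cong[where f="wint a b"] ext) (simp add: algebra_simps diff_divide_distrib)
      also have "\<dots> = wint a b (\<lambda>u. 3/2 * (poly p u * poly p u))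
           + wint a b (\<lambda>u. (1/(real D)\<^sup>2) * (poly ([:1, 0, -1:] * pderiv p) u * poly (pderiv p) u))"
        by (rule wint_add) (intro continuous_intros)+
      finally have "wint a b \<psi> = wint a b (\<lambda>u. 3/2 * (poly p u * poly p u))
           + wint a b (\<lambda>u. (1/(real D)\<^sup>2) * (poly ([:1, 0, -1:] * pderiv p) u * poly (pderiv p) u))" .
      thus ?thesis unfolding wint_cmult unfolding ip_def[symmetric] unfolding ip_Lop[symmetric] by simp
    qed
    also have "\<dots> \<le> (7/2 + a + b) * ip p p"
    proof -
      have "lam D * ip p p \<le> (a + b + 2) * (real D)\<^sup>2 * ip p p"
        using lam_le[OF D] by (intro mult_right_mono ip_nonneg)
      with Bernstein_energy[OF deg] have "ip (Lop p) p \<le> (a + b + 2) * ip p p * (real D)\<^sup>2"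
        by (simp add: mult_ac)
      hence "ip (Lop p) p / (real D)\<^sup>2 \<le> (a + b + 2) * ip p p"
        using Dp by (subst pos_divide_le_eq) auto
      thus ?thesis by (simp add: algebra_simps)
    qed
    finally have "h * (?P x)\<^sup>2 \<le> (7/2 + a + b) * ip p p / K" using K by (simp add: divide_right_mono)
    hence 2: "K * h * (?P x)\<^sup>2 \<le> (7/2 + a + b) * ip p p" using K by (simp add: field_simps)
    have "(1 - x) powr (a + 1/2) = (1-x) powr a * s"
      unfolding s_def using x by (simp add: powr_add powr_half_sqrt)
    hence "K * h = (c2 * c3) * (1 - x) powr (a + 1/2) / (2 * D)"
      unfolding K_def h_def by simp
    with 2 have "(c2 * c3) * (1 - x) powr (a + 1/2) / (2 * D) * (?P x)\<^sup>2 \<le> (7/2 + a + b) * ip p p" by simp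
    hence "(?P x)\<^sup>2 * (1 - x) powr (a + 1/2) * (c2 * c3 / (2 * D)) \<le> (7/2 + a + b) * ip p p"
      by (simp add: mult_ac)
    moreover have "0 < c2 * c3 / (2 * D)" using c2 c3 Dp by simp
    ultimately have "(?P x)\<^sup>2 * (1 - x) powr (a + 1/2) \<le> ((7/2 + a + b) * ip p p) / (c2 * c3 / (2 * D))"
      by (subst pos_le_divide_eq) auto
    also have "\<dots> = C * real D * ip p p" unfolding C_def by simp
    finally show ?thesis .
  qed
  ultimately show thesis by (rule that)
qed

text \<open>Cauchy's mean value theorem for the flux \<open>\<Phi>\<close> and the comparison
  function \<open>\<Psi>\<close>, both of which vanish at 1; the possibly singular factor
  \<open>(1 - \<xi>) powr a\<close> cancels from the quotient of the derivatives.\<close>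

lemma pderiv_le_sup_Lop:
  assumes x: "0 \<le> x" "x < 1" and G: "\<And>t. \<lbrakk>x \<le> t; t \<le> 1\<rbrakk> \<Longrightarrow> \<bar>poly (Lop p) t\<bar> \<le> G"
  shows "\<bar>poly (pderiv p) x\<bar> \<le> 2 powr (b+1) / (a+1) * G"
proof -
  let ?w = "jacobi_weight a b"
  have pos: "0 < a + 1" "0 < b + 1" using a_ge b_ge by auto
  define \<Phi> where "\<Phi> t = (1-t) powr (a+1) * (1+t) powr (b+1) * poly (pderiv p) t" for t
  define \<Psi> where "\<Psi> t = (1-t) powr (a+1)" for t
  define H where "H t = \<Phi> t * \<Psi> x - \<Phi> x * \<Psi> t" for t
  have c\<Phi>: "continuous_on {x..1} \<Phi>"
    unfolding \<Phi>_def[abs_def] using pos x by (auto intro!: continuous_intros continuous_on_powr')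
  have c\<Psi>: "continuous_on {x..1} \<Psi>"
    unfolding \<Psi>_def[abs_def] using pos x by (auto intro!: continuous_intros continuous_on_powr')
  have cont: "continuous_on {x..1} H"
    unfolding H_def[abs_def] by (intro continuous_on_diff continuous_on_mult continuous_on_const c\<Phi> c\<Psi>)
  have d\<Phi>: "(\<Phi> has_real_derivative (- poly (Lop p) t * ?w t)) (at t)" if "x < t" "t < 1" for t
    unfolding \<Phi>_def[abs_def] by (rule flux_has_derivative) (use that x in auto)
  have d\<Psi>: "(\<Psi> has_real_derivative (- (a+1) * (1-t) powr a)) (at t)" if t: "x < t" "t < 1" for t
    unfolding \<Psi>_def[abs_def] using t by (auto intro!: derivative_eq_intros simp: algebra_simps)
  have dH: "(H has_real_derivative (- poly (Lop p) t * ?w t) * \<Psi> x - \<Phi> x * (- (a+1) * (1-t) powr a)) (at t)"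
    if t: "x < t" "t < 1" for t
    unfolding H_def[abs_def] by (intro DERIV_diff DERIV_cmult DERIV_cmult_right d\<Phi> d\<Psi> t)
  have "H x = H 1" unfolding H_def \<Phi>_def \<Psi>_def using pos by simp
  then obtain \<xi> where \<xi>: "x < \<xi>" "\<xi> < 1" and "(H has_real_derivative 0) (at \<xi>)"
    using Rolle[OF x(2) _ cont] dH real_differentiable_def by blast
  hence "(- poly (Lop p) \<xi> * ?w \<xi>) * \<Psi> x - \<Phi> x * (- (a+1) * (1-\<xi>) powr a) = 0"
    using dH[OF \<xi>] DERIV_unique by blast
  hence "(1-\<xi>) powr a * (1-x) powr (a+1) * ((1+\<xi>) powr b * poly (Lop p) \<xi>)
    = (1-\<xi>) powr a * (1-x) powr (a+1) * ((a+1) * (1+x) powr (b+1) * poly (pderiv p) x)"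
    unfolding \<Phi>_def \<Psi>_def jacobi_weight_def by (simp add: algebra_simps)
  hence "(1+\<xi>) powr b * poly (Lop p) \<xi> = (a+1) * (1+x) powr (b+1) * poly (pderiv p) x"
    using \<xi> x by simp
  hence e: "(a+1) * (1+x) powr (b+1) * \<bar>poly (pderiv p) x\<bar> = (1+\<xi>) powr b * \<bar>poly (Lop p) \<xi>\<bar>"
    using pos by (metis abs_mult abs_of_nonneg less_imp_le powr_ge_zero)
  have x1: "1 \<le> (1+x) powr (b+1)" using x pos by (simp add: ge_one_powr_ge_zero)
  have "(1+\<xi>) powr b \<le> 2 powr (b+1)"
  proof (cases "b \<ge> 0")
    case True
    have "(1+\<xi>) powr b \<le> 2 powr b" using True \<xi> x by (intro powr_mono2) auto
    also have "\<dots> \<le> 2 powr (b+1)" by simp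
    finally show ?thesis .
  next
    case False
    have "(1+\<xi>) powr b \<le> 1 powr b" using False \<xi> x by (intro powr_mono2') auto
    also have "\<dots> \<le> 2 powr (b+1)" using pos by (simp add: ge_one_powr_ge_zero)
    finally show ?thesis .
  qed
  have "(a+1) * 1 * \<bar>poly (pderiv p) x\<bar> \<le> (a+1) * (1+x) powr (b+1) * \<bar>poly (pderiv p) x\<bar>"
    using pos x1 by (intro mult_right_mono mult_left_mono) auto
  also have "\<dots> \<le> 2 powr (b+1) * G"
    unfolding e using G[of \<xi>] \<xi> \<open>(1+\<xi>) powr b \<le> 2 powr (b+1)\<close> by (intro mult_mono) auto
  finally show ?thesis using pos by (simp add: field_simps)
qed

lemma ip_en_le_nrm: "\<bar>ip p (en \<nu>)\<bar> \<le> nrm p"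
  using ip_Cauchy_Schwarz[of p "en \<nu>"] by (simp add: nrm_def ip_en)

text \<open>Within distance of order \<open>1 / D\<^sup>2\<close> of the endpoint, the eigenvalue equation gives
  \<open>\<bar>p'\<bar> \<lesssim> sup \<bar>Lop p\<bar>\<close>; since \<open>Lop\<close> maps polynomials of degree \<open>D\<close> to themselves with norm of order \<open>D\<^sup>2\<close>,
  the best constant \<open>Z\<close> in the estimate satisfies \<open>Z \<le> Y + Z / 2\<close>.\<close>

lemma endpoint_bound:
  assumes D: "1 \<le> D" and \<kappa>: "0 < \<kappa>" "\<kappa> \<le> 1"
    and small: "2 powr (b+1) / (a+1) * \<kappa> * (a+b+2) \<le> 1/2"
    and Y: "\<And>p. degree p \<le> D \<Longrightarrow> \<bar>poly p (1 - \<kappa> / (real D)\<^sup>2)\<bar> \<le> Y * nrm p"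
    and p: "degree p \<le> D" and x: "1 - \<kappa> / (real D)\<^sup>2 \<le> x" "x \<le> 1"
  shows "\<bar>poly p x\<bar> \<le> 2 * Y * nrm p"
proof -
  define \<delta> where "\<delta> = \<kappa> / (real D)\<^sup>2"
  define x0 where "x0 = 1 - \<delta>"
  define C1 where "C1 = 2 powr (b+1) / (a+1)"
  have C1: "C1 > 0" unfolding C1_def using a_ge by simp
  have D2: "(real D)\<^sup>2 \<ge> 1" using D by simp
  have \<delta>: "0 < \<delta>" "\<delta> \<le> 1" unfolding \<delta>_def using \<kappa> D order.trans[OF \<kappa>(2) D2] by (auto simp: divide_le_eq)
  have Yx0: "\<bar>poly p x0\<bar> \<le> Y * nrm p" if "degree p \<le> D" for p
    using Y[OF that] by (simp add: x0_def \<delta>_def)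
  define S where "S = {\<bar>poly p x\<bar> | p x. degree p \<le> D \<and> nrm p \<le> 1 \<and> x0 \<le> x \<and> x \<le> 1}"
  have "\<forall>\<nu>. \<exists>K. \<forall>x\<in>{x0..1}. \<bar>poly (en \<nu>) x\<bar> \<le> K"
  proof
    fix \<nu>
    have "compact (poly (en \<nu>) ` {x0..1})" by (intro compact_continuous_image continuous_intros) auto
    thus "\<exists>K. \<forall>x\<in>{x0..1}. \<bar>poly (en \<nu>) x\<bar> \<le> K"
      using compact_imp_bounded bounded_iff by (metis (no_types, lifting) imageI real_norm_def)
  qed
  then obtain K where K: "\<And>\<nu> x. x \<in> {x0..1} \<Longrightarrow> \<bar>poly (en \<nu>) x\<bar> \<le> K \<nu>" by metis
  \<comment> \<open>Finiteness of the supremum has to be known before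
    \<open>Z \<le> Y + Z / 2\<close> can be solved for \<open>Z\<close>; any bound will do, here one
    from the expansion in the finitely many \<open>en\<close>.\<close>
  have bdd: "bdd_above S"
  proof (rule bdd_aboveI)
    fix v assume "v \<in> S"
    then obtain p x where v: "v = \<bar>poly p x\<bar>" and p: "degree p \<le> D" "nrm p \<le> 1" and x: "x \<in> {x0..1}"
      unfolding S_def by auto
    have "poly p x = (\<Sum>\<nu>\<le>D. ip p (en \<nu>) * poly (en \<nu>) x)"
      by (subst en_expand[OF p(1)]) (simp add: poly_sum)
    also have "\<bar>\<dots>\<bar> \<le> (\<Sum>\<nu>\<le>D. \<bar>ip p (en \<nu>)\<bar> * \<bar>poly (en \<nu>) x\<bar>)"
      using sum_abs[of "\<lambda>\<nu>. ip p (en \<nu>) * poly (en \<nu>) x" "{..D}"] by (simp add: abs_mult)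
    also have "\<dots> \<le> (\<Sum>\<nu>\<le>D. 1 * K \<nu>)"
      using K[OF x] p(2) ip_en_le_nrm[of p] by (intro sum_mono mult_mono) (auto intro: order.trans)
    finally show "v \<le> (\<Sum>\<nu>\<le>D. 1 * K \<nu>)" using v by simp
  qed
  have ne: "S \<noteq> {}" unfolding S_def using \<delta> by (auto simp: x0_def intro!: exI[of _ "0::real poly"] exI[of _ "1::real"])
  define Z where "Z = Sup S"
  have Zle: "\<bar>poly p x\<bar> \<le> Z" if "degree p \<le> D" "nrm p \<le> 1" "x0 \<le> x" "x \<le> 1" for p x
    unfolding Z_def by (rule cSup_upper[OF _ bdd]) (use that in \<open>auto simp: S_def\<close>)
  have Z0: "0 \<le> Z" using Zle[of 0 1] \<delta> by (auto simp: x0_def)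
  have Ynn: "0 \<le> Y" using Yx0[of "en 0"] by (simp add: degree_en nrm_def ip_en)
  have lamp: "lam D > 0" using lam_strict[of 0 D] D by (simp add: lam_def)
  have step: "\<bar>poly p x\<bar> \<le> Y + Z/2" if p: "degree p \<le> D" "nrm p \<le> 1" and x: "x0 \<le> x" "x \<le> 1" for p x
  proof -
    have LZ: "\<bar>poly (Lop p) t\<bar> \<le> lam D * Z" if "x0 \<le> t" "t \<le> 1" for t
    proof -
      \<comment> \<open>By \<open>nrm_Lop\<close> this rescaled image of \<open>p\<close> lies again
        in the unit ball that defines \<open>S\<close>, so the unknown constant \<open>Z\<close>
        controls \<open>Lop p\<close> as well.\<close>
      define q where "q = smult (1/lam D) (Lop p)"
      have "degree q \<le> D" unfolding q_def using degree_Lop[of p] p by (intro order.trans[OF degree_smult_le]) auto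
      moreover have "nrm q \<le> 1"
      proof -
        have "nrm (Lop p) \<le> lam D * 1"
          using nrm_Lop[OF p(1)] mult_left_mono[OF p(2), of "lam D"] lamp by linarith
        thus ?thesis unfolding q_def nrm_smult using lamp by (simp add: field_simps)
      qed
      ultimately have "\<bar>poly q t\<bar> \<le> Z" using Zle that by blast
      thus ?thesis unfolding q_def using lamp by (simp add: abs_mult field_simps)
    qed
    have d: "\<bar>poly (pderiv p) t\<bar> \<le> C1 * (lam D * Z)" if "x0 \<le> t" "t < 1" for t
      unfolding C1_def by (rule pderiv_le_sup_Lop) (use that LZ \<delta> in \<open>auto simp: x0_def\<close>)
    have diff: "\<bar>poly p x - poly p x0\<bar> \<le> \<delta> * (C1 * (lam D * Z))"
    proof (cases "x = x0")
      case False
      hence "x0 < x" using x by simp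
      then obtain z where z: "x0 < z" "z < x" "poly p x - poly p x0 = (x - x0) * poly (pderiv p) z"
        using poly_MVT by blast
      show ?thesis unfolding z(3) abs_mult
        using z x d[of z] by (intro mult_mono) (auto simp: x0_def)
    qed (use \<delta> C1 lamp Z0 in simp)
    have "\<delta> * (C1 * (lam D * Z)) = (\<delta> * C1 * lam D) * Z" by simp
    also have "\<dots> \<le> 1/2 * Z"
    proof (rule mult_right_mono[OF _ Z0])
      have "\<delta> * C1 * lam D \<le> \<delta> * C1 * ((a+b+2) * (real D)\<^sup>2)"
        using lam_le[OF D] \<delta> C1 by (intro mult_left_mono) auto
      also have "\<dots> = C1 * \<kappa> * (a+b+2)" unfolding \<delta>_def using D by (simp add: field_simps)
      finally show "\<delta> * C1 * lam D \<le> 1/2" using small unfolding C1_def by linarith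
    qed
    finally have "\<bar>poly p x\<bar> \<le> \<bar>poly p x0\<bar> + Z/2" using diff by linarith
    also have "\<bar>poly p x0\<bar> \<le> Y * 1"
      using Yx0[OF p(1)] mult_left_mono[OF p(2) Ynn] by linarith
    finally show ?thesis by simp
  qed
  have "Sup S \<le> Y + Z/2"
    by (rule cSup_least[OF ne]) (use step in \<open>auto simp: S_def\<close>)
  hence "Z \<le> Y + Z/2" by (simp add: Z_def)
  hence Z2: "Z \<le> 2 * Y" by simp
  show ?thesis
  proof (cases "p = 0")
    case False
    hence np: "nrm p > 0" using ip_pos[of p] by (simp add: nrm_def)
    define q where "q = smult (1 / nrm p) p"
    have "\<bar>poly q x\<bar> \<le> Z"
      using p x np by (intro Zle) (auto simp: q_def nrm_smult x0_def \<delta>_def)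
    hence "\<bar>poly p x\<bar> \<le> Z * nrm p" unfolding q_def using np by (simp add: abs_mult field_simps)
    also have "\<dots> \<le> 2 * Y * nrm p" using Z2 np by (intro mult_right_mono) auto
    finally show ?thesis .
  qed simp
qed

text \<open>The width \<open>\<kappa> / D^2\<close> of the boundary layer is small enough for
  \<open>endpoint_bound\<close>. Outside the layer, adding \<open>1 / D^2\<close> to
  \<open>1 - x\<close> changes it only by a constant factor; inside, \<open>endpoint_bound\<close>
  carries over the estimate at the layer's edge, where both quantities are of order
  \<open>1 / D^2\<close>.\<close>

lemma right_half_bound:
  obtains C where "C > 0"
    and "\<And>D p x. \<lbrakk>1 \<le> D; degree p \<le> D; 0 \<le> x; x \<le> 1\<rbrakk>
      \<Longrightarrow> (poly p x)\<^sup>2 * (1 - x + 1 / (real D)\<^sup>2) powr (a + 1/2) \<le> C * real D * ip p p"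
proof -
  define C1 where "C1 = 2 powr (b+1) / (a+1) * (a+b+2)"
  have C1: "C1 > 0" unfolding C1_def using a_ge b_ge by simp
  define \<kappa> where "\<kappa> = min 1 (1 / (2 * C1))"
  have \<kappa>: "0 < \<kappa>" "\<kappa> \<le> 1" "C1 * \<kappa> \<le> 1/2"
    unfolding \<kappa>_def using C1 by (auto simp: min_def field_simps)
  from interior_bound[OF \<kappa>(1)] obtain C where C: "C > 0"
    and int: "\<And>D p x. \<lbrakk>1 \<le> D; degree p \<le> D; 0 \<le> x; \<kappa> / (real D)\<^sup>2 \<le> 1 - x\<rbrakk>
      \<Longrightarrow> (poly p x)\<^sup>2 * (1 - x) powr (a + 1/2) \<le> C * real D * ip p p" by blast
  define c where "c = a + 1/2"
  have c: "c \<ge> 0" using a_ge by (simp add: c_def)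
  define C' where "C' = 4 * C * (2/\<kappa>) powr c + C * (1 + 1/\<kappa>) powr c"
  have "C' > 0" unfolding C'_def using C \<kappa> by (intro add_pos_nonneg) auto
  moreover have "(poly p x)\<^sup>2 * (1 - x + 1 / (real D)\<^sup>2) powr (a + 1/2) \<le> C' * real D * ip p p"
    if D: "1 \<le> D" and p: "degree p \<le> D" and x: "0 \<le> x" "x \<le> 1" for D p x
  proof -
    have Dp: "real D \<ge> 1" using D by simp
    define \<delta> where "\<delta> = 1 / (real D)\<^sup>2"
    have \<delta>: "0 < \<delta>" "\<delta> \<le> 1" unfolding \<delta>_def using Dp by (auto simp: field_simps)
    have DI: "0 \<le> real D * ip p p" using ip_nonneg by simp
    show ?thesis
    proof (cases "\<kappa> / (real D)\<^sup>2 \<le> 1 - x")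
      case True
      hence t: "\<kappa> * \<delta> \<le> 1 - x" by (simp add: \<delta>_def)
      have x1: "0 < 1 - x" using t \<delta> \<kappa> mult_pos_pos[of \<kappa> \<delta>] by linarith
      have "\<delta> \<le> (1-x) / \<kappa>" using t \<kappa> by (simp add: field_simps)
      hence "1 - x + \<delta> \<le> (1 + 1/\<kappa>) * (1 - x)" by (simp add: algebra_simps)
      hence "(1 - x + \<delta>) powr c \<le> ((1 + 1/\<kappa>) * (1 - x)) powr c"
        using x1 \<delta> c by (intro powr_mono2) auto
      also have "\<dots> = (1 + 1/\<kappa>) powr c * (1 - x) powr c"
        using \<kappa> x1 by (simp add: powr_mult)
      finally have "(poly p x)\<^sup>2 * (1 - x + \<delta>) powr c \<le> (poly p x)\<^sup>2 * ((1 + 1/\<kappa>) powr c * (1 - x) powr c)"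
        by (intro mult_left_mono) auto
      also have "\<dots> = (1 + 1/\<kappa>) powr c * ((poly p x)\<^sup>2 * (1 - x) powr c)" by simp
      also have "\<dots> \<le> (1 + 1/\<kappa>) powr c * (C * real D * ip p p)"
        using int[OF D p x(1) True] by (intro mult_left_mono) (auto simp: c_def)
      also have "\<dots> = (C * (1 + 1/\<kappa>) powr c) * (real D * ip p p)" by simp
      also have "\<dots> \<le> C' * (real D * ip p p)"
        unfolding C'_def using C by (intro mult_right_mono DI) auto
      finally show ?thesis by (simp add: c_def \<delta>_def mult_ac)
    next
      case False
      define Y where "Y = sqrt (C * real D / (\<kappa> * \<delta>) powr c)"
      have \<kappa>\<delta>: "0 < \<kappa> * \<delta>" "\<kappa> * \<delta> \<le> 1" using \<kappa> \<delta> by (auto simp: mult_le_one)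
      have YY: "\<bar>poly q (1 - \<kappa> / (real D)\<^sup>2)\<bar> \<le> Y * nrm q" if q: "degree q \<le> D" for q
      proof -
        have "(poly q (1 - \<kappa>*\<delta>))\<^sup>2 * (1 - (1 - \<kappa> * \<delta>)) powr (a + 1/2) \<le> C * real D * ip q q"
          by (rule int[OF D q]) (use \<kappa>\<delta> in \<open>auto simp: \<delta>_def\<close>)
        hence "(poly q (1 - \<kappa>*\<delta>))\<^sup>2 * (\<kappa> * \<delta>) powr c \<le> C * real D * ip q q" by (simp add: c_def)
        moreover have "(\<kappa> * \<delta>) powr c > 0" using \<kappa> \<delta> by simp
        ultimately have "(poly q (1 - \<kappa>*\<delta>))\<^sup>2 \<le> (C * real D / (\<kappa> * \<delta>) powr c) * ip q q"
          by (simp add: field_simps)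
        hence "sqrt ((poly q (1 - \<kappa>*\<delta>))\<^sup>2) \<le> sqrt ((C * real D / (\<kappa> * \<delta>) powr c) * ip q q)"
          by (rule real_sqrt_le_mono)
        thus ?thesis unfolding Y_def nrm_def real_sqrt_mult by (simp add: \<delta>_def)
      qed
      have "\<bar>poly p x\<bar> \<le> 2 * Y * nrm p"
      proof (rule endpoint_bound[OF D \<kappa>(1,2) _ YY p _ x(2)])
        show "2 powr (b + 1) / (a + 1) * \<kappa> * (a + b + 2) \<le> 1 / 2" using \<kappa>(3) by (simp add: C1_def mult_ac)
        show "1 - \<kappa> / (real D)\<^sup>2 \<le> x" using False by simp
      qed
      hence "(poly p x)\<^sup>2 \<le> (2 * Y * nrm p)\<^sup>2" using power_mono[of "\<bar>poly p x\<bar>" "2 * Y * nrm p" 2] by simp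
      also have "\<dots> = 4 * (C * real D / (\<kappa> * \<delta>) powr c) * ip p p"
        unfolding power_mult_distrib nrm_sq Y_def using C by simp
      finally have 1: "(poly p x)\<^sup>2 \<le> 4 * (C * real D / (\<kappa> * \<delta>) powr c) * ip p p" .
      have "1 - x + \<delta> \<le> (2/\<kappa>) * (\<kappa> * \<delta>)" using False \<kappa> mult_right_mono[OF \<kappa>(2), of \<delta>] \<delta> by (simp add: \<delta>_def)
      hence "(1 - x + \<delta>) powr c \<le> ((2/\<kappa>) * (\<kappa> * \<delta>)) powr c"
        using x \<delta> c by (intro powr_mono2) auto
      also have "\<dots> = (2/\<kappa>) powr c * (\<kappa> * \<delta>) powr c" by (rule powr_mult)
      finally have 2: "(1 - x + \<delta>) powr c \<le> (2/\<kappa>) powr c * (\<kappa> * \<delta>) powr c" .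
      have "(poly p x)\<^sup>2 * (1 - x + \<delta>) powr c
         \<le> 4 * (C * real D / (\<kappa> * \<delta>) powr c) * ip p p * ((2/\<kappa>) powr c * (\<kappa> * \<delta>) powr c)"
        using C ip_nonneg[of p] by (intro mult_mono 1 2) auto
      also have "\<dots> = (4 * C * (2/\<kappa>) powr c) * (real D * ip p p)"
        using \<kappa> \<delta> by simp
      also have "\<dots> \<le> C' * (real D * ip p p)"
        unfolding C'_def using C by (intro mult_right_mono DI) auto
      finally show ?thesis by (simp add: c_def \<delta>_def mult_ac)
    qed
  qed
  ultimately show thesis by (rule that)
qed

definition wn :: "nat \<Rightarrow> real \<Rightarrow> real" where
  "wn n x = (1 - x + 1 / (real n)\<^sup>2) powr (a + 1/2) * (1 + x + 1 / (real n)\<^sup>2) powr (b + 1/2)"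

text \<open>The reflection of the interval exchanges the two exponents; it reduces the left half to
  \<open>right_half_bound\<close> with \<open>a\<close> and \<open>b\<close> interchanged.\<close>

lemma ip_reflect:
  "ip p q = wint b a (\<lambda>x. poly (pcompose p [:0, -1:]) x * poly (pcompose q [:0, -1:]) x)"
proof -
  have "ip p q = (\<integral>x. indicator {-1..1} x *\<^sub>R (poly p x * poly q x * jacobi_weight a b x) \<partial>lborel)"
    by (simp add: ip_def wint_def set_lebesgue_integral_def)
  also have "\<dots> = (\<integral>x. indicator {-1..1} (0 + (-1) * x) *\<^sub>R (poly p (0 + (-1) * x) * poly q (0 + (-1) * x) * jacobi_weight a b (0 + (-1) * x)) \<partial>lborel)"
    by (subst lborel_integral_real_affine[where c="-1" and t=0]) auto
  also have "\<dots> = wint b a (\<lambda>x. poly (pcompose p [:0, -1:]) x * poly (pcompose q [:0, -1:]) x)"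
    unfolding wint_def set_lebesgue_integral_def
    by (intro Bochner_Integration.integral_cong)
       (auto simp: indicator_def poly_pcompose jacobi_weight_def)
  finally show ?thesis .
qed

text \<open>On each half of the interval the estimate is \<open>right_half_bound\<close> for the
  nearer endpoint; the base of the other factor of \<open>wn\<close> is at most 3.\<close>

lemma Christoffel_bound:
  obtains C where "C > 0"
    and "\<And>D p x. \<lbrakk>1 \<le> D; degree p \<le> D; -1 \<le> x; x \<le> 1\<rbrakk>
      \<Longrightarrow> (poly p x)\<^sup>2 * wn D x \<le> C * real D * ip p p"
proof -
  interpret sw: jacobi_param b a by unfold_locales (use a_ge b_ge in auto)
  obtain Ca where Ca: "Ca > 0" "\<And>D p x. \<lbrakk>1 \<le> D; degree p \<le> D; 0 \<le> x; x \<le> 1\<rbrakk>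
      \<Longrightarrow> (poly p x)\<^sup>2 * (1 - x + 1 / (real D)\<^sup>2) powr (a + 1/2) \<le> Ca * real D * ip p p"
    using right_half_bound by blast
  obtain Cb where Cb: "Cb > 0" "\<And>D p x. \<lbrakk>1 \<le> D; degree p \<le> D; 0 \<le> x; x \<le> 1\<rbrakk>
      \<Longrightarrow> (poly p x)\<^sup>2 * (1 - x + 1 / (real D)\<^sup>2) powr (b + 1/2) \<le> Cb * real D * sw.ip p p"
    using sw.right_half_bound by blast
  define C where "C = Ca * 3 powr (b+1/2) + Cb * 3 powr (a+1/2)"
  have "C > 0" unfolding C_def using Ca Cb by (intro add_pos_pos) auto
  moreover have "(poly p x)\<^sup>2 * wn D x \<le> C * real D * ip p p"
    if D: "1 \<le> D" and p: "degree p \<le> D" and x: "-1 \<le> x" "x \<le> 1" for D p x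
  proof -
    have \<delta>: "0 < 1 / (real D)\<^sup>2" "1 / (real D)\<^sup>2 \<le> 1" using D by auto
    have DI: "0 \<le> real D * ip p p" using ip_nonneg by simp
    have \<delta>x: "1 + x + 1 / (real D)\<^sup>2 \<le> 3" "1 - x + 1 / (real D)\<^sup>2 \<le> 3" "0 \<le> 1 + x + 1 / (real D)\<^sup>2" "0 \<le> 1 - x + 1 / (real D)\<^sup>2"
      using x \<delta> by linarith+
    show ?thesis
    proof (cases "0 \<le> x")
      case True
      have "(1 + x + 1 / (real D)\<^sup>2) powr (b + 1/2) \<le> 3 powr (b + 1/2)"
        using b_ge by (intro powr_mono2 \<delta>x) auto
      hence "(poly p x)\<^sup>2 * (1 - x + 1 / (real D)\<^sup>2) powr (a + 1/2) * (1 + x + 1 / (real D)\<^sup>2) powr (b + 1/2)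
        \<le> (Ca * real D * ip p p) * 3 powr (b + 1/2)"
        using Ca DI by (intro mult_mono Ca(2) D p True x) (auto simp: mult.assoc)
      also have "\<dots> = (Ca * 3 powr (b + 1/2)) * (real D * ip p p)" by simp
      also have "\<dots> \<le> C * (real D * ip p p)" unfolding C_def using Cb by (intro mult_right_mono DI) auto
      finally show ?thesis by (simp add: wn_def mult_ac)
    next
      case False
      define q where "q = pcompose p [:0, -1:]"
      have q: "degree q \<le> D" unfolding q_def using p by (simp add: degree_pcompose)
      have qx: "poly q (-x) = poly p x" by (simp add: q_def poly_pcompose)
      have qi: "sw.ip q q = ip p p" unfolding sw.ip_def ip_reflect q_def ..
      have "(1 - x + 1 / (real D)\<^sup>2) powr (a + 1/2) \<le> 3 powr (a + 1/2)"
        using a_ge by (intro powr_mono2 \<delta>x) auto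
      moreover have "(poly q (-x))\<^sup>2 * (1 - (-x) + 1 / (real D)\<^sup>2) powr (b + 1/2) \<le> Cb * real D * sw.ip q q"
        by (rule Cb(2)[OF D q]) (use False x in auto)
      ultimately have "(poly p x)\<^sup>2 * (1 + x + 1 / (real D)\<^sup>2) powr (b + 1/2) * (1 - x + 1 / (real D)\<^sup>2) powr (a + 1/2)
        \<le> (Cb * real D * ip p p) * 3 powr (a + 1/2)"
        unfolding qx qi by (intro mult_mono[of "_ * _" "_ * _ * _"]) (use Cb(1) DI in \<open>auto simp: mult.assoc\<close>)
      also have "\<dots> = (Cb * 3 powr (a + 1/2)) * (real D * ip p p)" by simp
      also have "\<dots> \<le> C * (real D * ip p p)" unfolding C_def using Ca by (intro mult_right_mono DI) auto
      finally show ?thesis by (simp add: wn_def mult_ac)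
    qed
  qed
  ultimately show thesis by (rule that)
qed

end

section \<open>Chebyshev multipliers and the wave propagator\<close>

fun cheb :: "nat \<Rightarrow> real poly" where
  "cheb 0 = 1"
| "cheb (Suc 0) = [:0, 1:]"
| "cheb (Suc (Suc n)) = [:0, 2:] * cheb (Suc n) - cheb n"

lemma poly_cheb_cos: "poly (cheb n) (cos \<theta>) = cos (real n * \<theta>)"
proof (induction n rule: cheb.induct)
  case (3 n)
  have 1: "cos (real (Suc (Suc n)) * \<theta>) = cos (real (Suc n) * \<theta> + \<theta>)"
    and 2: "cos (real n * \<theta>) = cos (real (Suc n) * \<theta> - \<theta>)"
    by (simp_all add: algebra_simps)
  have "cos (real (Suc (Suc n)) * \<theta>) + cos (real n * \<theta>) = 2 * cos \<theta> * cos (real (Suc n) * \<theta>)"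
    unfolding 1 2 cos_add cos_diff by simp
  then show ?case using 3 by (simp only: cheb.simps poly_diff poly_mult) simp
qed simp_all

lemma degree_cheb: "degree (cheb n) \<le> n"
proof (induction n rule: cheb.induct)
  case (3 n)
  have "degree ([:0, 2:] * cheb (Suc n)) \<le> Suc (Suc n)"
    using degree_mult_le[of "[:0, 2:]" "cheb (Suc n)"] 3 by simp
  then show ?case using 3 by (simp only: cheb.simps) (intro degree_diff_le, auto)
qed simp_all

lemma cos_arccos_Icc:
  assumes "x \<in> {-1..1}"
  obtains \<theta> where "x = cos \<theta>" "0 \<le> \<theta>" "\<theta> \<le> pi"
  using assms by (intro that[of "arccos x"]) (auto simp: arccos_lbound arccos_ubound)

lemma cheb_abs_le: "x \<in> {-1..1} \<Longrightarrow> \<bar>poly (cheb n) x\<bar> \<le> 1"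
  by (erule cos_arccos_Icc) (simp add: poly_cheb_cos)

lemma abs_sin_mult_le: "\<bar>sin (real n * \<theta>)\<bar> \<le> real n * \<bar>sin \<theta>\<bar>"
proof (induction n)
  case (Suc n)
  have "sin (real (Suc n) * \<theta>) = sin (real n * \<theta>) * cos \<theta> + cos (real n * \<theta>) * sin \<theta>"
    by (simp add: distrib_right sin_add add.commute)
  also have "\<bar>\<dots>\<bar> \<le> \<bar>sin (real n * \<theta>)\<bar> * \<bar>cos \<theta>\<bar> + \<bar>cos (real n * \<theta>)\<bar> * \<bar>sin \<theta>\<bar>"
    by (metis abs_mult abs_triangle_ineq)
  also have "\<dots> \<le> \<bar>sin (real n * \<theta>)\<bar> * 1 + 1 * \<bar>sin \<theta>\<bar>"
    by (intro add_mono mult_mono) auto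
  finally show ?case using Suc by (simp add: algebra_simps)
qed simp

lemma pderiv_cheb_cos: "poly (pderiv (cheb n)) (cos \<theta>) * sin \<theta> = real n * sin (real n * \<theta>)"
proof -
  have "((\<lambda>\<theta>. poly (cheb n) (cos \<theta>)) has_real_derivative (poly (pderiv (cheb n)) (cos \<theta>) * (- sin \<theta>))) (at \<theta>)"
    by (rule DERIV_chain2[OF poly_DERIV DERIV_cos])
  moreover have "((\<lambda>\<theta>. poly (cheb n) (cos \<theta>)) has_real_derivative (- sin (real n * \<theta>) * real n)) (at \<theta>)"
    unfolding poly_cheb_cos by (auto intro!: derivative_eq_intros)
  ultimately have "poly (pderiv (cheb n)) (cos \<theta>) * (- sin \<theta>) = - sin (real n * \<theta>) * real n"
    by (rule DERIV_unique)
  thus ?thesis by simp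
qed

text \<open>Chebyshev's differential equation, from differentiating \<open>pderiv_cheb_cos\<close>.
  It shows that \<open>(1 - x^2) * Q''\<close> is of order \<open>n^2\<close>, although
  \<open>Q''\<close> alone grows like \<open>n^4\<close> at the endpoints.\<close>

lemma pderiv2_cheb_cos:
  "(sin \<theta>)\<^sup>2 * poly (pderiv (pderiv (cheb n))) (cos \<theta>) =
     cos \<theta> * poly (pderiv (cheb n)) (cos \<theta>) - (real n)\<^sup>2 * cos (real n * \<theta>)"
proof -
  have "((\<lambda>\<theta>. poly (pderiv (cheb n)) (cos \<theta>) * sin \<theta>) has_real_derivative
     ((poly (pderiv (pderiv (cheb n))) (cos \<theta>) * (- sin \<theta>)) * sin \<theta> + cos \<theta> * poly (pderiv (cheb n)) (cos \<theta>))) (at \<theta>)"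
    by (rule DERIV_mult[OF DERIV_chain2[OF poly_DERIV DERIV_cos] DERIV_sin])
  moreover have "((\<lambda>\<theta>. poly (pderiv (cheb n)) (cos \<theta>) * sin \<theta>) has_real_derivative (real n * (cos (real n * \<theta>) * real n))) (at \<theta>)"
    unfolding pderiv_cheb_cos by (auto intro!: derivative_eq_intros)
  ultimately have "(poly (pderiv (pderiv (cheb n))) (cos \<theta>) * (- sin \<theta>)) * sin \<theta> + cos \<theta> * poly (pderiv (cheb n)) (cos \<theta>)
     = real n * (cos (real n * \<theta>) * real n)" by (rule DERIV_unique)
  thus ?thesis by (simp add: power2_eq_square algebra_simps)
qed

text \<open>Division by \<open>sin \<theta>\<close> is possible in the open interval only; the
  endpoints follow by continuity.\<close>

lemma pderiv_cheb_le:
  assumes "x \<in> {-1..1}" shows "\<bar>poly (pderiv (cheb n)) x\<bar> \<le> (real n)\<^sup>2"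
proof -
  have "\<bar>poly (pderiv (cheb n)) x\<bar> \<le> (real n)\<^sup>2" if x: "x \<in> {-1<..<1}" for x
  proof -
    obtain \<theta> where \<theta>: "x = cos \<theta>" "0 \<le> \<theta>" "\<theta> \<le> pi"
      by (rule cos_arccos_Icc[of x]) (use x in auto)
    have "\<theta> \<noteq> 0" "\<theta> \<noteq> pi" using x \<theta> by auto
    hence s: "\<bar>sin \<theta>\<bar> > 0" using \<theta> sin_gt_zero[of \<theta>] by linarith
    have "\<bar>poly (pderiv (cheb n)) x\<bar> * \<bar>sin \<theta>\<bar> = real n * \<bar>sin (real n * \<theta>)\<bar>"
      unfolding \<theta>(1) abs_mult[symmetric] pderiv_cheb_cos by (simp add: abs_mult)
    also have "\<dots> \<le> real n * (real n * \<bar>sin \<theta>\<bar>)" by (intro mult_left_mono abs_sin_mult_le) auto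
    finally have "\<bar>poly (pderiv (cheb n)) x\<bar> * \<bar>sin \<theta>\<bar> \<le> (real n)\<^sup>2 * \<bar>sin \<theta>\<bar>" by (simp add: power2_eq_square)
    thus ?thesis using s by simp
  qed
  moreover have "x \<in> closure {-1<..<1::real}" using assms by simp
  moreover have "continuous_on (closure {-1<..<1::real}) (\<lambda>x. \<bar>poly (pderiv (cheb n)) x\<bar>)"
    by (intro continuous_on_rabs continuous_on_poly continuous_on_id)
  ultimately show ?thesis using continuous_le_on_closure by blast
qed

text \<open>Bernstein's inequality: the factor \<open>1 - x^2\<close> improves the power 4 of
  \<open>n\<close>, which squaring \<open>pderiv_cheb_le\<close> would give, to 2.\<close>

lemma pderiv_cheb_sq_le:
  assumes "x \<in> {-1..1}" shows "(1 - x\<^sup>2) * (poly (pderiv (cheb n)) x)\<^sup>2 \<le> (real n)\<^sup>2"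
proof -
  obtain \<theta> where \<theta>: "x = cos \<theta>" using assms cos_arccos_Icc by blast
  have "(1 - x\<^sup>2) * (poly (pderiv (cheb n)) x)\<^sup>2 = (poly (pderiv (cheb n)) (cos \<theta>) * sin \<theta>)\<^sup>2"
    by (simp add: \<theta> power_mult_distrib sin_squared_eq)
  also have "\<dots> = (real n)\<^sup>2 * (sin (real n * \<theta>))\<^sup>2" by (simp add: pderiv_cheb_cos power_mult_distrib)
  also have "\<dots> \<le> (real n)\<^sup>2 * 1" by (intro mult_left_mono) (auto simp: abs_square_le_1)
  finally show ?thesis by simp
qed

text \<open>Formally \<open>(sqrt f)' = f' / (2 * sqrt f) \<le> c\<close>. The regularization by
  \<open>\<epsilon>\<close> makes the square root differentiable where \<open>f\<close> vanishes, in
  particular at 0.\<close>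

lemma sqrt_growth:
  fixes f f' :: "real \<Rightarrow> real"
  assumes "0 \<le> t" "0 \<le> c" "f 0 = 0" and f0: "\<And>s. 0 \<le> f s"
    and d: "\<And>s. (f has_real_derivative f' s) (at s)"
    and le: "\<And>s. \<lbrakk>0 \<le> s; s \<le> t\<rbrakk> \<Longrightarrow> \<bar>f' s\<bar> \<le> 2 * sqrt (f s) * c"
  shows "sqrt (f t) \<le> c * t"
proof (rule field_le_epsilon)
  fix \<epsilon> :: real assume \<epsilon>: "0 < \<epsilon>"
  define g where "g s = sqrt (f s + \<epsilon>\<^sup>2)" for s
  have pos: "f s + \<epsilon>\<^sup>2 > 0" for s using f0[of s] \<epsilon> by (simp add: add_nonneg_pos)
  have dg: "(g has_real_derivative (f' s / (2 * g s))) (at s)" for s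
    unfolding g_def[abs_def] using pos[of s]
    by (auto intro!: derivative_eq_intros d simp: field_simps)
  have bd: "\<bar>f' s / (2 * g s)\<bar> \<le> c" if "0 \<le> s" "s \<le> t" for s
  proof -
    have "\<bar>f' s\<bar> \<le> 2 * sqrt (f s) * c" using le that by blast
    also have "\<dots> \<le> 2 * g s * c"
      unfolding g_def using assms(2) by (intro mult_right_mono mult_left_mono real_sqrt_le_mono) auto
    finally show ?thesis using pos[of s] by (simp add: g_def abs_mult divide_le_eq mult_ac)
  qed
  have "g t \<le> g 0 + c * t"
  proof (cases "t = 0")
    case False
    then obtain z where z: "0 < z" "z < t" "g t - g 0 = (t - 0) * (f' z / (2 * g z))"
      using MVT2[of 0 t g "\<lambda>s. f' s / (2 * g s)"] dg assms(1) by auto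
    have "f' z / (2 * g z) \<le> c" using bd[of z] z by (meson abs_le_D1 less_imp_le)
    hence "(t - 0) * (f' z / (2 * g z)) \<le> t * c"
      unfolding diff_zero by (rule mult_left_mono[OF _ assms(1)])
    thus ?thesis using z(3) by (simp add: mult_ac)
  qed simp
  moreover have "sqrt (f t) \<le> g t" unfolding g_def by (intro real_sqrt_le_mono) simp
  moreover have "g 0 = \<epsilon>" unfolding g_def using assms(3) \<epsilon> by simp
  ultimately show "sqrt (f t) \<le> c * t + \<epsilon>" by linarith
qed

section \<open>Spectral multipliers and their iterated commutators\<close>

context jacobi_param
begin

definition sg :: real where "sg = (a + b + 1) / 2"
definition mu :: "nat \<Rightarrow> real" where "mu \<nu> = real \<nu> + sg"

lemma sg_nonneg: "0 \<le> sg" unfolding sg_def using a_ge b_ge by simp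
lemma mu_nonneg: "0 \<le> mu \<nu>" unfolding mu_def using sg_nonneg by simp
lemma mu_sq: "(mu \<nu>)\<^sup>2 = lam \<nu> + sg\<^sup>2"
  by (simp add: mu_def lam_def sg_def power2_eq_square field_simps)

text \<open>The spectral multiplier with symbol \<open>h\<close>. Cutting the sum at the degree
  loses nothing, because the higher coefficients of \<open>p\<close> vanish
  (\<open>ip_en_zero\<close>).\<close>

definition Mult :: "(nat \<Rightarrow> real) \<Rightarrow> real poly \<Rightarrow> real poly" where
  "Mult h p = (\<Sum>\<nu>\<le>degree p. smult (h \<nu> * ip p (en \<nu>)) (en \<nu>))"

lemma Mult_eq:
  assumes "degree p \<le> N"
  shows "Mult h p = (\<Sum>\<nu>\<le>N. smult (h \<nu> * ip p (en \<nu>)) (en \<nu>))"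
  unfolding Mult_def
  by (rule sum.mono_neutral_left) (use assms in \<open>auto simp: ip_en_zero\<close>)

lemma ip_Mult_en: "ip (Mult h p) (en \<nu>) = h \<nu> * ip p (en \<nu>)"
proof -
  have "ip (Mult h p) (en \<nu>) = (\<Sum>\<mu>\<le>max \<nu> (degree p). h \<mu> * ip p (en \<mu>) * ip (en \<mu>) (en \<nu>))"
    by (subst Mult_eq[of _ "max \<nu> (degree p)"]) (auto simp: ip_sum_left ip_smult_left)
  also have "\<dots> = h \<nu> * ip p (en \<nu>)" by (simp add: ip_en if_distrib cong: if_cong)
  finally show ?thesis .
qed

lemma poly_eq_en:
  assumes "\<And>\<nu>. ip p (en \<nu>) = ip q (en \<nu>)" shows "p = q"
  using en_expand[of p "max (degree p) (degree q)"] en_expand[of q "max (degree p) (degree q)"] assms by simp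

lemma degree_Mult: "degree (Mult h p) \<le> degree p"
  unfolding Mult_def
  by (rule degree_sum_le) (auto intro: order.trans[OF degree_smult_le] simp: degree_en)

lemma nrm_Mult:
  assumes "0 \<le> c" "\<And>\<nu>. \<bar>h \<nu>\<bar> \<le> c"
  shows "nrm (Mult h p) \<le> c * nrm p"
proof -
  have "ip (Mult h p) (Mult h p) = (\<Sum>\<nu>\<le>degree p. (h \<nu>)\<^sup>2 * (ip p (en \<nu>))\<^sup>2)"
    by (subst ip_parseval[OF degree_Mult]) (simp add: ip_Mult_en power2_eq_square mult_ac)
  also have "\<dots> \<le> (\<Sum>\<nu>\<le>degree p. c\<^sup>2 * (ip p (en \<nu>))\<^sup>2)"
    using assms power_mono[of "\<bar>h _\<bar>" c 2] by (intro sum_mono mult_right_mono) auto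
  also have "\<dots> = c\<^sup>2 * ip p p"
    by (subst (2) ip_parseval[OF order.refl]) (simp add: sum_distrib_left power2_eq_square)
  finally have "sqrt (ip (Mult h p) (Mult h p)) \<le> sqrt (c\<^sup>2 * ip p p)" by (rule real_sqrt_le_mono)
  thus ?thesis using assms by (simp add: nrm_def real_sqrt_mult)
qed

definition M2 :: "real poly \<Rightarrow> real poly" where "M2 p = Lop p + smult (sg\<^sup>2) p"

lemma ip_M2_en: "ip (M2 p) (en \<nu>) = (mu \<nu>)\<^sup>2 * ip p (en \<nu>)"
  by (simp add: M2_def mu_sq ip_add_left ip_smult_left ip_Lop_en algebra_simps)

lemma Mult_M2: "Mult (\<lambda>\<nu>. (mu \<nu>)\<^sup>2 * h \<nu>) p = M2 (Mult h p)"
  by (rule poly_eq_en) (simp add: ip_M2_en ip_Mult_en)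

text \<open>The \<open>k\<close>-th power of the adjoint action of multiplication by
  \<open>Q\<close>, applied to the operator \<open>Mult h\<close>.\<close>

fun ad :: "real poly \<Rightarrow> (nat \<Rightarrow> real) \<Rightarrow> nat \<Rightarrow> real poly \<Rightarrow> real poly" where
  "ad Q h 0 p = Mult h p"
| "ad Q h (Suc k) p = Q * ad Q h k p - ad Q h k (Q * p)"

lemma degree_ad: "degree (ad Q h k p) \<le> degree p + k * degree Q"
proof (induction k arbitrary: p)
  case 0 then show ?case by (simp add: degree_Mult)
next
  case (Suc k)
  have "degree (Q * ad Q h k p) \<le> degree p + Suc k * degree Q"
    using degree_mult_le[of Q "ad Q h k p"] Suc.IH[of p] by simp
  moreover have "degree (ad Q h k (Q * p)) \<le> degree p + Suc k * degree Q"
    using degree_mult_le[of Q p] Suc.IH[of "Q * p"] by simp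
  ultimately show ?case unfolding ad.simps by (rule degree_diff_le)
qed

text \<open>\<open>comB\<close> and \<open>comG\<close> are the first and second commutator of
  multiplication by \<open>Q\<close> with \<open>M2\<close>. Each commutation lowers the order of a
  differential operator by one, so they have orders 1 and 0, and \<open>comG\<close> commutes with
  \<open>Q\<close>.\<close>

definition comB :: "real poly \<Rightarrow> real poly \<Rightarrow> real poly" where
  "comB Q r = smult 2 ([:1, 0, -1:] * pderiv Q * pderiv r) - Lop Q * r"

definition comG :: "real poly \<Rightarrow> real poly \<Rightarrow> real poly" where
  "comG Q r = smult (-2) ([:1, 0, -1:] * pderiv Q * pderiv Q * r)"

lemma M2_diff: "M2 (p - q) = M2 p - M2 q"
  by (simp add: M2_def Lop_diff smult_diff_right)

lemma comB_diff: "comB Q (p - q) = comB Q p - comB Q q"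
  by (rule poly_ext) (simp add: comB_def pderiv_diff algebra_simps)

lemma comG_diff: "comG Q (p - q) = comG Q p - comG Q q"
  by (rule poly_ext) (simp add: comG_def algebra_simps)

lemma comm_M2: "Q * M2 r = M2 (Q * r) + comB Q r"
  by (rule poly_ext) (simp add: M2_def Lop_def comB_def pderiv_mult pderiv_add algebra_simps)

lemma comm_comB: "Q * comB Q r = comB Q (Q * r) + comG Q r"
  by (rule poly_ext) (simp add: comG_def comB_def pderiv_mult algebra_simps)

lemma comm_comG: "Q * comG Q r = comG Q (Q * r)"
  by (rule poly_ext) (simp add: comG_def algebra_simps)

text \<open>Leibniz rule for the adjoint action on the product of \<open>M2\<close> and
  \<open>Mult h\<close>; it stops after three terms because the third commutator of
  \<open>M2\<close> with \<open>Q\<close> is 0. For \<open>k < 2\<close> the truncated differences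
  do no harm, as their coefficients vanish.\<close>

lemma ad_M2:
  "ad Q (\<lambda>\<nu>. (mu \<nu>)\<^sup>2 * h \<nu>) k p = M2 (ad Q h k p) + smult (real k) (comB Q (ad Q h (k-1) p))
      + smult (real (k choose 2)) (comG Q (ad Q h (k-2) p))"
proof (induction k arbitrary: p)
  case 0
  then show ?case by (simp add: Mult_M2)
next
  case (Suc k)
  define X X' Y Y' Z Z' where "X = ad Q h k p" and "X' = ad Q h k (Q * p)"
    and "Y = ad Q h (k-1) p" and "Y' = ad Q h (k-1) (Q * p)"
    and "Z = ad Q h (k-2) p" and "Z' = ad Q h (k-2) (Q * p)"
  note defs = X_def X'_def Y_def Y'_def Z_def Z'_def
  have "ad Q (\<lambda>\<nu>. (mu \<nu>)\<^sup>2 * h \<nu>) (Suc k) p =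
      Q * M2 X + smult (real k) (Q * comB Q Y) + smult (real (k choose 2)) (Q * comG Q Z)
      - (M2 X' + smult (real k) (comB Q Y') + smult (real (k choose 2)) (comG Q Z'))"
    unfolding ad.simps Suc.IH defs by (simp add: algebra_simps)
  also have "\<dots> = M2 (Q * X - X') + comB Q X + smult (real k) (comB Q (Q * Y - Y')) + smult (real k) (comG Q Y)
      + smult (real (k choose 2)) (comG Q (Q * Z - Z'))"
    unfolding comm_M2 comm_comB comm_comG M2_diff comB_diff comG_diff
    by (simp add: algebra_simps smult_add_right smult_diff_right)
  also have "Q * X - X' = ad Q h (Suc k) p" by (simp add: defs)
  also have "smult (real k) (comB Q (Q * Y - Y')) = smult (real k) (comB Q X)"
    by (cases k) (simp_all add: defs)
  also have "smult (real (k choose 2)) (comG Q (Q * Z - Z')) = smult (real (k choose 2)) (comG Q Y)"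
  proof (cases "k < 2")
    case False
    then obtain m where "k = Suc (Suc m)" by (metis add_2_eq_Suc le_Suc_ex linorder_not_less)
    thus ?thesis by (simp add: defs)
  qed (simp add: binomial_eq_0)
  finally have "ad Q (\<lambda>\<nu>. (mu \<nu>)\<^sup>2 * h \<nu>) (Suc k) p = M2 (ad Q h (Suc k) p)
     + (comB Q X + smult (real k) (comB Q X)) + (smult (real k) (comG Q Y) + smult (real (k choose 2)) (comG Q Y))"
    by (simp add: algebra_simps)
  also have "comB Q X + smult (real k) (comB Q X) = smult (real (Suc k)) (comB Q X)"
    by (simp add: smult_add_left)
  also have "smult (real k) (comG Q Y) + smult (real (k choose 2)) (comG Q Y) = smult (real (Suc k choose 2)) (comG Q Y)"
    by (simp add: smult_add_left numeral_2_eq_2)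
  finally show ?case by (simp add: X_def Y_def del: ad.simps)
qed

lemma ad_const: "k \<ge> 1 \<Longrightarrow> ad Q (\<lambda>_. c) k p = 0"
proof -
  have 0: "Mult (\<lambda>_. c) p = smult c p" for p
    by (rule poly_eq_en) (simp add: ip_Mult_en ip_smult_left)
  have "ad Q (\<lambda>_. c) (Suc k) p = 0" for k p
    by (induction k arbitrary: p) (auto simp: 0)
  thus "k \<ge> 1 \<Longrightarrow> ad Q (\<lambda>_. c) k p = 0" by (cases k) auto
qed

lemma ad_uminus: "ad Q (\<lambda>\<nu>. - h \<nu>) k p = - ad Q h k p"
proof (induction k arbitrary: p)
  case 0
  show ?case by (rule poly_eq_en) (simp add: ip_Mult_en ip_minus_left)
qed simp

text \<open>Only pairings with a fixed \<open>r\<close> are differentiated: the induction then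
  concerns real functions, with the outer factor \<open>Q\<close> moved over to
  \<open>r\<close>.\<close>

lemma ad_has_derivative:
  assumes "\<And>\<nu>. ((\<lambda>t. h t \<nu>) has_real_derivative h' \<nu>) (at t)"
  shows "((\<lambda>t. ip (ad Q (h t) k p) r) has_real_derivative ip (ad Q h' k p) r) (at t)"
proof (induction k arbitrary: p r)
  case 0
  have e: "ip (ad Q h 0 p) r = (\<Sum>\<nu>\<le>degree p. h \<nu> * (ip p (en \<nu>) * ip (en \<nu>) r))" for h
    by (simp add: Mult_def ip_sum_left ip_smult_left mult.assoc)
  show ?case unfolding e by (intro DERIV_sum DERIV_cmult_right assms)
next
  case (Suc k)
  show ?case unfolding ad.simps ip_diff_left ip_mult[of Q]
    by (intro DERIV_diff Suc)
qed

text \<open>\<open>Ct t\<close> and \<open>St t\<close> are the multipliers of the cosine and sine propagators of the wave equation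
  \<open>u'' = - M2 u\<close>; at \<open>mu \<nu> = 0\<close> the quotient \<open>sin (t * mu \<nu>) / mu \<nu>\<close> is read as its limit \<open>t\<close>.\<close>

definition St :: "real \<Rightarrow> nat \<Rightarrow> real" where
  "St t \<nu> = (if mu \<nu> = 0 then t else sin (t * mu \<nu>) / mu \<nu>)"

definition Ct :: "real \<Rightarrow> nat \<Rightarrow> real" where "Ct t \<nu> = cos (t * mu \<nu>)"

lemma St_deriv: "((\<lambda>t. St t \<nu>) has_real_derivative Ct t \<nu>) (at t)"
proof (cases "mu \<nu> = 0")
  case False
  thus ?thesis unfolding St_def Ct_def by (auto intro!: derivative_eq_intros)
qed (simp add: St_def Ct_def)

lemma Ct_deriv: "((\<lambda>t. Ct t \<nu>) has_real_derivative - ((mu \<nu>)\<^sup>2 * St t \<nu>)) (at t)"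
proof -
  have "((\<lambda>t. Ct t \<nu>) has_real_derivative - sin (t * mu \<nu>) * mu \<nu>) (at t)"
    unfolding Ct_def by (auto intro!: derivative_eq_intros)
  moreover have "- sin (t * mu \<nu>) * mu \<nu> = - ((mu \<nu>)\<^sup>2 * St t \<nu>)"
    by (simp add: St_def power2_eq_square)
  ultimately show ?thesis by simp
qed

text \<open>The wave energy of the curve \<open>ad Q (St t) k p\<close>: by \<open>St_deriv\<close>
  its velocity is \<open>ad Q (Ct t) k p\<close>, which supplies the kinetic term.\<close>

definition En :: "real poly \<Rightarrow> nat \<Rightarrow> real poly \<Rightarrow> real \<Rightarrow> real" where
  "En Q k p t = ip (ad Q (Ct t) k p) (ad Q (Ct t) k p) + ip (M2 (ad Q (St t) k p)) (ad Q (St t) k p)"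

definition Fo :: "real poly \<Rightarrow> nat \<Rightarrow> real poly \<Rightarrow> real \<Rightarrow> real poly" where
  "Fo Q k p t = smult (real k) (comB Q (ad Q (St t) (k-1) p))
      + smult (real (k choose 2)) (comG Q (ad Q (St t) (k-2) p))"

section \<open>Energy estimates for the commutators with the propagators\<close>

lemma ip_M2_nonneg: "0 \<le> ip (M2 p) p" "ip (Lop p) p \<le> ip (M2 p) p" "0 \<le> ip (Lop p) p"
proof -
  show L: "0 \<le> ip (Lop p) p"
    unfolding ip_Lop unfolding ip_def
  proof (rule wint_nonneg)
    fix x :: real assume "x \<in> {-1..1}"
    hence "0 \<le> (1 - x\<^sup>2) * (poly (pderiv p) x)\<^sup>2"
      by (intro mult_nonneg_nonneg) (auto simp: abs_square_le_1)
    thus "0 \<le> poly ([:1, 0, -1:] * pderiv p) x * poly (pderiv p) x"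
      by (simp add: power2_eq_square algebra_simps)
  qed
  have s: "0 \<le> sg\<^sup>2 * ip p p" using ip_nonneg by simp
  show "ip (Lop p) p \<le> ip (M2 p) p" using s by (simp add: M2_def ip_add_left ip_smult_left)
  thus "0 \<le> ip (M2 p) p" using L by linarith
qed

lemma En_nonneg: "0 \<le> En Q k p t"
  unfolding En_def using ip_nonneg ip_M2_nonneg by (simp add: add_nonneg_nonneg)

lemma nrm_le_En: "nrm (ad Q (Ct t) k p) \<le> sqrt (En Q k p t)"
  unfolding nrm_def En_def using ip_M2_nonneg by simp

lemma ip_Lop_le_En: "ip (Lop (ad Q (St t) k p)) (ad Q (St t) k p) \<le> En Q k p t"
  unfolding En_def using ip_M2_nonneg[of "ad Q (St t) k p"] ip_nonneg[of "ad Q (Ct t) k p"] by linarith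

text \<open>The degree bound does not depend on \<open>t\<close>, so the energy is a fixed finite
  sum of scalar functions and can be differentiated term by term.\<close>

lemma En_sum:
  "En Q k p t = (\<Sum>\<nu>\<le>degree p + k * degree Q. (ip (ad Q (Ct t) k p) (en \<nu>))\<^sup>2 + (mu \<nu>)\<^sup>2 * (ip (ad Q (St t) k p) (en \<nu>))\<^sup>2)"
proof -
  have d: "degree (M2 (ad Q (St t) k p)) \<le> degree p + k * degree Q"
    unfolding M2_def using degree_ad[of Q "St t" k p] degree_Lop[of "ad Q (St t) k p"]
    by (intro degree_add_le) (auto intro: order.trans[OF degree_smult_le])
  show ?thesis unfolding En_def
    by (simp add: ip_parseval[OF degree_ad[of Q "Ct t" k p], of "ad Q (Ct t) k p"]
      ip_parseval[OF d, of "ad Q (St t) k p"] ip_M2_en sum.distrib power2_eq_square mult_ac)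
qed

text \<open>The \<open>k\<close>-fold commutator with the sine propagator solves the inhomogeneous wave equation with
  right-hand side \<open>- Fo\<close>, because commutators of order three with \<open>M2\<close> vanish.\<close>

lemma En_deriv:
  "(En Q k p has_real_derivative - 2 * ip (ad Q (Ct t) k p) (Fo Q k p t)) (at t)"
proof -
  let ?N = "degree p + k * degree Q"
  let ?c = "\<lambda>t. ad Q (Ct t) k p" and ?s = "\<lambda>t. ad Q (St t) k p"
  have ds: "((\<lambda>t. ip (?s t) r) has_real_derivative ip (?c t) r) (at t)" for r
    by (rule ad_has_derivative) (rule St_deriv)
  have dc: "((\<lambda>t. ip (?c t) r) has_real_derivative ip (- (M2 (?s t) + Fo Q k p t)) r) (at t)" for r
  proof -
    have "((\<lambda>t. ip (?c t) r) has_real_derivative ip (ad Q (\<lambda>\<nu>. - ((mu \<nu>)\<^sup>2 * St t \<nu>)) k p) r) (at t)"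
      by (rule ad_has_derivative) (rule Ct_deriv)
    thus ?thesis unfolding ad_uminus ad_M2 Fo_def by (simp add: add.assoc)
  qed
  have "(En Q k p has_real_derivative (\<Sum>\<nu>\<le>?N. 2 * ip (?c t) (en \<nu>) * ip (- (M2 (?s t) + Fo Q k p t)) (en \<nu>)
      + (mu \<nu>)\<^sup>2 * (2 * ip (?s t) (en \<nu>) * ip (?c t) (en \<nu>)))) (at t)"
    unfolding En_sum
    by (intro DERIV_sum) (auto intro!: derivative_eq_intros ds dc)
  also have "(\<Sum>\<nu>\<le>?N. 2 * ip (?c t) (en \<nu>) * ip (- (M2 (?s t) + Fo Q k p t)) (en \<nu>)
      + (mu \<nu>)\<^sup>2 * (2 * ip (?s t) (en \<nu>) * ip (?c t) (en \<nu>)))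
     = (\<Sum>\<nu>\<le>?N. - 2 * (ip (?c t) (en \<nu>) * ip (Fo Q k p t) (en \<nu>)))"
    by (intro sum.cong refl, simp only: ip_minus_left ip_add_left ip_M2_en) (simp add: algebra_simps)
  also have "\<dots> = - 2 * ip (?c t) (Fo Q k p t)"
    by (simp only: ip_parseval[OF degree_ad[of Q "Ct t" k p], of "Fo Q k p t"] sum_distrib_left)
  finally show ?thesis .
qed

text \<open>The first-order part of \<open>comB\<close> costs one factor \<open>m\<close> and the
  energy of \<open>r\<close>, the zero-order part costs \<open>m^2\<close> and the norm of
  \<open>r\<close>. In the induction below the norm bound carries an extra factor
  \<open>t \<le> 1 / m\<close> over the energy bound, so the two terms balance.\<close>

lemma nrm_comB:
  obtains c where "c \<ge> 0" and "\<And>m r. nrm (comB (cheb m) r) \<le> c * (real m)\<^sup>2 * nrm r + 2 * real m * sqrt (ip (Lop r) r)"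
proof -
  define c where "c = 2 + \<bar>b - a\<bar> + (a + b + 2)"
  have "c \<ge> 0" unfolding c_def using a_ge b_ge by simp
  moreover have "nrm (comB (cheb m) r) \<le> c * (real m)\<^sup>2 * nrm r + 2 * real m * sqrt (ip (Lop r) r)" for m r
  proof -
    let ?Q = "cheb m"
    have L: "\<bar>poly (Lop ?Q) x\<bar> \<le> c * (real m)\<^sup>2" if x: "x \<in> {-1..1}" for x
    proof -
      obtain \<theta> where \<theta>: "x = cos \<theta>" using x cos_arccos_Icc by blast
      have q: "\<bar>poly (pderiv ?Q) x\<bar> \<le> (real m)\<^sup>2" by (rule pderiv_cheb_le[OF x])
      have "poly (Lop ?Q) x = - ((1 - x\<^sup>2) * poly (pderiv (pderiv ?Q)) x + (b - a - (a+b+2) * x) * poly (pderiv ?Q) x)"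
        by (simp add: Lop_def algebra_simps power2_eq_square)
      also have "(1 - x\<^sup>2) * poly (pderiv (pderiv ?Q)) x = x * poly (pderiv ?Q) x - (real m)\<^sup>2 * poly ?Q x"
        using pderiv2_cheb_cos[of \<theta> m] unfolding \<theta> by (simp add: sin_squared_eq poly_cheb_cos)
      finally have e: "poly (Lop ?Q) x = (real m)\<^sup>2 * poly ?Q x - (x + (b - a) - (a+b+2) * x) * poly (pderiv ?Q) x"
        by (simp add: algebra_simps)
      have "\<bar>(a+b+2) * x\<bar> \<le> (a + b + 2) * 1"
        unfolding abs_mult using a_ge b_ge x by (intro mult_mono) auto
      hence "\<bar>x + (b - a) - (a+b+2) * x\<bar> \<le> 1 + \<bar>b - a\<bar> + (a + b + 2)" using x by auto
      hence "\<bar>(x + (b - a) - (a+b+2) * x) * poly (pderiv ?Q) x\<bar> \<le> (1 + \<bar>b - a\<bar> + (a + b + 2)) * (real m)\<^sup>2"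
        unfolding abs_mult using q by (intro mult_mono) auto
      moreover have "\<bar>(real m)\<^sup>2 * poly ?Q x\<bar> \<le> (real m)\<^sup>2 * 1"
        unfolding abs_mult using cheb_abs_le[OF x] by (intro mult_mono) auto
      ultimately have "\<bar>poly (Lop ?Q) x\<bar> \<le> (real m)\<^sup>2 * 1 + (1 + \<bar>b - a\<bar> + (a + b + 2)) * (real m)\<^sup>2"
        unfolding e by linarith
      thus ?thesis unfolding c_def by (simp add: algebra_simps)
    qed
    define R where "R = [:1, 0, -1:] * pderiv ?Q * pderiv r"
    have polyR: "poly R x = (1 - x\<^sup>2) * poly (pderiv ?Q) x * poly (pderiv r) x" for x
      unfolding R_def poly_mult power2_eq_square by simp
    have "ip R R \<le> (real m)\<^sup>2 * ip (Lop r) r"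
      unfolding ip_Lop unfolding ip_def
    proof (subst wint_cmult[symmetric], rule wint_mono)
      fix x :: real assume x: "x \<in> {-1..1}"
      have "0 \<le> 1 - x\<^sup>2" using x by (auto simp: abs_square_le_1)
      hence "((1 - x\<^sup>2) * (poly (pderiv ?Q) x)\<^sup>2) * ((1 - x\<^sup>2) * (poly (pderiv r) x)\<^sup>2)
        \<le> (real m)\<^sup>2 * ((1 - x\<^sup>2) * (poly (pderiv r) x)\<^sup>2)"
        using pderiv_cheb_sq_le[OF x] by (intro mult_right_mono) auto
      thus "poly R x * poly R x \<le> (real m)\<^sup>2 * (poly ([:1, 0, -1:] * pderiv r) x * poly (pderiv r) x)"
        unfolding polyR by (simp add: power2_eq_square algebra_simps)
    qed (auto intro!: continuous_intros)
    hence "sqrt (ip R R) \<le> sqrt ((real m)\<^sup>2 * ip (Lop r) r)" by (rule real_sqrt_le_mono)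
    hence R: "nrm R \<le> real m * sqrt (ip (Lop r) r)" by (simp add: nrm_def real_sqrt_mult)
    have "nrm (comB ?Q r) \<le> nrm (smult 2 R) + nrm (Lop ?Q * r)" unfolding comB_def R_def by (rule nrm_diff)
    also have "nrm (smult 2 R) \<le> 2 * (real m * sqrt (ip (Lop r) r))" unfolding nrm_smult using R by simp
    also have "nrm (Lop ?Q * r) \<le> c * (real m)\<^sup>2 * nrm r" by (rule nrm_mult_le) (rule L)
    finally show ?thesis by simp
  qed
  ultimately show thesis by (rule that)
qed

lemma nrm_comG: "nrm (comG (cheb m) r) \<le> 2 * (real m)\<^sup>2 * nrm r"
proof -
  have "nrm (([:1, 0, -1:] * pderiv (cheb m) * pderiv (cheb m)) * r) \<le> (real m)\<^sup>2 * nrm r"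
  proof (rule nrm_mult_le)
    fix x :: real assume x: "x \<in> {-1..1}"
    have "poly ([:1, 0, -1:] * pderiv (cheb m) * pderiv (cheb m)) x = (1 - x\<^sup>2) * (poly (pderiv (cheb m)) x)\<^sup>2"
      unfolding poly_mult power2_eq_square by simp
    moreover have "0 \<le> (1 - x\<^sup>2) * (poly (pderiv (cheb m)) x)\<^sup>2"
      using x by (intro mult_nonneg_nonneg) (auto simp: abs_square_le_1)
    ultimately show "\<bar>poly ([:1, 0, -1:] * pderiv (cheb m) * pderiv (cheb m)) x\<bar> \<le> (real m)\<^sup>2"
      using pderiv_cheb_sq_le[OF x, of m] by linarith
  qed
  moreover have "\<bar>-2\<bar> * n \<le> 2 * (real m)\<^sup>2 * nrm r" if "n \<le> (real m)\<^sup>2 * nrm r" for n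
    using that by simp
  ultimately show ?thesis unfolding comG_def nrm_smult by blast
qed

text \<open>The commutator with \<open>St t\<close> is 0 at time 0 and has the commutator with
  \<open>Ct t\<close> as its derivative; \<open>sqrt_growth\<close> replaces the integration of a
  vector-valued function.\<close>

lemma nrm_St_growth:
  assumes "0 \<le> t" "0 \<le> c" "\<And>s. \<lbrakk>0 \<le> s; s \<le> t\<rbrakk> \<Longrightarrow> nrm (ad Q (Ct s) k p) \<le> c"
  shows "nrm (ad Q (St t) k p) \<le> c * t"
proof -
  let ?s = "\<lambda>t. ad Q (St t) k p" and ?c = "\<lambda>t. ad Q (Ct t) k p"
  have "ad Q (St 0) k p = 0"
  proof -
    have "St 0 = (\<lambda>_. 0)" by (auto simp: St_def)
    moreover have "ad Q (\<lambda>_. 0) k p = 0" by (cases k) (auto simp: Mult_def ad_const simp del: ad.simps(2))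
    ultimately show ?thesis by simp
  qed
  moreover have "((\<lambda>t. ip (?s t) (?s t)) has_real_derivative 2 * ip (?s t) (?c t)) (at t)" for t
  proof -
    have "((\<lambda>t. \<Sum>\<nu>\<le>degree p + k * degree Q. ip (?s t) (en \<nu>) * ip (?s t) (en \<nu>)) has_real_derivative
      (\<Sum>\<nu>\<le>degree p + k * degree Q. ip (?c t) (en \<nu>) * ip (?s t) (en \<nu>) + ip (?c t) (en \<nu>) * ip (?s t) (en \<nu>))) (at t)"
      by (intro DERIV_sum DERIV_mult ad_has_derivative St_deriv)
    moreover have "ip (?s t) (?s t) = (\<Sum>\<nu>\<le>degree p + k * degree Q. ip (?s t) (en \<nu>) * ip (?s t) (en \<nu>))" for t
      by (rule ip_parseval[OF degree_ad])
    moreover have "ip (?c t) (?s t) = (\<Sum>\<nu>\<le>degree p + k * degree Q. ip (?c t) (en \<nu>) * ip (?s t) (en \<nu>))"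
      by (rule ip_parseval[OF degree_ad])
    ultimately show ?thesis by (simp only: sum.distrib ip_commute[of "?s t" "?c t"]) simp
  qed
  ultimately have "sqrt (ip (?s t) (?s t)) \<le> c * t"
  proof (intro sqrt_growth[where f="\<lambda>t. ip (?s t) (?s t)" and f'="\<lambda>t. 2 * ip (?s t) (?c t)"])
    fix s assume "0 \<le> s" "s \<le> t"
    hence "\<bar>ip (?s s) (?c s)\<bar> \<le> nrm (?s s) * c"
      using ip_Cauchy_Schwarz[of "?s s" "?c s"] assms(3)[of s] mult_left_mono[of "nrm (?c s)" c "nrm (?s s)"]
      by (meson nrm_nonneg order_trans)
    thus "\<bar>2 * ip (?s s) (?c s)\<bar> \<le> 2 * sqrt (ip (?s s) (?s s)) * c" by (simp add: nrm_def abs_mult)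
  qed (use assms ip_nonneg in auto)
  thus ?thesis by (simp add: nrm_def)
qed

text \<open>Duhamel's principle in energy form: for \<open>k \<ge> 1\<close> the energy starts at 0,
  because the symbols \<open>St 0\<close> and \<open>Ct 0\<close> are constant and constants commute
  with \<open>Q\<close>, and it is fed by \<open>Fo\<close> alone.\<close>

lemma En_growth:
  assumes "0 \<le> t" "0 \<le> c" "1 \<le> k" "\<And>s. \<lbrakk>0 \<le> s; s \<le> t\<rbrakk> \<Longrightarrow> nrm (Fo Q k p s) \<le> c"
  shows "sqrt (En Q k p t) \<le> c * t"
proof (rule sqrt_growth[OF assms(1,2) _ En_nonneg En_deriv])
  have "St 0 = (\<lambda>_. 0)" "Ct 0 = (\<lambda>_. 1)" by (auto simp: St_def Ct_def)
  thus "En Q k p 0 = 0" using assms(3) by (simp add: En_def ad_const)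
  fix s assume s: "0 \<le> s" "s \<le> t"
  have "\<bar>ip (ad Q (Ct s) k p) (Fo Q k p s)\<bar> \<le> nrm (ad Q (Ct s) k p) * nrm (Fo Q k p s)"
    by (rule ip_Cauchy_Schwarz)
  also have "\<dots> \<le> sqrt (En Q k p s) * c"
    using assms(4)[OF s] nrm_le_En by (intro mult_mono) (auto simp: En_nonneg)
  finally show "\<bar>- 2 * ip (ad Q (Ct s) k p) (Fo Q k p s)\<bar> \<le> 2 * sqrt (En Q k p s) * c"
    by (simp add: abs_mult)
qed

text \<open>Strong induction, since \<open>Fo\<close> at level \<open>k\<close> involves the levels
  \<open>k - 1\<close> and \<open>k - 2\<close>. It is of order \<open>m * (t * m)^(k-1)\<close>,
  and integration in time supplies the missing factor \<open>t\<close>. Both bounds are carried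
  along because \<open>comB\<close> needs the energy and the norm, \<open>comG\<close> the
  norm.\<close>

lemma commutator_bound_small:
  "\<exists>C\<ge>0. \<forall>m\<ge>1. \<forall>p t. 0 \<le> t \<and> t * real m \<le> 1 \<longrightarrow>
     sqrt (En (cheb m) k p t) \<le> C * (t * real m) ^ k * nrm p \<and>
     nrm (ad (cheb m) (St t) k p) \<le> C * t * (t * real m) ^ k * nrm p"
proof (induction k rule: less_induct)
  case (less k)
  obtain cB where cB: "cB \<ge> 0" "\<And>m r. nrm (comB (cheb m) r) \<le> cB * (real m)\<^sup>2 * nrm r + 2 * real m * sqrt (ip (Lop r) r)"
    using nrm_comB by blast
  show ?case
  proof (cases "k = 0")
    case True
    have "sqrt (En Q 0 p t) \<le> nrm p \<and> nrm (ad Q (St t) 0 p) \<le> t * nrm p" if t: "0 \<le> t" for Q p t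
    proof -
      \<comment> \<open>Without commutators the energy is conserved, separately in every mode;
        \<open>mu \<nu> = 0\<close> is included thanks to the factor
        \<open>(mu \<nu>)\<^sup>2\<close>.\<close>
      have trig: "(Ct t \<nu>)\<^sup>2 + (mu \<nu>)\<^sup>2 * (St t \<nu>)\<^sup>2 = 1" for \<nu>
        by (simp add: Ct_def St_def power_divide)
      have "En Q 0 p t = (\<Sum>\<nu>\<le>degree p. ((Ct t \<nu>)\<^sup>2 + (mu \<nu>)\<^sup>2 * (St t \<nu>)\<^sup>2) * (ip p (en \<nu>))\<^sup>2)"
        unfolding En_sum by (simp add: ip_Mult_en power_mult_distrib algebra_simps)
      also have "\<dots> = ip p p" unfolding trig by (simp add: ip_parseval[OF order.refl, of p p] power2_eq_square)
      finally have 1: "sqrt (En Q 0 p t) \<le> nrm p" by (simp add: nrm_def)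
      have "\<bar>St t \<nu>\<bar> \<le> t" for \<nu>
      proof -
        have "\<bar>sin (t * mu \<nu>)\<bar> \<le> t * mu \<nu>" using abs_sin_x_le_abs_x[of "t * mu \<nu>"] t mu_nonneg[of \<nu>] by simp
        thus ?thesis using t mu_nonneg[of \<nu>] by (auto simp: St_def abs_mult field_simps)
      qed
      hence "nrm (ad Q (St t) 0 p) \<le> t * nrm p" using t by (simp add: nrm_Mult)
      with 1 show ?thesis by simp
    qed
    thus ?thesis unfolding True by (intro exI[of _ 1]) auto
  next
    case False
    hence k: "1 \<le> k" by simp
    obtain C1 where C1: "C1 \<ge> 0" "\<And>m p t. \<lbrakk>1 \<le> m; 0 \<le> t; t * real m \<le> 1\<rbrakk> \<Longrightarrow>
     sqrt (En (cheb m) (k-1) p t) \<le> C1 * (t * real m) ^ (k-1) * nrm p \<and>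
     nrm (ad (cheb m) (St t) (k-1) p) \<le> C1 * t * (t * real m) ^ (k-1) * nrm p"
      using less.IH[of "k-1"] k by auto
    obtain C2 where C2: "C2 \<ge> 0" "\<And>m p t. \<lbrakk>1 \<le> m; 0 \<le> t; t * real m \<le> 1\<rbrakk> \<Longrightarrow>
     nrm (ad (cheb m) (St t) (k-2) p) \<le> C2 * t * (t * real m) ^ (k-2) * nrm p"
      using less.IH[of "k-2"] k by auto
    define C where "C = real k * (cB + 2) * C1 + real (k choose 2) * 2 * C2"
    have C: "C \<ge> 0" unfolding C_def using cB C1 C2 by simp
    have F: "nrm (Fo (cheb m) k p s) \<le> C * real m * (t * real m) ^ (k-1) * nrm p"
      if m: "1 \<le> m" and t: "0 \<le> t" "t * real m \<le> 1" and s: "0 \<le> s" "s \<le> t" for m p t s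
    proof -
      define A where "A = s * real m"
      define P where "P = (t * real m) ^ (k-1) * nrm p"
      have st: "A \<le> t * real m" unfolding A_def using s by (intro mult_right_mono) auto
      hence A: "0 \<le> A" "A \<le> 1" unfolding A_def using s t by (auto simp: A_def)
      have Ak: "A ^ (k-1) * nrm p \<le> P" unfolding P_def using st A by (intro mult_right_mono power_mono) auto
      have Pnn: "0 \<le> P" unfolding P_def using t by simp
      have sm: "s * real m \<le> 1" using A by (simp add: A_def)
      note 1 = C1(2)[OF m s(1) sm, folded A_def, of p]
      note 2 = C2(2)[OF m s(1) sm, folded A_def, of p]
      let ?u = "ad (cheb m) (St s) (k-1) p"
      have sq: "sqrt (ip (Lop ?u) ?u) \<le> C1 * A ^ (k-1) * nrm p"
        using real_sqrt_le_mono[OF ip_Lop_le_En[of "cheb m" s "k-1" p]] 1 by linarith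
      have "nrm (comB (cheb m) ?u) \<le> cB * (real m)\<^sup>2 * nrm ?u + 2 * real m * sqrt (ip (Lop ?u) ?u)" by (rule cB)
      also have "\<dots> \<le> cB * (real m)\<^sup>2 * (C1 * s * A ^ (k-1) * nrm p) + 2 * real m * (C1 * A ^ (k-1) * nrm p)"
        using 1 cB(1) sq by (intro add_mono mult_left_mono) auto
      also have "\<dots> = cB * C1 * real m * A * (A ^ (k-1) * nrm p) + 2 * C1 * real m * (A ^ (k-1) * nrm p)"
        by (simp add: A_def power2_eq_square)
      also have "\<dots> \<le> cB * C1 * real m * 1 * P + 2 * C1 * real m * P"
        using cB(1) C1(1) A Ak by (intro add_mono mult_mono) auto
      finally have B: "nrm (comB (cheb m) ?u) \<le> (cB + 2) * C1 * real m * P" by (simp add: algebra_simps)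
      have G: "real (k choose 2) * nrm (comG (cheb m) (ad (cheb m) (St s) (k-2) p)) \<le> real (k choose 2) * (2 * C2 * real m * P)"
      proof (cases "k < 2")
        case False
        hence k2: "k - 1 = Suc (k - 2)" by simp
        have "nrm (comG (cheb m) (ad (cheb m) (St s) (k-2) p)) \<le> 2 * (real m)\<^sup>2 * (C2 * s * A ^ (k-2) * nrm p)"
          by (intro order.trans[OF nrm_comG] mult_left_mono 2) auto
        also have "\<dots> = 2 * C2 * real m * (A ^ (k-1) * nrm p)"
          unfolding k2 by (simp add: A_def power2_eq_square)
        also have "\<dots> \<le> 2 * C2 * real m * P" using Ak C2(1) by (intro mult_left_mono) auto
        finally show ?thesis by (rule mult_left_mono) simp
      qed (simp add: binomial_eq_0)
      have "nrm (Fo (cheb m) k p s) \<le> real k * nrm (comB (cheb m) ?u) + real (k choose 2) * nrm (comG (cheb m) (ad (cheb m) (St s) (k-2) p))"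
        unfolding Fo_def by (rule order.trans[OF nrm_triangle]) (simp add: nrm_smult)
      also have "\<dots> \<le> real k * ((cB + 2) * C1 * real m * P) + real (k choose 2) * (2 * C2 * real m * P)"
        by (intro add_mono G mult_left_mono B) auto
      also have "\<dots> = C * real m * P" unfolding C_def by (simp add: algebra_simps)
      finally show ?thesis by (simp add: P_def mult.assoc)
    qed
    have E: "sqrt (En (cheb m) k p t) \<le> C * (t * real m) ^ k * nrm p"
      if m: "1 \<le> m" and t: "0 \<le> t" "t * real m \<le> 1" for m p t
    proof -
      have "sqrt (En (cheb m) k p t) \<le> (C * real m * (t * real m) ^ (k-1) * nrm p) * t"
        by (rule En_growth[OF t(1) _ k F[OF m t]]) (use C t in auto)
      also have "\<dots> = C * (t * real m) ^ (Suc (k - 1)) * nrm p" by simp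
      also have "Suc (k-1) = k" using k by simp
      finally show ?thesis .
    qed
    have "nrm (ad (cheb m) (St t) k p) \<le> C * t * (t * real m) ^ k * nrm p"
      if m: "1 \<le> m" and t: "0 \<le> t" "t * real m \<le> 1" for m p t
    proof -
      have "nrm (ad (cheb m) (St t) k p) \<le> (C * (t * real m) ^ k * nrm p) * t"
      proof (rule nrm_St_growth)
        fix s assume s: "0 \<le> s" "s \<le> t"
        have st: "s * real m \<le> t * real m" using s by (intro mult_right_mono) auto
        have "nrm (ad (cheb m) (Ct s) k p) \<le> C * (s * real m) ^ k * nrm p"
          using E[OF m s(1), of p] nrm_le_En[of "cheb m" s k p] st t by linarith
        also have "\<dots> \<le> C * (t * real m) ^ k * nrm p"
          using st s C by (intro mult_right_mono mult_left_mono power_mono) auto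
        finally show "nrm (ad (cheb m) (Ct s) k p) \<le> C * (t * real m) ^ k * nrm p" .
      qed (use C t in auto)
      thus ?thesis by (simp add: mult_ac)
    qed
    with E C show ?thesis by blast
  qed
qed

text \<open>Each commutation at most doubles the bound, as multiplication by a Chebyshev polynomial
  does not increase the norm.\<close>

lemma nrm_ad_le:
  assumes "0 \<le> c" "\<And>\<nu>. \<bar>h \<nu>\<bar> \<le> c"
  shows "nrm (ad (cheb m) h k p) \<le> 2 ^ k * c * nrm p"
proof (induction k arbitrary: p)
  case 0 thus ?case using nrm_Mult[OF assms] by simp
next
  case (Suc k)
  have Q: "nrm (cheb m * r) \<le> nrm r" for r
    using nrm_mult_le[of "cheb m" 1 r] cheb_abs_le by auto
  have "nrm (ad (cheb m) h (Suc k) p) \<le> nrm (ad (cheb m) h k p) + nrm (ad (cheb m) h k (cheb m * p))"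
    using nrm_diff[of "cheb m * ad (cheb m) h k p" "ad (cheb m) h k (cheb m * p)"] Q[of "ad (cheb m) h k p"]
    by simp
  also have "\<dots> \<le> 2 ^ k * c * nrm p + 2 ^ k * c * nrm (cheb m * p)" by (intro add_mono Suc)
  also have "\<dots> \<le> 2 ^ k * c * nrm p + 2 ^ k * c * nrm p"
    using Q[of p] assms(1) by (intro add_mono mult_left_mono) auto
  also have "\<dots> = 2 ^ Suc k * c * nrm p" by simp
  finally show ?case .
qed

text \<open>The energy estimate serves for \<open>t * m \<le> 1\<close>, the crude bound
  \<open>nrm_ad_le\<close> for later times.\<close>

lemma commutator_bound:
  obtains C where "C \<ge> 0" and "\<And>m p t. \<lbrakk>1 \<le> m; 0 \<le> t\<rbrakk> \<Longrightarrow>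
     nrm (ad (cheb m) (Ct t) k p) \<le> C * (min 1 (t * real m)) ^ k * nrm p"
proof -
  obtain C where C: "C \<ge> 0" "\<And>m p t. \<lbrakk>1 \<le> m; 0 \<le> t; t * real m \<le> 1\<rbrakk> \<Longrightarrow>
     sqrt (En (cheb m) k p t) \<le> C * (t * real m) ^ k * nrm p"
    using commutator_bound_small[of k] by blast
  have "nrm (ad (cheb m) (Ct t) k p) \<le> (C + 2 ^ k) * (min 1 (t * real m)) ^ k * nrm p"
    if m: "1 \<le> m" and t: "0 \<le> t" for m p t
  proof (cases "t * real m \<le> 1")
    case True
    have "nrm (ad (cheb m) (Ct t) k p) \<le> C * (t * real m) ^ k * nrm p"
      using nrm_le_En C(2)[OF m t True] by (rule order.trans)
    also have "\<dots> \<le> (C + 2 ^ k) * (t * real m) ^ k * nrm p"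
      using t by (intro mult_right_mono) auto
    finally show ?thesis using True by (simp add: min_def)
  next
    case False
    have "nrm (ad (cheb m) (Ct t) k p) \<le> 2 ^ k * 1 * nrm p"
      by (rule nrm_ad_le) (auto simp: Ct_def)
    also have "\<dots> \<le> (C + 2 ^ k) * 1 * nrm p" using C by (intro mult_right_mono) auto
    finally show ?thesis using False by (simp add: min_def)
  qed
  moreover have "C + 2 ^ k \<ge> 0" using C by simp
  ultimately show thesis by (intro that)
qed

end

section \<open>Cosine series and separation of points\<close>

text \<open>Completeness of the cosines: \<open>h\<close> is orthogonal to all polynomials in
  \<open>cos \<theta>\<close>, and by Weierstrass in the variable \<open>cos \<theta>\<close> these
  approximate \<open>h\<close> itself uniformly, so the integral of \<open>h^2\<close> is 0.\<close>

lemma cos_moments_determine: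
  fixes h :: "real \<Rightarrow> real"
  assumes cont: "continuous_on {0..pi} h"
    and zero: "\<And>j::nat. integral {0..pi} (\<lambda>\<theta>. h \<theta> * cos (real j * \<theta>)) = 0"
    and \<theta>: "\<theta> \<in> {0..pi}"
  shows "h \<theta> = 0"
proof -
  have int: "(\<lambda>\<theta>. h \<theta> * cos (real j * \<theta>) * cos \<theta> ^ m) integrable_on {0..pi}" for j m
    by (intro integrable_continuous_real continuous_intros cont)
  \<comment> \<open>The frequency stays general in this induction, since a factor
    \<open>cos \<theta>\<close> splits \<open>cos (j * \<theta>)\<close> into the frequencies
    \<open>j + 1\<close> and \<open>j - 1\<close>.\<close>
  have pow: "integral {0..pi} (\<lambda>\<theta>. h \<theta> * cos (real j * \<theta>) * cos \<theta> ^ m) = 0" for j m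
  proof (induction m arbitrary: j)
    case 0 then show ?case using zero by simp
  next
    case (Suc m)
    show ?case
    proof (cases j)
      case 0
      have "(\<lambda>\<theta>. h \<theta> * cos (real j * \<theta>) * cos \<theta> ^ Suc m) = (\<lambda>\<theta>. h \<theta> * cos (real 1 * \<theta>) * cos \<theta> ^ m)"
        unfolding 0 by (auto simp: mult_ac)
      thus ?thesis using Suc[of 1] by simp
    next
      case j: (Suc i)
      have e: "h \<theta> * cos (real j * \<theta>) * cos \<theta> ^ Suc m
          = (1/2) * (h \<theta> * cos (real (Suc (Suc i)) * \<theta>) * cos \<theta> ^ m + h \<theta> * cos (real i * \<theta>) * cos \<theta> ^ m)" for \<theta>
      proof -
        have 1: "cos (real (Suc (Suc i)) * \<theta>) = cos (real j * \<theta> + \<theta>)"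
          and 2: "cos (real i * \<theta>) = cos (real j * \<theta> - \<theta>)"
          unfolding j by (simp_all add: algebra_simps)
        show ?thesis unfolding 1 2 cos_add cos_diff by (simp add: algebra_simps)
      qed
      show ?thesis unfolding e integral_mult_right
        by (subst integral_add[OF int int]) (simp only: Suc, simp)
    qed
  qed
  have poly0: "integral {0..pi} (\<lambda>\<theta>. h \<theta> * g (cos \<theta>)) = 0" if "real_polynomial_function g" for g :: "real \<Rightarrow> real"
  proof -
    from that obtain c n where g: "g = (\<lambda>x. \<Sum>i\<le>n. c i * x ^ i)"
      using real_polynomial_function_iff_sum by blast
    have "integral {0..pi} (\<lambda>\<theta>. h \<theta> * g (cos \<theta>)) = integral {0..pi} (\<lambda>\<theta>. \<Sum>i\<le>n. c i * (h \<theta> * cos (real 0 * \<theta>) * cos \<theta> ^ i))"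
      unfolding g by (simp add: sum_distrib_left mult_ac)
    also have "\<dots> = (\<Sum>i\<le>n. integral {0..pi} (\<lambda>\<theta>. c i * (h \<theta> * cos (real 0 * \<theta>) * cos \<theta> ^ i)))"
      by (intro integral_sum integrable_continuous_real continuous_intros cont) auto
    also have "\<dots> = 0" unfolding integral_mult_right pow by simp
    finally show ?thesis .
  qed
  obtain B where B: "\<And>\<theta>. \<theta> \<in> {0..pi} \<Longrightarrow> \<bar>h \<theta>\<bar> \<le> B"
    using compact_imp_bounded[OF compact_continuous_image[OF cont compact_Icc]]
    by (fastforce simp: bounded_iff)
  have B0: "0 \<le> B" using B[of 0] by auto
  have "integral {0..pi} (\<lambda>\<theta>. h \<theta> * h \<theta>) \<le> 0 + e" if e: "e > 0" for e
  proof -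
    define e' where "e' = e / (pi * (B + 1))"
    have e': "e' > 0" unfolding e'_def using e B0 by simp
    have "continuous_on {-1..1} (\<lambda>x. h (arccos x))"
      by (rule continuous_on_compose2[OF cont continuous_on_arccos']) (auto simp: arccos_lbound arccos_ubound)
    then obtain g where g: "real_polynomial_function g" "\<And>x. x \<in> {-1..1} \<Longrightarrow> \<bar>h (arccos x) - g x\<bar> < e'"
      using Stone_Weierstrass_real_polynomial_function[OF compact_Icc _ e'] by blast
    have gc: "continuous_on {0..pi} (\<lambda>\<theta>. g (cos \<theta>))"
    proof (rule continuous_on_compose2[of UNIV g])
      show "continuous_on UNIV g"
        using g(1) by (simp add: real_polynomial_function_eq continuous_on_polymonial_function)
      show "continuous_on {0..pi} (cos :: real \<Rightarrow> real)" by (intro continuous_intros)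
    qed simp
    have "integral {0..pi} (\<lambda>\<theta>. h \<theta> * h \<theta>) = integral {0..pi} (\<lambda>\<theta>. h \<theta> * h \<theta> - h \<theta> * g (cos \<theta>))"
      by (subst integral_diff) (auto intro!: integrable_continuous_real continuous_intros cont gc simp: poly0[OF g(1)])
    also have "\<dots> \<le> integral {0..pi} (\<lambda>\<theta>. B * e')"
    proof (rule integral_le)
      fix t assume t: "t \<in> {0..pi}"
      have "\<bar>h (arccos (cos t)) - g (cos t)\<bar> < e'" by (rule g(2)) auto
      hence "\<bar>h t - g (cos t)\<bar> \<le> e'" using t by (simp add: arccos_cos)
      hence "\<bar>h t\<bar> * \<bar>h t - g (cos t)\<bar> \<le> B * e'" using B[OF t] B0 by (intro mult_mono) auto
      moreover have "h t * h t - h t * g (cos t) = h t * (h t - g (cos t))" by (simp add: algebra_simps)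
      ultimately show "h t * h t - h t * g (cos t) \<le> B * e'"
        by (metis abs_le_D1 abs_mult)
    qed (auto intro!: integrable_continuous_real continuous_intros cont gc)
    also have "\<dots> = pi * B * e'" by simp
    also have "\<dots> \<le> e"
    proof -
      have "pi * B * e' = e * (B / (B + 1))" unfolding e'_def using B0 by simp
      also have "\<dots> \<le> e * 1" using e B0 by (intro mult_left_mono) auto
      finally show ?thesis by simp
    qed
    finally show ?thesis by simp
  qed
  hence "integral {0..pi} (\<lambda>\<theta>. h \<theta> * h \<theta>) \<le> 0" by (rule field_le_epsilon)
  moreover have "0 \<le> integral {0..pi} (\<lambda>\<theta>. h \<theta> * h \<theta>)"
    by (rule integral_nonneg) (auto intro!: integrable_continuous_real continuous_intros cont)
  ultimately have "integral {0..pi} (\<lambda>\<theta>. h \<theta> * h \<theta>) = 0" by simp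
  moreover have "integral {0..pi} (\<lambda>\<theta>. h \<theta> * h \<theta>) = 0 \<longleftrightarrow> (\<forall>\<theta>\<in>{0..pi}. h \<theta> * h \<theta> = 0)"
    by (rule integral_eq_0_iff) (auto intro!: continuous_intros cont)
  ultimately show ?thesis using \<theta> by auto
qed

lemma integral_cos_int:
  fixes k :: int
  shows "integral {0..pi} (\<lambda>\<theta>. cos (of_int k * \<theta>)) = (if k = 0 then pi else 0)"
proof (cases "k = 0")
  case False
  have "((\<lambda>\<theta>. cos (of_int k * \<theta>)) has_integral (sin (of_int k * pi) / of_int k - sin (of_int k * 0) / of_int k)) {0..pi}"
  proof (rule fundamental_theorem_of_calculus)
    fix x
    have "((\<lambda>\<theta>. sin (of_int k * \<theta>) / of_int k) has_real_derivative cos (of_int k * x)) (at x within {0..pi})"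
      using False by (auto intro!: derivative_eq_intros)
    thus "((\<lambda>\<theta>. sin (of_int k * \<theta>) / of_int k) has_vector_derivative cos (of_int k * x)) (at x within {0..pi})"
      by (simp add: has_real_derivative_iff_has_vector_derivative)
  qed simp
  moreover have "sin (of_int k * pi) = 0" by (metis sin_zero_iff_int2)
  ultimately show ?thesis using False by (simp add: integral_unique)
qed simp

lemma integral_cos_cos:
  "integral {0..pi} (\<lambda>\<theta>. cos (real j * \<theta>) * cos (real l * \<theta>)) =
     (if j = l then (if j = 0 then pi else pi / 2) else 0)"
proof -
  have e: "cos (real j * \<theta>) * cos (real l * \<theta>) =
      (1/2) * (cos (of_int (int j - int l) * \<theta>) + cos (of_int (int j + int l) * \<theta>))" for \<theta>
  proof -
    have 1: "cos (of_int (int j - int l) * \<theta>) = cos (real j * \<theta> - real l * \<theta>)"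
      and 2: "cos (of_int (int j + int l) * \<theta>) = cos (real j * \<theta> + real l * \<theta>)"
      by (simp_all add: algebra_simps)
    show ?thesis unfolding 1 2 cos_add cos_diff by simp
  qed
  have "integral {0..pi} (\<lambda>\<theta>. cos (real j * \<theta>) * cos (real l * \<theta>))
    = (1/2) * ((if int j - int l = 0 then pi else 0) + (if int j + int l = 0 then pi else 0))"
    unfolding e integral_mult_right integral_cos_int[symmetric]
    by (subst integral_add) (intro integrable_continuous_real continuous_intros refl)+
  thus ?thesis by auto
qed

text \<open>Summability makes the series converge uniformly to a continuous \<open>G\<close>;
  uniform convergence lets its moments be computed termwise, they agree with those of
  \<open>g\<close>, and \<open>cos_moments_determine\<close> identifies the two functions.\<close>

lemma cosine_series:
  fixes g :: "real \<Rightarrow> real"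
  assumes cont: "continuous_on {0..pi} g"
    and c: "\<And>j. c j = integral {0..pi} (\<lambda>\<theta>. g \<theta> * cos (real j * \<theta>))"
    and summ: "summable (\<lambda>j. \<bar>c j\<bar>)"
    and \<theta>: "\<theta> \<in> {0..pi}"
  shows "(\<lambda>j. (if j = 0 then c j / pi else 2 * c j / pi) * cos (real j * \<theta>)) sums g \<theta>"
proof -
  define d where "d j = (if j = 0 then c j / pi else 2 * c j / pi)" for j
  define G where "G \<theta> = (\<Sum>j. d j * cos (real j * \<theta>))" for \<theta>
  have sd: "summable (\<lambda>j. \<bar>d j\<bar>)"
  proof (rule summable_comparison_test)
    show "\<exists>N. \<forall>j\<ge>N. norm \<bar>d j\<bar> \<le> (2/pi) * \<bar>c j\<bar>"
      by (intro exI[of _ 0]) (auto simp: d_def abs_mult field_simps)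
    show "summable (\<lambda>j. (2/pi) * \<bar>c j\<bar>)" by (rule summable_mult[OF summ])
  qed
  have bd: "norm (d j * cos (real j * \<theta>)) \<le> \<bar>d j\<bar>" for j \<theta>
    using mult_left_mono[OF abs_cos_le_one[of "real j * \<theta>"], of "\<bar>d j\<bar>"] by (simp add: abs_mult)
  have ul: "uniform_limit {0..pi} (\<lambda>n \<theta>. \<Sum>j<n. d j * cos (real j * \<theta>)) G sequentially"
    unfolding G_def by (rule Weierstrass_m_test[OF _ sd]) (rule bd)
  have Gc: "continuous_on {0..pi} G"
    by (rule uniform_limit_theorem[OF _ ul]) (auto intro!: always_eventually continuous_intros)
  have mom: "integral {0..pi} (\<lambda>\<theta>. G \<theta> * cos (real l * \<theta>)) = c l" for l
  proof -
    have ul': "uniform_limit {0..pi} (\<lambda>n \<theta>. (\<Sum>j<n. d j * cos (real j * \<theta>)) * cos (real l * \<theta>)) (\<lambda>\<theta>. G \<theta> * cos (real l * \<theta>)) sequentially"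
    proof (rule uniform_limitI)
      fix e :: real assume "e > 0"
      from uniform_limitD[OF ul this]
      show "\<forall>\<^sub>F n in sequentially. \<forall>x\<in>{0..pi}. dist ((\<Sum>j<n. d j * cos (real j * x)) * cos (real l * x)) (G x * cos (real l * x)) < e"
      proof eventually_elim
        case (elim n)
        show ?case
        proof
          fix x assume "x \<in> {0..pi}"
          hence "\<bar>(\<Sum>j<n. d j * cos (real j * x)) - G x\<bar> < e" using elim by (simp add: dist_real_def)
          moreover have "\<bar>((\<Sum>j<n. d j * cos (real j * x)) - G x) * cos (real l * x)\<bar> \<le> \<bar>(\<Sum>j<n. d j * cos (real j * x)) - G x\<bar> * 1"
            unfolding abs_mult by (intro mult_left_mono) auto
          ultimately show "dist ((\<Sum>j<n. d j * cos (real j * x)) * cos (real l * x)) (G x * cos (real l * x)) < e"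
            by (simp add: dist_real_def left_diff_distrib)
        qed
      qed
    qed
    obtain I J where I: "\<And>n. ((\<lambda>\<theta>. (\<Sum>j<n. d j * cos (real j * \<theta>)) * cos (real l * \<theta>)) has_integral I n) {0..pi}"
      and J: "((\<lambda>\<theta>. G \<theta> * cos (real l * \<theta>)) has_integral J) {0..pi}" and lim: "I \<longlonglongrightarrow> J"
      by (rule uniform_limit_integral[OF ul']) (auto intro!: continuous_intros)
    have "I n = c l" if "n > l" for n
    proof -
      have "I n = integral {0..pi} (\<lambda>\<theta>. \<Sum>j<n. d j * (cos (real j * \<theta>) * cos (real l * \<theta>)))"
        using I[of n] by (simp add: integral_unique sum_distrib_right mult.assoc)
      also have "\<dots> = (\<Sum>j<n. d j * integral {0..pi} (\<lambda>\<theta>. cos (real j * \<theta>) * cos (real l * \<theta>)))"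
        by (subst integral_sum) (auto intro!: integrable_continuous_real continuous_intros)
      also have "\<dots> = (\<Sum>j<n. if j = l then d l * (if l = 0 then pi else pi/2) else 0)"
        unfolding integral_cos_cos by (intro sum.cong) auto
      also have "\<dots> = d l * (if l = 0 then pi else pi/2)" using that by simp
      also have "\<dots> = c l" by (simp add: d_def)
      finally show ?thesis .
    qed
    hence "\<forall>\<^sub>F n in sequentially. I n = c l" by (intro eventually_mono[OF eventually_gt_at_top[of l]]) auto
    hence "I \<longlonglongrightarrow> c l" by (rule tendsto_eventually)
    hence "J = c l" using lim LIMSEQ_unique by blast
    thus ?thesis using J by (simp add: integral_unique)
  qed
  have "(\<lambda>\<theta>. g \<theta> - G \<theta>) \<theta> = 0"
  proof (rule cos_moments_determine[OF _ _ \<theta>])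
    show "continuous_on {0..pi} (\<lambda>\<theta>. g \<theta> - G \<theta>)" by (intro continuous_intros cont Gc)
    fix j
    have "integral {0..pi} (\<lambda>\<theta>. (g \<theta> - G \<theta>) * cos (real j * \<theta>))
      = integral {0..pi} (\<lambda>\<theta>. g \<theta> * cos (real j * \<theta>)) - integral {0..pi} (\<lambda>\<theta>. G \<theta> * cos (real j * \<theta>))"
      unfolding left_diff_distrib
      by (rule integral_diff) (intro integrable_continuous_real continuous_intros cont Gc)+
    thus "integral {0..pi} (\<lambda>\<theta>. (g \<theta> - G \<theta>) * cos (real j * \<theta>)) = 0" by (simp add: mom c)
  qed
  hence "G \<theta> = g \<theta>" by simp
  moreover have "summable (\<lambda>j. d j * cos (real j * \<theta>))"
    by (rule summable_comparison_test[OF _ sd]) (use bd in auto)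
  ultimately have "(\<lambda>j. d j * cos (real j * \<theta>)) sums g \<theta>" unfolding G_def by (metis summable_sums)
  thus ?thesis unfolding d_def .
qed

text \<open>One integration by parts. The sine is written as a cosine with its phase shifted by
  \<open>pi/2\<close>, so that the formula can be iterated unchanged.\<close>

lemma cos_integral_step:
  fixes f f' :: "real \<Rightarrow> real"
  assumes "u \<le> v" "j \<noteq> 0" "continuous_on {u..v} f" "continuous_on {u..v} f'"
    and d: "\<And>t. \<lbrakk>u < t; t < v\<rbrakk> \<Longrightarrow> (f has_real_derivative f' t) (at t)"
  shows "integral {u..v} (\<lambda>t. f t * cos (j * t + c)) =
     (f v * sin (j * v + c) - f u * sin (j * u + c)) / j - integral {u..v} (\<lambda>t. f' t * cos (j * t + (c - pi/2))) / j"
proof -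
  let ?F = "\<lambda>t. f t * sin (j * t + c) / j"
  have s: "sin (j * t + c) = cos (j * t + (c - pi/2))" for t
    using sin_cos_eq[of "j * t + c"] cos_minus[of "pi/2 - (j * t + c)"] by (simp add: algebra_simps)
  have "((\<lambda>t. f' t * sin (j * t + c) / j + f t * cos (j * t + c)) has_integral (?F v - ?F u)) {u..v}"
  proof (rule fundamental_theorem_of_calculus_interior[OF assms(1)])
    show "continuous_on {u..v} ?F" by (intro continuous_intros assms) (use assms in auto)
    fix t assume "t \<in> {u<..<v}"
    hence t: "(f has_real_derivative f' t) (at t)" using d by auto
    have "((\<lambda>t. sin (j * t + c)) has_real_derivative cos (j * t + c) * j) (at t)"
      by (auto intro!: derivative_eq_intros)
    from DERIV_cdivide[OF DERIV_mult[OF t this], of j]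
    have "(?F has_real_derivative (f' t * sin (j * t + c) + cos (j * t + c) * j * f t) / j) (at t)" .
    moreover have "(f' t * sin (j * t + c) + cos (j * t + c) * j * f t) / j = f' t * sin (j * t + c) / j + f t * cos (j * t + c)"
      using assms(2) by (simp add: field_simps)
    ultimately show "(?F has_vector_derivative f' t * sin (j * t + c) / j + f t * cos (j * t + c)) (at t)"
      by (simp add: has_real_derivative_iff_has_vector_derivative)
  qed
  hence "integral {u..v} (\<lambda>t. f' t * sin (j * t + c) / j + f t * cos (j * t + c)) = ?F v - ?F u"
    by (rule integral_unique)
  moreover have "integral {u..v} (\<lambda>t. f' t * sin (j * t + c) / j + f t * cos (j * t + c))
    = integral {u..v} (\<lambda>t. f' t * sin (j * t + c) / j) + integral {u..v} (\<lambda>t. f t * cos (j * t + c))"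
    by (rule integral_add) (use assms in \<open>auto intro!: integrable_continuous_real continuous_intros\<close>)
  moreover have "integral {u..v} (\<lambda>t. f' t * sin (j * t + c) / j) = integral {u..v} (\<lambda>t. f' t * cos (j * t + (c - pi/2))) / j"
    unfolding s by simp
  ultimately show ?thesis unfolding diff_divide_distrib by linarith
qed

text \<open>Here \<open>b m\<close> is the \<open>m\<close>-th derivative of \<open>b 0\<close>,
  which \<open>max t \<theta>0\<close> continues as a constant to the left of
  \<open>\<theta>0\<close>. The integral over \<open>[0, \<theta>0]\<close> is explicit and cancels
  the boundary term at \<open>\<theta>0\<close> of the first integration by parts; the remaining
  \<open>K - 1\<close> integrations have no boundary terms.\<close>

lemma cos_coefficient_decay:
  fixes b :: "nat \<Rightarrow> real \<Rightarrow> real"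
  assumes \<theta>0: "0 \<le> \<theta>0" "\<theta>0 \<le> pi" and j: "1 \<le> j" and K: "1 \<le> K"
    and cont: "\<And>m. m \<le> K \<Longrightarrow> continuous_on {\<theta>0..pi} (b m)"
    and d: "\<And>m t. \<lbrakk>m < K; \<theta>0 < t; t < pi\<rbrakk> \<Longrightarrow> (b m has_real_derivative b (Suc m) t) (at t)"
    and z0: "\<And>m. \<lbrakk>1 \<le> m; m < K\<rbrakk> \<Longrightarrow> b m \<theta>0 = 0" and z1: "\<And>m. m < K \<Longrightarrow> b m pi = 0"
    and B: "\<And>t. \<lbrakk>\<theta>0 \<le> t; t \<le> pi\<rbrakk> \<Longrightarrow> \<bar>b K t\<bar> \<le> B"
  shows "\<bar>integral {0..pi} (\<lambda>t. b 0 (max t \<theta>0) * cos (real j * t))\<bar> \<le> pi * B / real j ^ K"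
proof -
  have B0: "0 \<le> B" using B[of \<theta>0] \<theta>0 by auto
  have dec: "\<bar>integral {\<theta>0..pi} (\<lambda>t. b (K - r) t * cos (real j * t + c))\<bar> \<le> pi * B / real j ^ r"
    if "r < K" for r c
    using that
  proof (induction r arbitrary: c)
    case 0
    have "norm (integral {\<theta>0..pi} (\<lambda>t. b K t * cos (real j * t + c))) \<le> B * (pi - \<theta>0)"
    proof (rule integral_bound)
      fix t assume "t \<in> {\<theta>0..pi}"
      hence "\<bar>b K t\<bar> * \<bar>cos (real j * t + c)\<bar> \<le> B * 1" using B B0 by (intro mult_mono) auto
      thus "norm (b K t * cos (real j * t + c)) \<le> B" by (simp add: abs_mult)
    qed (use \<theta>0 in \<open>auto intro!: continuous_intros cont\<close>)
    also have "\<dots> \<le> B * pi" using \<theta>0 B0 by (intro mult_left_mono) auto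
    finally show ?case by (simp add: mult.commute)
  next
    case (Suc r)
    define m where "m = K - Suc r"
    have m: "1 \<le> m" "m < K" "Suc m = K - r" unfolding m_def using Suc.prems by auto
    have "integral {\<theta>0..pi} (\<lambda>t. b m t * cos (real j * t + c)) =
      (b m pi * sin (real j * pi + c) - b m \<theta>0 * sin (real j * \<theta>0 + c)) / real j
       - integral {\<theta>0..pi} (\<lambda>t. b (Suc m) t * cos (real j * t + (c - pi/2))) / real j"
      by (rule cos_integral_step) (use m(1,2) j \<theta>0 d[OF m(2)] in \<open>auto intro!: cont\<close>)
    hence "\<bar>integral {\<theta>0..pi} (\<lambda>t. b m t * cos (real j * t + c))\<bar>
      = \<bar>integral {\<theta>0..pi} (\<lambda>t. b (K - r) t * cos (real j * t + (c - pi/2)))\<bar> / real j"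
      using z0[OF m(1,2)] z1[OF m(2)] by (simp add: m(3))
    also have "\<dots> \<le> (pi * B / real j ^ r) / real j"
      using Suc.IH[of "c - pi/2"] Suc.prems by (intro divide_right_mono) auto
    finally show ?case by (simp add: m_def mult.commute)
  qed
  let ?g = "\<lambda>t. b 0 (max t \<theta>0) * cos (real j * t)"
  have cg: "continuous_on {0..pi} ?g"
  proof -
    have "continuous_on {0..pi} (\<lambda>t. b 0 (max t \<theta>0))"
      by (rule continuous_on_compose2[OF cont[of 0]]) (use \<theta>0 in \<open>auto intro!: continuous_intros\<close>)
    thus ?thesis by (intro continuous_intros)
  qed
  have "integral {0..pi} ?g = integral {0..\<theta>0} ?g + integral {\<theta>0..pi} ?g"
    using Henstock_Kurzweil_Integration.integral_combine[OF \<theta>0 integrable_continuous_real[OF cg]] by simp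
  also have "integral {0..\<theta>0} ?g = integral {0..\<theta>0} (\<lambda>t. b 0 \<theta>0 * cos (real j * t + 0))"
    by (rule integral_cong) (auto simp: max_def)
  also have "\<dots> = b 0 \<theta>0 * sin (real j * \<theta>0) / real j"
    using cos_integral_step[of 0 \<theta>0 "real j" "\<lambda>_. b 0 \<theta>0" "\<lambda>_. 0" 0] \<theta>0 j by auto
  also have "integral {\<theta>0..pi} ?g = integral {\<theta>0..pi} (\<lambda>t. b 0 t * cos (real j * t + 0))"
    by (rule integral_cong) (auto simp: max_def)
  also have "\<dots> = (b 0 pi * sin (real j * pi + 0) - b 0 \<theta>0 * sin (real j * \<theta>0 + 0)) / real j
       - integral {\<theta>0..pi} (\<lambda>t. b (Suc 0) t * cos (real j * t + (0 - pi/2))) / real j"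
    by (rule cos_integral_step) (use K j \<theta>0 in \<open>auto intro!: cont d\<close>)
  finally have "integral {0..pi} ?g = - integral {\<theta>0..pi} (\<lambda>t. b (K - (K - 1)) t * cos (real j * t + (0 - pi/2))) / real j"
    using z1[of 0] K by (simp add: diff_divide_distrib)
  hence "\<bar>integral {0..pi} ?g\<bar> = \<bar>integral {\<theta>0..pi} (\<lambda>t. b (K - (K - 1)) t * cos (real j * t + (0 - pi/2)))\<bar> / real j"
    by simp
  also have "\<dots> \<le> (pi * B / real j ^ (K - 1)) / real j"
    by (intro divide_right_mono dec) (use K in auto)
  also have "\<dots> = pi * B / real j ^ Suc (K - 1)" by simp
  also have "Suc (K - 1) = K" using K by simp
  finally show ?thesis .
qed

text \<open>The quotient \<open>q = min 1 (j * \<epsilon>) / j\<close> is at most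
  \<open>\<epsilon>\<close> and at most \<open>2 / (j + 1 / \<epsilon>)\<close>. Of its
  \<open>k + 1\<close> factors, \<open>k - 1\<close> are estimated in the first way and two in the
  second, which leaves a telescoping sum of size \<open>\<epsilon>\<close>.\<close>

lemma sum_min_power_le:
  assumes "0 < \<epsilon>" "1 \<le> k"
  shows "(\<Sum>j=1..J. (min 1 (real j * \<epsilon>)) ^ Suc k / real j ^ Suc k) \<le> 4 * \<epsilon> ^ k"
proof -
  have termb: "(min 1 (real j * \<epsilon>)) ^ Suc k / real j ^ Suc k
      \<le> \<epsilon> ^ (k-1) * (4 * (1 / (real j - 1 + 1/\<epsilon>) - 1 / (real j + 1/\<epsilon>)))" if j: "1 \<le> j" for j
  proof -
    define y where "y = 1 / \<epsilon>"
    have y: "y > 0" "\<epsilon> = 1 / y" unfolding y_def using assms by auto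
    define q where "q = min 1 (real j * \<epsilon>) / real j"
    have j0: "real j \<ge> 1" using j by simp
    have q0: "0 \<le> q" unfolding q_def using assms by simp
    have q1: "q \<le> \<epsilon>" unfolding q_def using j0 by (simp add: divide_le_eq mult.commute)
    have q2: "q \<le> 2 / (real j + y)"
    proof (cases "real j \<le> y")
      case True
      have "\<epsilon> \<le> 2 / (real j + y)" unfolding y(2) using True y(1) j0 by (simp add: field_simps)
      thus ?thesis using q1 by linarith
    next
      case False
      have "q \<le> 1 / real j" unfolding q_def using j0 by (intro divide_right_mono) auto
      also have "\<dots> \<le> 2 / (real j + y)" using False y(1) j0 by (simp add: field_simps)
      finally show ?thesis .
    qed
    have k: "Suc k = (k - 1) + 2" using assms by simp
    have "(min 1 (real j * \<epsilon>)) ^ Suc k / real j ^ Suc k = q ^ Suc k"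
      unfolding q_def power_divide ..
    also have "\<dots> = q ^ (k-1) * q\<^sup>2" unfolding k power_add ..
    also have "\<dots> \<le> \<epsilon> ^ (k-1) * (2 / (real j + y))\<^sup>2"
      using q0 q1 q2 assms by (intro mult_mono power_mono) auto
    also have "(2 / (real j + y))\<^sup>2 \<le> 4 * (1 / (real j - 1 + y) - 1 / (real j + y))"
    proof -
      have p: "0 < real j - 1 + y" "0 < real j + y" using j0 y by auto
      have "1 / (real j - 1 + y) - 1 / (real j + y) = 1 / ((real j - 1 + y) * (real j + y))"
        using p by (simp add: field_simps)
      also have "\<dots> \<ge> 1 / ((real j + y) * (real j + y))"
        using p by (intro divide_left_mono mult_right_mono) auto
      finally show ?thesis by (simp add: power_divide power2_eq_square)
    qed
    finally show ?thesis using assms by (simp add: y_def mult_left_mono)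
  qed
  have "(\<Sum>j=1..J. (min 1 (real j * \<epsilon>)) ^ Suc k / real j ^ Suc k)
     \<le> (\<Sum>j=1..J. \<epsilon> ^ (k-1) * (4 * (1 / (real j - 1 + 1/\<epsilon>) - 1 / (real j + 1/\<epsilon>))))"
    by (intro sum_mono termb) auto
  also have "\<dots> = \<epsilon> ^ (k-1) * (4 * (\<Sum>j=1..J. (1 / (real j - 1 + 1/\<epsilon>) - 1 / (real j + 1/\<epsilon>))))"
    by (simp only: sum_distrib_left)
  also have "(\<Sum>j=1..J. (1 / (real j - 1 + 1/\<epsilon>) - 1 / (real j + 1/\<epsilon>))) = \<epsilon> - 1 / (real J + 1/\<epsilon>)"
    by (induction J) (auto simp: add.commute)
  also have "\<epsilon> ^ (k-1) * (4 * (\<epsilon> - 1 / (real J + 1/\<epsilon>))) \<le> \<epsilon> ^ (k-1) * (4 * \<epsilon>)"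
    using assms by (intro mult_left_mono) auto
  also have "\<dots> = 4 * \<epsilon> ^ Suc (k - 1)" by simp
  also have "Suc (k-1) = k" using assms by simp
  finally show ?thesis .
qed

section \<open>Separating two angles by a cosine of low frequency\<close>

lemma sin_ge_half: "\<lbrakk>0 \<le> u; u \<le> pi/2\<rbrakk> \<Longrightarrow> u / 2 \<le> sin u"
proof (cases "u \<le> pi/3")
  case True
  assume u: "0 \<le> u"
  have "sin 0 - 0 / 2 \<le> sin u - u / 2"
  proof (rule DERIV_nonneg_imp_nondecreasing[OF u])
    fix x assume x: "0 \<le> x" "x \<le> u"
    have "cos (pi/3) \<le> cos x" using x True by (intro cos_monotone_0_pi_le) auto
    thus "\<exists>y. ((\<lambda>u. sin u - u/2) has_real_derivative y) (at x) \<and> 0 \<le> y"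
      by (intro exI[of _ "cos x - 1/2"]) (auto intro!: derivative_eq_intros simp: cos_60)
  qed
  thus ?thesis by simp
next
  case False
  assume u: "u \<le> pi/2"
  have "sqrt 3 / 2 \<le> sin u" using False u sin_monotone_2pi_le[of "pi/3" u] by (simp add: sin_60)
  moreover have "u / 2 \<le> sqrt 3 / 2"
  proof -
    have "u \<le> 1.6" using u pi_approx by simp
    also have "(1.6::real) \<le> sqrt 3" by (rule real_le_rsqrt) (simp add: power2_eq_square)
    finally show ?thesis by simp
  qed
  ultimately show ?thesis by simp
qed

text \<open>This is \<open>M\<close> times the classical Fejer kernel. The double sum displays its
  frequencies as differences \<open>i - l\<close>, all of modulus less than
  \<open>M\<close>.\<close>

definition fejer :: "nat \<Rightarrow> real \<Rightarrow> real" where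
  "fejer M z = (\<Sum>i<M. \<Sum>l<M. cos ((real i - real l) * z))"

lemma fejer_eq: "fejer M z = (cmod (\<Sum>i<M. cis z ^ i))\<^sup>2"
proof -
  have "(\<Sum>i<M. cis z ^ i) = Complex (\<Sum>i<M. cos (real i * z)) (\<Sum>i<M. sin (real i * z))"
    by (simp add: complex_eq_iff cos_n_Re_cis_pow_n sin_n_Im_cis_pow_n)
  hence "(cmod (\<Sum>i<M. cis z ^ i))\<^sup>2 = (\<Sum>i<M. cos (real i * z))\<^sup>2 + (\<Sum>i<M. sin (real i * z))\<^sup>2"
    by (simp add: cmod_power2)
  also have "\<dots> = fejer M z"
    unfolding fejer_def power2_eq_square sum_product sum.distrib[symmetric]
    by (simp add: left_diff_distrib cos_diff)
  finally show ?thesis by simp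
qed

lemma fejer_nonneg: "0 \<le> fejer M z"
  by (simp add: fejer_eq)

lemma fejer_zero: "fejer M 0 = (real M)\<^sup>2"
  by (simp add: fejer_def power2_eq_square)

text \<open>Summing the geometric series: the squared modulus of \<open>1 - cis z\<close> is
  \<open>4 * (sin (z/2))^2\<close>, and that of \<open>1 - cis z ^ M\<close> is at most 4.\<close>

lemma fejer_le: "fejer M z * (sin (z/2))\<^sup>2 \<le> 1"
proof -
  have "(cmod (1 - cis z))\<^sup>2 = 4 * (sin (z/2))\<^sup>2"
  proof -
    have "cos z = 1 - 2 * (sin (z/2))\<^sup>2" using cos_double_sin[of "z/2"] by simp
    moreover have "(cmod (1 - cis z))\<^sup>2 = (1 - cos z)\<^sup>2 + (sin z)\<^sup>2" by (simp add: cmod_power2)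
    ultimately show ?thesis using sin_cos_squared_add[of z]
      by (simp add: power2_diff algebra_simps)
  qed
  hence "4 * (fejer M z * (sin (z/2))\<^sup>2) = (cmod ((1 - cis z) * (\<Sum>i<M. cis z ^ i)))\<^sup>2"
    by (simp add: fejer_eq norm_mult power_mult_distrib)
  also have "(1 - cis z) * (\<Sum>i<M. cis z ^ i) = 1 - cis z ^ M" by (simp add: one_diff_power_eq)
  also have "(cmod (1 - cis z ^ M))\<^sup>2 \<le> (1 + 1)\<^sup>2"
    by (intro power_mono order.trans[OF norm_triangle_ineq4]) (auto simp: norm_power)
  finally show ?thesis by simp
qed

text \<open>The combination \<open>Q\<close> of cosines is at least \<open>M^2\<close> at
  \<open>\<phi>\<close> and at most \<open>M^2 / 2\<close> at \<open>\<theta>\<close>. It has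
  \<open>M^2\<close> terms with coefficients of modulus at most 2, so not all of these cosines can
  nearly agree at the two points.\<close>

lemma cos_separation:
  assumes \<theta>: "0 \<le> \<theta>" "\<theta> \<le> pi" and \<phi>: "0 \<le> \<phi>" "\<phi> \<le> pi" and ne: "\<theta> \<noteq> \<phi>"
  obtains p :: nat where "1 \<le> p" "real p \<le> 8 / \<bar>\<theta> - \<phi>\<bar>" "1/8 \<le> \<bar>cos (real p * \<theta>) - cos (real p * \<phi>)\<bar>"
proof -
  define \<rho> where "\<rho> = \<bar>\<theta> - \<phi>\<bar>"
  have \<rho>: "0 < \<rho>" "\<rho> \<le> pi" unfolding \<rho>_def using assms by auto
  \<comment> \<open>With \<open>M \<ge> 8 / \<rho>\<close> one has
    \<open>2 / M \<le> \<rho> / 4\<close>, and \<open>fejer_le\<close> gives at most a quarter of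
    the peak value \<open>M^2\<close> wherever
    \<open>\<bar>sin (z/2)\<bar> \<ge> \<rho> / 4\<close>.\<close>
  define M where "M = nat \<lceil>8 / \<rho>\<rceil>"
  have M: "8 / \<rho> \<le> real M" "real M - 1 < 8 / \<rho>"
  proof -
    have "real M = of_int \<lceil>8 / \<rho>\<rceil>" unfolding M_def using \<rho> by simp
    thus "8 / \<rho> \<le> real M" "real M - 1 < 8 / \<rho>" using ceiling_correct[of "8 / \<rho>"] by linarith+
  qed
  have Mp: "real M > 0" using M \<rho> by (meson divide_pos_pos less_le_trans zero_less_numeral)
  have small: "fejer M z \<le> (real M)\<^sup>2 / 4" if z: "\<rho>/4 \<le> \<bar>sin (z/2)\<bar>" for z
  proof -
    have "2 / real M \<le> \<rho>/4" using M \<rho> Mp by (simp add: field_simps)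
    hence "2 / real M \<le> \<bar>sin (z/2)\<bar>" using z by linarith
    hence "(2 / real M)\<^sup>2 \<le> (sin (z/2))\<^sup>2" using Mp power_mono[of "2 / real M" "\<bar>sin (z/2)\<bar>" 2] by simp
    hence "fejer M z * (2 / real M)\<^sup>2 \<le> fejer M z * (sin (z/2))\<^sup>2"
      by (intro mult_left_mono fejer_nonneg)
    also have "\<dots> \<le> 1" by (rule fejer_le)
    finally show ?thesis using Mp by (simp add: power_divide field_simps)
  qed
  have s1: "\<rho>/4 \<le> sin (\<rho>/2)" using sin_ge_half[of "\<rho>/2"] \<rho> by simp
  have F1: "fejer M (\<theta> - \<phi>) \<le> (real M)\<^sup>2 / 4"
  proof (rule small)
    have "\<bar>sin ((\<theta> - \<phi>)/2)\<bar> = \<bar>sin (\<rho>/2)\<bar>"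
    proof (cases "\<theta> \<ge> \<phi>")
      case False
      have "sin ((\<phi> - \<theta>)/2) = - sin ((\<theta> - \<phi>)/2)"
        using sin_minus[of "(\<theta> - \<phi>)/2"] by (simp add: minus_divide_left)
      thus ?thesis using False unfolding \<rho>_def by (simp add: abs_if)
    qed (simp add: \<rho>_def)
    thus "\<rho>/4 \<le> \<bar>sin ((\<theta> - \<phi>)/2)\<bar>" using s1 by linarith
  qed
  have F2: "fejer M (\<theta> + \<phi>) \<le> (real M)\<^sup>2 / 4"
  proof (rule small)
    let ?w = "(\<theta> + \<phi>)/2"
    \<comment> \<open>The mean of two angles in \<open>[0, pi]\<close> at distance
      \<open>\<rho>\<close> stays \<open>\<rho>/2\<close> away from both 0 and
      \<open>pi\<close>.\<close>
    have w: "\<rho>/2 \<le> ?w" "?w \<le> pi - \<rho>/2" unfolding \<rho>_def using assms by (auto simp: abs_if)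
    have "sin (\<rho>/2) \<le> sin ?w"
    proof (cases "?w \<le> pi/2")
      case True
      thus ?thesis using w \<rho> by (intro sin_monotone_2pi_le) auto
    next
      case False
      have "- (pi/2) \<le> \<rho>/2" "\<rho>/2 \<le> pi - ?w" "pi - ?w \<le> pi/2" using w \<rho> False by linarith+
      hence "sin (\<rho>/2) \<le> sin (pi - ?w)" by (intro sin_monotone_2pi_le)
      thus ?thesis by simp
    qed
    thus "\<rho>/4 \<le> \<bar>sin ((\<theta> + \<phi>)/2)\<bar>" using s1 by linarith
  qed
  \<comment> \<open>Adding the reflected kernel removes the sines: \<open>Q z\<close> is a
    combination of the functions \<open>cos (p * z)\<close>, that is, of Chebyshev polynomials in
    \<open>cos z\<close>.\<close>
  define Q where "Q z = (\<Sum>i<M. \<Sum>l<M. 2 * cos ((real i - real l) * \<phi>) * cos ((real i - real l) * z))" for z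
  have Qe: "Q z = fejer M (z - \<phi>) + fejer M (z + \<phi>)" for z
    unfolding Q_def fejer_def sum.distrib[symmetric]
    by (intro sum.cong refl) (simp add: right_diff_distrib distrib_left cos_add cos_diff)
  have Q1: "Q \<phi> \<ge> (real M)\<^sup>2" unfolding Qe using fejer_nonneg[of M "\<phi> + \<phi>"] by (simp add: fejer_zero)
  have Q2: "Q \<theta> \<le> (real M)\<^sup>2 / 2" unfolding Qe using F1 F2 by simp
  have "\<exists>i<M. \<exists>l<M. 1/8 \<le> \<bar>cos ((real i - real l) * \<theta>) - cos ((real i - real l) * \<phi>)\<bar>"
  proof (rule ccontr)
    assume "\<not> ?thesis"
    hence lt: "\<bar>cos ((real i - real l) * \<theta>) - cos ((real i - real l) * \<phi>)\<bar> \<le> 1/8" if "i < M" "l < M" for i l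
      using that by force
    have "Q \<phi> - Q \<theta> = (\<Sum>i<M. \<Sum>l<M. 2 * cos ((real i - real l) * \<phi>) * (cos ((real i - real l) * \<phi>) - cos ((real i - real l) * \<theta>)))"
      unfolding Q_def sum_subtractf[symmetric] by (simp add: algebra_simps)
    also have "\<dots> \<le> (\<Sum>i<M. \<Sum>l<M. 1/4)"
    proof (intro sum_mono)
      fix i l assume "i \<in> {..<M}" "l \<in> {..<M}"
      hence "\<bar>2 * cos ((real i - real l) * \<phi>)\<bar> * \<bar>cos ((real i - real l) * \<phi>) - cos ((real i - real l) * \<theta>)\<bar> \<le> 2 * (1/8)"
        using lt[of i l] by (intro mult_mono) (auto simp: abs_minus_commute abs_mult)
      thus "2 * cos ((real i - real l) * \<phi>) * (cos ((real i - real l) * \<phi>) - cos ((real i - real l) * \<theta>)) \<le> 1/4"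
        unfolding abs_mult[symmetric] by linarith
    qed
    also have "\<dots> = (real M)\<^sup>2 / 4" by (simp add: power2_eq_square)
    finally have "(real M)\<^sup>2 / 2 \<le> (real M)\<^sup>2 / 4" using Q1 Q2 by linarith
    thus False using Mp by (simp add: power2_eq_square)
  qed
  then obtain i l where il: "i < M" "l < M" "1/8 \<le> \<bar>cos ((real i - real l) * \<theta>) - cos ((real i - real l) * \<phi>)\<bar>"
    by blast
  define p where "p = (if l \<le> i then i - l else l - i)"
  have pe: "cos ((real i - real l) * z) = cos (real p * z)" for z
  proof (cases "l \<le> i")
    case False
    have "cos ((real i - real l) * z) = cos (- ((real i - real l) * z))" by simp
    also have "\<dots> = cos (real p * z)" using False by (simp add: p_def of_nat_diff algebra_simps)
    finally show ?thesis .
  qed (simp add: p_def of_nat_diff)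
  have "p \<noteq> 0" using il(3) unfolding pe by (intro notI) simp
  hence "1 \<le> p" by simp
  moreover have "real p \<le> 8 / \<bar>\<theta> - \<phi>\<bar>"
  proof -
    have "p \<le> M - 1" unfolding p_def using il by auto
    hence "real p \<le> real M - 1" using il by linarith
    thus ?thesis using M(2) unfolding \<rho>_def by linarith
  qed
  ultimately show thesis using that il(3) unfolding pe by blast
qed

section \<open>Localization in one variable\<close>

text \<open>\<open>f m\<close> plays the role of the \<open>m\<close>-th derivative of the cutoff function \<open>f 0\<close> on the half-line.\<close>

definition cutoff_family :: "nat \<Rightarrow> (nat \<Rightarrow> real \<Rightarrow> real) \<Rightarrow> real \<Rightarrow> bool" where
  "cutoff_family K f M \<longleftrightarrow>
     (\<forall>m<K. \<forall>s\<ge>0. (f m has_real_derivative f (Suc m) s) (at s within {0..})) \<and>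
     continuous_on {0..} (f K) \<and> (\<forall>m\<ge>1. m < K \<longrightarrow> f m 0 = 0) \<and>
     (\<forall>m\<le>K. \<forall>s\<ge>2. f m s = 0) \<and> (\<forall>s\<ge>0. \<bar>f K s\<bar> \<le> M)"

lemma cutoff_familyD:
  assumes "cutoff_family K f M"
  shows "\<lbrakk>m < K; 0 \<le> s\<rbrakk> \<Longrightarrow> (f m has_real_derivative f (Suc m) s) (at s within {0..})"
    and "m \<le> K \<Longrightarrow> continuous_on {0..} (f m)"
    and "\<lbrakk>1 \<le> m; m < K\<rbrakk> \<Longrightarrow> f m 0 = 0"
    and "\<lbrakk>m \<le> K; 2 \<le> s\<rbrakk> \<Longrightarrow> f m s = 0"
    and "0 \<le> s \<Longrightarrow> \<bar>f K s\<bar> \<le> M"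
    and "0 \<le> M"
proof -
  show d: "(f m has_real_derivative f (Suc m) s) (at s within {0..})" if "m < K" "0 \<le> s" for m s
    using assms that unfolding cutoff_family_def by blast
  show "continuous_on {0..} (f m)" if "m \<le> K"
  proof (cases "m = K")
    case False
    with that show ?thesis by (intro DERIV_continuous_on[of _ _ "f (Suc m)"] d) auto
  qed (use assms in \<open>simp add: cutoff_family_def\<close>)
  show M: "\<bar>f K s\<bar> \<le> M" if "0 \<le> s" for s using assms that unfolding cutoff_family_def by blast
  show "0 \<le> M" using M[of 0] by simp
qed (use assms in \<open>simp_all add: cutoff_family_def\<close>)

text \<open>Descending induction on the order by the mean value theorem on \<open>[s, 2]\<close>:
  each derivative vanishes at 2, and the length of the interval costs a factor of at most 2.\<close>

lemma cutoff_deriv_bound: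
  assumes cf: "cutoff_family K f M" and s: "0 \<le> s" and r: "r \<le> K"
  shows "\<bar>f (K - r) s\<bar> \<le> 2 ^ r * M"
  using r s
proof (induction r arbitrary: s)
  case (Suc r)
  define m where "m = K - Suc r"
  have m: "m < K" "Suc m = K - r" unfolding m_def using Suc.prems by auto
  note d = cutoff_familyD(1)[OF cf] and z2 = cutoff_familyD(4)[OF cf] and M0 = cutoff_familyD(6)[OF cf]
  show ?case
  proof (cases "s < 2")
    case True
    have c: "continuous_on {s..2} (f m)"
      by (rule continuous_on_subset[OF cutoff_familyD(2)[OF cf]]) (use Suc.prems m in auto)
    have dd: "(f m has_real_derivative f (Suc m) t) (at t)" if "s < t" for t
    proof -
      have "t \<in> interior {0..}" using that Suc.prems by simp
      hence "at t within {0..} = at t" by (rule at_within_interior)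
      thus ?thesis using d[OF m(1), of t] that Suc.prems by simp
    qed
    obtain l z where z: "s < z" "z < 2" "(f m has_real_derivative l) (at z)" "f m 2 - f m s = (2 - s) * l"
      using MVT[OF True c] dd real_differentiable_def by blast
    have "l = f (Suc m) z" using DERIV_unique[OF z(3) dd[OF z(1)]] .
    hence l: "\<bar>l\<bar> \<le> 2 ^ r * M" using Suc.IH[of z] Suc.prems z unfolding m(2) by auto
    have "\<bar>f m s\<bar> = \<bar>2 - s\<bar> * \<bar>l\<bar>" using z(4) z2[of m 2] m by (simp add: abs_mult[symmetric])
    also have "\<dots> \<le> 2 * (2 ^ r * M)" using Suc.prems True l by (intro mult_mono) auto
    finally show ?thesis by (simp add: m_def)
  next
    case False
    thus ?thesis using z2[of "K - Suc r" s] Suc.prems M0 by simp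
  qed
qed (use cutoff_familyD(5)[OF cf] in simp)

text \<open>Transports the bound from order \<open>3 * k - 1\<close>, in which the final constant is
  expressed, to the order \<open>k + 1\<close> of the cosine expansion.\<close>

lemma cutoff_family_lower:
  assumes cf: "cutoff_family K' f M" and K: "K \<le> K'"
  shows "cutoff_family K f (2 ^ (K' - K) * M)"
  unfolding cutoff_family_def
  using cutoff_familyD(1-4)[OF cf] cutoff_deriv_bound[OF cf, of _ "K' - K"] K by auto

section \<open>Commutators as functions of the symbol, and the reproducing kernel\<close>

context jacobi_param
begin

text \<open>The commutator sees the symbol only up to a finite index, so the cutoff may be replaced
  by a cosine series that represents it on a bounded range.\<close>

lemma ad_cong:
  "(\<And>\<nu>. \<nu> \<le> degree p + k * degree Q \<Longrightarrow> h \<nu> = h' \<nu>) \<Longrightarrow> ad Q h k p = ad Q h' k p"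
proof (induction k arbitrary: p)
  case 0
  thus ?case unfolding ad.simps Mult_def by (intro sum.cong) auto
next
  case (Suc k)
  have "ad Q h k p = ad Q h' k p" by (rule Suc.IH) (use Suc.prems in auto)
  moreover have "ad Q h k (Q * p) = ad Q h' k (Q * p)"
  proof (rule Suc.IH)
    fix \<nu> assume "\<nu> \<le> degree (Q * p) + k * degree Q"
    hence "\<nu> \<le> degree p + Suc k * degree Q" using degree_mult_le[of Q p] by simp
    thus "h \<nu> = h' \<nu>" by (rule Suc.prems)
  qed
  ultimately show ?case by simp
qed

lemma ip_Mult_left: "ip (Mult h p) r = (\<Sum>\<nu>\<le>degree p. h \<nu> * (ip p (en \<nu>) * ip (en \<nu>) r))"
  by (simp add: Mult_def ip_sum_left ip_smult_left mult.assoc)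

lemma ad_lincomb:
  "ip (ad Q (\<lambda>\<nu>. \<Sum>j\<in>J. d j * g j \<nu>) k p) r = (\<Sum>j\<in>J. d j * ip (ad Q (g j) k p) r)"
proof (induction k arbitrary: p r)
  case 0
  show ?case unfolding ad.simps ip_Mult_left sum_distrib_left sum_distrib_right
    by (subst sum.swap) (simp add: mult.assoc)
next
  case (Suc k)
  show ?case unfolding ad.simps ip_diff_left ip_mult[of Q] Suc
    by (simp add: sum_subtractf right_diff_distrib)
qed

lemma ad_tendsto:
  assumes "\<And>\<nu>. (\<lambda>n. h n \<nu>) \<longlonglongrightarrow> h' \<nu>"
  shows "(\<lambda>n. ip (ad Q (h n) k p) r) \<longlonglongrightarrow> ip (ad Q h' k p) r"
proof (induction k arbitrary: p r)
  case 0
  show ?case unfolding ad.simps ip_Mult_left by (intro tendsto_intros assms)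
next
  case (Suc k)
  show ?case unfolding ad.simps ip_diff_left ip_mult[of Q] by (intro tendsto_diff Suc)
qed

text \<open>The reproducing kernel at \<open>y\<close> of the polynomials of degree at most
  \<open>N\<close> (see \<open>ip_ker\<close>), a polynomial substitute for the point mass at
  \<open>y\<close>.\<close>

definition ker :: "nat \<Rightarrow> real \<Rightarrow> real poly" where
  "ker N y = (\<Sum>\<mu>\<le>N. smult (poly (en \<mu>) y) (en \<mu>))"

lemma degree_ker: "degree (ker N y) \<le> N"
  unfolding ker_def by (rule degree_sum_le) (auto intro: order.trans[OF degree_smult_le] simp: degree_en)

lemma ip_ker:
  assumes "degree q \<le> N" shows "ip (ker N y) q = poly q y"
proof -
  have "poly q y = (\<Sum>\<mu>\<le>N. ip q (en \<mu>) * poly (en \<mu>) y)"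
    by (subst en_expand[OF assms]) (simp add: poly_sum)
  thus ?thesis unfolding ker_def ip_sum_left ip_smult_left by (simp add: ip_commute[of q] mult.commute)
qed

lemma poly_Mult_ker:
  assumes "\<And>\<nu>. L < \<nu> \<Longrightarrow> h \<nu> = 0" "L \<le> N"
  shows "poly (Mult h (ker N y)) x = (\<Sum>\<nu>\<le>L. h \<nu> * poly (en \<nu>) x * poly (en \<nu>) y)"
proof -
  have "poly (Mult h (ker N y)) x = (\<Sum>\<nu>\<le>N. h \<nu> * poly (en \<nu>) x * poly (en \<nu>) y)"
    unfolding Mult_eq[OF degree_ker] poly_sum by (intro sum.cong) (auto simp: ip_ker degree_en)
  also have "\<dots> = (\<Sum>\<nu>\<le>L. h \<nu> * poly (en \<nu>) x * poly (en \<nu>) y)"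
    by (rule sum.mono_neutral_right) (use assms in auto)
  finally show ?thesis .
qed

text \<open>This converts operator norm bounds for iterated commutators into off-diagonal decay of the kernel.\<close>

lemma ad_ker:
  assumes h: "\<And>\<nu>. L < \<nu> \<Longrightarrow> h \<nu> = 0" and "L + degree r + k * degree Q \<le> N"
  shows "ad Q h k (r * ker N y) = smult (poly r y) ((Q - [:poly Q y:]) ^ k * Mult h (ker N y))"
  using assms(2)
proof (induction k arbitrary: r)
  case 0
  have "Mult h (r * ker N y) = smult (poly r y) (Mult h (ker N y))"
  proof (rule poly_eq_en)
    fix \<nu>
    show "ip (Mult h (r * ker N y)) (en \<nu>) = ip (smult (poly r y) (Mult h (ker N y))) (en \<nu>)"
    proof (cases "\<nu> \<le> L")
      case True
      \<comment> \<open>Here the size of \<open>N\<close> enters: \<open>r * en \<nu>\<close> is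
        still reproduced by \<open>ker N y\<close>, which therefore acts as a point mass.\<close>
      hence "degree (r * en \<nu>) \<le> N" "degree (en \<nu>) \<le> N"
        using 0 degree_mult_le[of r "en \<nu>"] by (auto simp: degree_en)
      thus ?thesis by (simp add: ip_Mult_en ip_smult_left ip_mult ip_ker)
    qed (simp add: ip_Mult_en ip_smult_left h)
  qed
  thus ?case by simp
next
  case (Suc k)
  have 1: "ad Q h k (r * ker N y) = smult (poly r y) ((Q - [:poly Q y:]) ^ k * Mult h (ker N y))"
    by (rule Suc.IH) (use Suc.prems in auto)
  have "ad Q h k ((Q * r) * ker N y) = smult (poly (Q * r) y) ((Q - [:poly Q y:]) ^ k * Mult h (ker N y))"
    by (rule Suc.IH) (use Suc.prems degree_mult_le[of Q r] in auto)
  hence 2: "ad Q h k (Q * (r * ker N y)) = smult (poly (Q * r) y) ((Q - [:poly Q y:]) ^ k * Mult h (ker N y))"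
    by (simp add: mult.assoc)
  show ?case unfolding ad.simps 1 2
    by (rule poly_ext) (simp add: algebra_simps)
qed

lemma wn_pos: "\<lbrakk>1 \<le> n; -1 \<le> x; x \<le> 1\<rbrakk> \<Longrightarrow> 0 < wn n x"
proof -
  assume n: "1 \<le> n" and x: "-1 \<le> x" "x \<le> 1"
  have "0 < 1 / (real n)\<^sup>2" using n by simp
  hence "0 < 1 - x + 1 / (real n)\<^sup>2" "0 < 1 + x + 1 / (real n)\<^sup>2" using x by linarith+
  thus ?thesis unfolding wn_def by simp
qed

lemma wn_scale:
  assumes n: "1 \<le> n" and c: "1 \<le> c" and x: "-1 \<le> x" "x \<le> 1"
  shows "wn n x \<le> (real c)\<^sup>2 powr (a + 1/2) * (real c)\<^sup>2 powr (b + 1/2) * wn (c * n) x"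
proof -
  have c2: "1 \<le> (real c)\<^sup>2" using c by simp
  have e: "1 / (real n)\<^sup>2 = (real c)\<^sup>2 * (1 / (real (c * n))\<^sup>2)" using c n by (simp add: power_mult_distrib)
  have 1: "(u + 1 / (real n)\<^sup>2) powr s \<le> (real c)\<^sup>2 powr s * (u + 1 / (real (c * n))\<^sup>2) powr s"
    if "0 \<le> u" "0 \<le> s" for u s
  proof -
    have "u * 1 \<le> u * (real c)\<^sup>2" using that c2 by (intro mult_left_mono) auto
    hence "u + 1 / (real n)\<^sup>2 \<le> (real c)\<^sup>2 * (u + 1 / (real (c * n))\<^sup>2)" unfolding e by (simp add: algebra_simps)
    hence "(u + 1 / (real n)\<^sup>2) powr s \<le> ((real c)\<^sup>2 * (u + 1 / (real (c * n))\<^sup>2)) powr s"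
      using that by (intro powr_mono2) auto
    thus ?thesis by (simp only: powr_mult)
  qed
  have "wn n x \<le> ((real c)\<^sup>2 powr (a + 1/2) * (1 - x + 1 / (real (c * n))\<^sup>2) powr (a + 1/2))
     * ((real c)\<^sup>2 powr (b + 1/2) * (1 + x + 1 / (real (c * n))\<^sup>2) powr (b + 1/2))"
    unfolding wn_def using x a_ge b_ge by (intro mult_mono 1) auto
  thus ?thesis by (simp add: wn_def mult_ac)
qed

text \<open>\<open>Christoffel_bound\<close> enters twice: for \<open>q\<close> at \<open>x\<close>,
  and for \<open>ker N y\<close> at \<open>y\<close>, where the value is the squared norm by
  \<open>ip_ker\<close>, so that a bound for the norm results. The scale \<open>c * n\<close> of the
  degrees is then traded for \<open>n\<close> by \<open>wn_scale\<close>.\<close>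

lemma kernel_pointwise:
  fixes c :: nat
  assumes c: "1 \<le> c"
  obtains C0 where "C0 > 0" and "\<And>n N q L x y. \<lbrakk>1 \<le> n; N \<le> c * n; degree q \<le> c * n; 0 \<le> L;
      -1 \<le> x; x \<le> 1; -1 \<le> y; y \<le> 1; nrm q \<le> L * nrm (ker N y)\<rbrakk>
      \<Longrightarrow> \<bar>poly q x\<bar> * (sqrt (wn n x) * sqrt (wn n y)) \<le> C0 * real n * L"
proof -
  obtain C where C: "C > 0" "\<And>D p x. \<lbrakk>1 \<le> D; degree p \<le> D; -1 \<le> x; x \<le> 1\<rbrakk>
      \<Longrightarrow> (poly p x)\<^sup>2 * wn D x \<le> C * real D * ip p p"
    using Christoffel_bound by blast
  define s where "s = (real c)\<^sup>2 powr (a + 1/2) * (real c)\<^sup>2 powr (b + 1/2)"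
  have s: "s > 0" unfolding s_def using c by simp
  have "C * real c * s > 0" using C s c by simp
  moreover have "\<bar>poly q x\<bar> * (sqrt (wn n x) * sqrt (wn n y)) \<le> (C * real c * s) * real n * L"
    if n: "1 \<le> n" and N: "N \<le> c * n" and q: "degree q \<le> c * n" and L: "0 \<le> L"
      and x: "-1 \<le> x" "x \<le> 1" and y: "-1 \<le> y" "y \<le> 1" and le: "nrm q \<le> L * nrm (ker N y)" for n N q L x y
  proof -
    define D where "D = c * n"
    have D: "1 \<le> D" unfolding D_def using c n by simp
    have wD: "0 < wn D x" "0 < wn D y" using D x y wn_pos by auto
    have CD: "0 \<le> C * real D" using C by simp
    have q1: "\<bar>poly q x\<bar> * sqrt (wn D x) \<le> sqrt (C * real D) * nrm q"
    proof -
      have "(poly q x)\<^sup>2 * wn D x \<le> C * real D * ip q q" by (rule C(2)[OF D _ x]) (use q in \<open>simp add: D_def\<close>)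
      hence "sqrt ((poly q x)\<^sup>2 * wn D x) \<le> sqrt (C * real D * ip q q)" by (rule real_sqrt_le_mono)
      thus ?thesis by (simp add: real_sqrt_mult nrm_def)
    qed
    have k1: "nrm (ker N y) * sqrt (wn D y) \<le> sqrt (C * real D)"
    proof (cases "nrm (ker N y) = 0")
      case True thus ?thesis using CD by simp
    next
      case False
      hence p: "nrm (ker N y) > 0" using nrm_nonneg[of "ker N y"] by linarith
      have e: "poly (ker N y) y = (nrm (ker N y))\<^sup>2" unfolding nrm_sq by (simp add: ip_ker[OF degree_ker])
      have "(poly (ker N y) y)\<^sup>2 * wn D y \<le> C * real D * ip (ker N y) (ker N y)"
        by (rule C(2)[OF D _ y]) (use degree_ker[of N y] N in \<open>simp add: D_def\<close>)
      hence "((nrm (ker N y))\<^sup>2 * wn D y) * (nrm (ker N y))\<^sup>2 \<le> (C * real D) * (nrm (ker N y))\<^sup>2"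
        unfolding e nrm_sq[symmetric] by (simp add: power2_eq_square mult_ac)
      hence "(nrm (ker N y))\<^sup>2 * wn D y \<le> C * real D" using p by (simp add: mult.commute)
      hence "sqrt ((nrm (ker N y))\<^sup>2 * wn D y) \<le> sqrt (C * real D)" by (rule real_sqrt_le_mono)
      thus ?thesis using p by (simp add: real_sqrt_mult)
    qed
    have "\<bar>poly q x\<bar> * sqrt (wn D x) * sqrt (wn D y) \<le> sqrt (C * real D) * (L * nrm (ker N y)) * sqrt (wn D y)"
    proof (rule mult_right_mono)
      show "\<bar>poly q x\<bar> * sqrt (wn D x) \<le> sqrt (C * real D) * (L * nrm (ker N y))"
        using q1 mult_left_mono[OF le, of "sqrt (C * real D)"] CD by (meson order_trans real_sqrt_ge_zero)
    qed (use wD in simp)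
    also have "\<dots> = sqrt (C * real D) * L * (nrm (ker N y) * sqrt (wn D y))" by simp
    also have "\<dots> \<le> sqrt (C * real D) * L * sqrt (C * real D)"
      using k1 L CD by (intro mult_left_mono) auto
    also have "\<dots> = (sqrt (C * real D) * sqrt (C * real D)) * L" by simp
    also have "sqrt (C * real D) * sqrt (C * real D) = C * real D" using CD by simp
    finally have 1: "\<bar>poly q x\<bar> * sqrt (wn D x) * sqrt (wn D y) \<le> C * real D * L" .
    have "sqrt (wn n x) * sqrt (wn n y) \<le> (sqrt s * sqrt (wn D x)) * (sqrt s * sqrt (wn D y))"
      unfolding real_sqrt_mult[symmetric] s_def D_def
      using wn_scale[OF n c x] wn_scale[OF n c y] wn_pos[OF n x] wn_pos[OF n y]
      by (intro real_sqrt_le_mono mult_mono) auto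
    also have "\<dots> = s * (sqrt (wn D x) * sqrt (wn D y))" using s by simp
    finally have "\<bar>poly q x\<bar> * (sqrt (wn n x) * sqrt (wn n y)) \<le> \<bar>poly q x\<bar> * (s * (sqrt (wn D x) * sqrt (wn D y)))"
      by (intro mult_left_mono) auto
    also have "\<dots> = s * (\<bar>poly q x\<bar> * sqrt (wn D x) * sqrt (wn D y))" by simp
    also have "\<dots> \<le> s * (C * real D * L)" using 1 s by (intro mult_left_mono) auto
    finally show ?thesis by (simp add: D_def mult_ac)
  qed
  ultimately show thesis by (rule that)
qed

text \<open>The series is taken in the variable \<open>t = pi * mu \<nu> / (R * n)\<close>, for
  which \<open>g t = \<nu> / n\<close>. The point \<open>\<theta>0\<close> corresponds to
  \<open>\<nu> = 0\<close>; to its left the function is constant. The condition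
  \<open>R \<ge> 2 + sg\<close> places \<open>t = pi\<close> where the cutoff already
  vanishes.\<close>

lemma cutoff_cosine_series:
  fixes f :: "nat \<Rightarrow> real \<Rightarrow> real"
  assumes K: "2 \<le> K" and n: "1 \<le> n" and R: "2 + sg \<le> R" and cf: "cutoff_family K f M"
  obtains e where "\<And>j. 1 \<le> j \<Longrightarrow> \<bar>e j\<bar> \<le> 2 * (R/pi) ^ K * M / real j ^ K" and "summable (\<lambda>j. \<bar>e j\<bar>)"
    and "\<And>\<nu>. mu \<nu> \<le> R * real n \<Longrightarrow> (\<lambda>j. e j * Ct (real j * (pi / (R * real n))) \<nu>) sums f 0 (real \<nu> / real n)"
proof -
  note d = cutoff_familyD(1)[OF cf] and cm = cutoff_familyD(2)[OF cf] and z0 = cutoff_familyD(3)[OF cf]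
    and z2 = cutoff_familyD(4)[OF cf] and M = cutoff_familyD(5)[OF cf]
  have n0: "real n \<ge> 1" using n by simp
  have R0: "R > 0" using R sg_nonneg by linarith
  have sgn: "0 \<le> sg / real n" "sg / real n \<le> sg"
    using sg_nonneg n0 mult_left_mono[OF n0 sg_nonneg] by (auto simp: divide_le_eq)
  define \<theta>0 where "\<theta>0 = pi / R * (sg / real n)"
  have \<theta>0: "0 \<le> \<theta>0" "\<theta>0 \<le> pi"
  proof -
    show "0 \<le> \<theta>0" unfolding \<theta>0_def using sgn R0 by simp
    have "sg / real n \<le> R" using sgn R by linarith
    hence "pi / R * (sg / real n) \<le> pi / R * R" using R0 by (intro mult_left_mono) auto
    thus "\<theta>0 \<le> pi" unfolding \<theta>0_def using R0 by simp
  qed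
  define g where "g t = R / pi * t - sg / real n" for t
  have g0: "g \<theta>0 = 0" unfolding g_def \<theta>0_def using R0 by simp
  have gpi: "g pi \<ge> 2" unfolding g_def using sgn R by simp
  have gmono: "g s < g t" if "s < t" for s t
    unfolding g_def using that R0 by (simp add: divide_strict_right_mono)
  have gnn: "0 \<le> g t" if "\<theta>0 \<le> t" for t using gmono[of \<theta>0 t] g0 that by (cases "t = \<theta>0") auto
  define b where "b m t = (R/pi) ^ m * f m (g t)" for m t
  have cb: "continuous_on {\<theta>0..pi} (b m)" if "m \<le> K" for m
  proof -
    have "continuous_on {\<theta>0..pi} (\<lambda>t. f m (g t))"
      by (rule continuous_on_compose2[OF cm[OF that]]) (use gnn in \<open>auto intro!: continuous_intros simp: g_def[abs_def]\<close>)
    thus ?thesis unfolding b_def[abs_def] by (intro continuous_intros)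
  qed
  have db: "(b m has_real_derivative b (Suc m) t) (at t)" if "m < K" "\<theta>0 < t" "t < pi" for m t
  proof -
    have gt: "0 < g t" using gmono[of \<theta>0 t] g0 that by simp
    hence "g t \<in> interior {0..}" by simp
    hence "at (g t) within {0..} = at (g t)" by (rule at_within_interior)
    hence 1: "(f m has_real_derivative f (Suc m) (g t)) (at (g t))" using d[OF that(1), of "g t"] gt by simp
    have "(g has_real_derivative (R/pi * 1 - 0)) (at t)"
      unfolding g_def[abs_def] by (intro DERIV_diff DERIV_cmult DERIV_ident DERIV_const)
    from DERIV_cmult[OF DERIV_chain2[OF 1 this], of "(R/pi) ^ m"]
    show ?thesis unfolding b_def[abs_def] by (simp add: mult_ac)
  qed
  have z0b: "b m \<theta>0 = 0" if "1 \<le> m" "m < K" for m using z0[OF that] by (simp add: b_def g0)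
  have z1b: "b m pi = 0" if "m < K" for m using z2[of m "g pi"] gpi that by (simp add: b_def)
  have Bb: "\<bar>b K t\<bar> \<le> (R/pi) ^ K * M" if "\<theta>0 \<le> t" "t \<le> pi" for t
    using M[OF gnn[OF that(1)]] R0 by (simp add: b_def abs_mult mult_left_mono)
  define G where "G t = b 0 (max t \<theta>0)" for t
  have cG: "continuous_on {0..pi} G"
    unfolding G_def[abs_def]
    by (rule continuous_on_compose2[OF cb[of 0]]) (use \<theta>0 in \<open>auto intro!: continuous_intros\<close>)
  define c where "c j = integral {0..pi} (\<lambda>t. G t * cos (real j * t))" for j
  have cj: "\<bar>c j\<bar> \<le> pi * ((R/pi) ^ K * M) / real j ^ K" if "1 \<le> j" for j
    unfolding c_def G_def
    by (rule cos_coefficient_decay[OF \<theta>0 that _ cb db z0b z1b Bb]) (use K in auto)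
  have sc: "summable (\<lambda>j. \<bar>c j\<bar>)"
  proof (rule summable_comparison_test)
    show "\<exists>N. \<forall>j\<ge>N. norm \<bar>c j\<bar> \<le> (pi * ((R/pi) ^ K * M)) * (inverse (real j ^ K))"
      using cj by (intro exI[of _ 1]) (auto simp: divide_inverse)
    show "summable (\<lambda>j. (pi * ((R/pi) ^ K * M)) * inverse (real j ^ K))"
      by (intro summable_mult inverse_power_summable) (use K in auto)
  qed
  define e where "e j = (if j = 0 then c j / pi else 2 * c j / pi)" for j
  show thesis
  proof (rule that)
    fix j :: nat assume j: "1 \<le> j"
    have "\<bar>e j\<bar> = 2 / pi * \<bar>c j\<bar>" using j by (simp add: e_def abs_mult)
    also have "\<dots> \<le> 2 / pi * (pi * ((R/pi) ^ K * M) / real j ^ K)" by (intro mult_left_mono cj j) auto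
    finally show "\<bar>e j\<bar> \<le> 2 * (R/pi) ^ K * M / real j ^ K" by simp
  next
    show "summable (\<lambda>j. \<bar>e j\<bar>)"
    proof (rule summable_comparison_test)
      show "\<exists>N. \<forall>j\<ge>N. norm \<bar>e j\<bar> \<le> (2/pi) * \<bar>c j\<bar>"
        by (intro exI[of _ 0]) (auto simp: e_def abs_mult field_simps)
      show "summable (\<lambda>j. (2/pi) * \<bar>c j\<bar>)" by (rule summable_mult[OF sc])
    qed
  next
    fix \<nu> assume \<nu>: "mu \<nu> \<le> R * real n"
    define t where "t = pi / (R * real n) * mu \<nu>"
    have Rn: "R * real n > 0" using R0 n0 by simp
    have t: "t \<in> {0..pi}"
    proof -
      have "pi * mu \<nu> \<le> pi * (R * real n)" using \<nu> by (intro mult_left_mono) auto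
      thus ?thesis unfolding t_def using mu_nonneg[of \<nu>] Rn by (simp add: field_simps)
    qed
    have gt: "g t = real \<nu> / real n" unfolding g_def t_def mu_def using R0 n0 by (simp add: field_simps)
    have "\<theta>0 \<le> t"
    proof -
      have "pi / (R * real n) * sg \<le> t" unfolding t_def mu_def using Rn by (intro mult_left_mono) auto
      thus ?thesis unfolding \<theta>0_def by simp
    qed
    hence "G t = f 0 (real \<nu> / real n)" by (simp add: G_def b_def gt)
    moreover have "(\<lambda>j. e j * cos (real j * t)) sums G t"
      unfolding e_def by (rule cosine_series[OF cG c_def sc t])
    ultimately show "(\<lambda>j. e j * Ct (real j * (pi / (R * real n))) \<nu>) sums f 0 (real \<nu> / real n)"
      by (simp add: Ct_def t_def mult.assoc)
  qed
qed

text \<open>The decay \<open>j^(-k-1)\<close> of the coefficients is summed against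
  \<open>commutator_bound\<close> by \<open>sum_min_power_le\<close> with
  \<open>\<epsilon> = \<tau> * m\<close>. The term \<open>j = 0\<close> is a constant symbol and has
  no commutators.\<close>

lemma cutoff_commutator:
  assumes k: "1 \<le> k"
  obtains C where "C \<ge> 0" and "\<And>f M n m p. \<lbrakk>1 \<le> n; 1 \<le> m;
      degree p + Suc k * m \<le> (2 * k + 4) * n; cutoff_family (Suc k) f M\<rbrakk>
    \<Longrightarrow> nrm (ad (cheb m) (\<lambda>\<nu>. f 0 (real \<nu> / real n)) (Suc k) p) \<le> C * M * (real m / real n) ^ k * nrm p"
proof -
  obtain C1 where C1: "C1 \<ge> 0" "\<And>m p t. \<lbrakk>1 \<le> m; 0 \<le> t\<rbrakk> \<Longrightarrow>
     nrm (ad (cheb m) (Ct t) (Suc k) p) \<le> C1 * (min 1 (t * real m)) ^ (Suc k) * nrm p"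
    using commutator_bound by blast
  \<comment> \<open>All indices up to \<open>(2 * k + 4) * n\<close> must fall into the range where
    the cosine series represents the cutoff. Moreover \<open>R \<ge> 4 > pi\<close> gives
    \<open>\<epsilon> \<le> m / n\<close> at the end.\<close>
  define R where "R = 2 * real k + 4 + sg"
  have R4: "R \<ge> 4" unfolding R_def using sg_nonneg by simp
  define C where "C = C1 * (2 * (R/pi) ^ Suc k) * 4"
  have "C \<ge> 0" unfolding C_def using C1 R4 by simp
  moreover have "nrm (ad (cheb m) (\<lambda>\<nu>. f 0 (real \<nu> / real n)) (Suc k) p) \<le> C * M * (real m / real n) ^ k * nrm p"
    if n: "1 \<le> n" and m: "1 \<le> m" and deg: "degree p + Suc k * m \<le> (2 * k + 4) * n"
      and cf: "cutoff_family (Suc k) f M" for f M n m p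
  proof -
    have M0: "0 \<le> M" by (rule cutoff_familyD(6)[OF cf])
    obtain e where e: "\<And>j. 1 \<le> j \<Longrightarrow> \<bar>e j\<bar> \<le> 2 * (R/pi) ^ Suc k * M / real j ^ Suc k" "summable (\<lambda>j. \<bar>e j\<bar>)"
      "\<And>\<nu>. mu \<nu> \<le> R * real n \<Longrightarrow> (\<lambda>j. e j * Ct (real j * (pi / (R * real n))) \<nu>) sums f 0 (real \<nu> / real n)"
      using cutoff_cosine_series[of "Suc k" n R f M, OF _ n _ cf] k R_def by auto
    define \<tau> where "\<tau> = pi / (R * real n)"
    have Rn: "R * real n > 0" using R4 n by simp
    have \<tau>: "\<tau> > 0" unfolding \<tau>_def using Rn by simp
    define h' where "h' \<nu> = (\<Sum>j. e j * Ct (real j * \<tau>) \<nu>)" for \<nu>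
    define Q where "Q = cheb m"
    define u where "u = ad Q (\<lambda>\<nu>. f 0 (real \<nu> / real n)) (Suc k) p"
    have "u = ad Q h' (Suc k) p"
      unfolding u_def
    proof (rule ad_cong)
      fix \<nu> assume "\<nu> \<le> degree p + Suc k * degree Q"
      also have "\<dots> \<le> degree p + Suc k * m" unfolding Q_def using degree_cheb[of m] by (intro add_left_mono mult_left_mono) auto
      also have "\<dots> \<le> (2 * k + 4) * n" by (rule deg)
      finally have "real \<nu> \<le> real ((2 * k + 4) * n)" by (rule of_nat_mono)
      moreover have "sg * 1 \<le> sg * real n" using n sg_nonneg by (intro mult_left_mono) auto
      ultimately have "mu \<nu> \<le> R * real n" unfolding mu_def R_def by (simp add: algebra_simps)
      from e(3)[OF this] show "f 0 (real \<nu> / real n) = h' \<nu>"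
        unfolding h'_def \<tau>_def by (simp add: sums_unique)
    qed
    define HJ where "HJ J \<nu> = (\<Sum>j<J. e j * Ct (real j * \<tau>) \<nu>)" for J \<nu>
    have lim: "(\<lambda>J. HJ J \<nu>) \<longlonglongrightarrow> h' \<nu>" for \<nu>
    proof -
      have "summable (\<lambda>j. e j * Ct (real j * \<tau>) \<nu>)"
      proof (rule summable_comparison_test[OF _ e(2)])
        show "\<exists>N. \<forall>j\<ge>N. norm (e j * Ct (real j * \<tau>) \<nu>) \<le> \<bar>e j\<bar>"
          by (intro exI[of _ 0]) (auto simp: Ct_def abs_mult intro!: mult_left_le)
      qed
      thus ?thesis unfolding HJ_def h'_def by (rule summable_LIMSEQ)
    qed
    \<comment> \<open>The partial sums are paired with the commutator \<open>u\<close> itself, so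
      that the limit is its squared norm; one factor \<open>nrm u\<close> is divided out
      afterwards.\<close>
    have "(\<lambda>J. ip (ad Q (HJ J) (Suc k) p) u) \<longlonglongrightarrow> ip (ad Q h' (Suc k) p) u"
      by (rule ad_tendsto) (rule lim)
    hence lim2: "(\<lambda>J. ip (ad Q (HJ J) (Suc k) p) u) \<longlonglongrightarrow> ip u u" using \<open>u = ad Q h' (Suc k) p\<close> by simp
    define \<epsilon> where "\<epsilon> = \<tau> * real m"
    have \<epsilon>: "\<epsilon> > 0" unfolding \<epsilon>_def using \<tau> m by simp
    define X where "X = C1 * nrm p * nrm u"
    have X0: "0 \<le> X" unfolding X_def using C1 by simp
    define Y where "Y = 2 * (R/pi) ^ Suc k * M"
    have Y0: "0 \<le> Y" unfolding Y_def using M0 R4 by simp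
    have bd: "ip (ad Q (HJ J) (Suc k) p) u \<le> X * Y * (4 * \<epsilon> ^ k)" for J
    proof -
      have t: "e j * ip (ad Q (Ct (real j * \<tau>)) (Suc k) p) u \<le> X * Y * ((min 1 (real j * \<epsilon>)) ^ Suc k / real j ^ Suc k)" for j
      proof (cases "j = 0")
        case True
        have "Ct 0 = (\<lambda>_. 1)" by (auto simp: Ct_def)
        thus ?thesis using True by (simp add: ad_const del: ad.simps)
      next
        case False
        have "e j * ip (ad Q (Ct (real j * \<tau>)) (Suc k) p) u \<le> \<bar>e j\<bar> * \<bar>ip (ad Q (Ct (real j * \<tau>)) (Suc k) p) u\<bar>"
          unfolding abs_mult[symmetric] by simp
        also have "\<dots> \<le> (Y / real j ^ Suc k) * ((C1 * (min 1 (real j * \<tau> * real m)) ^ Suc k * nrm p) * nrm u)"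
        proof (rule mult_mono)
          show "\<bar>e j\<bar> \<le> Y / real j ^ Suc k" using e(1)[of j] False by (simp add: Y_def)
          have "\<bar>ip (ad Q (Ct (real j * \<tau>)) (Suc k) p) u\<bar> \<le> nrm (ad Q (Ct (real j * \<tau>)) (Suc k) p) * nrm u"
            by (rule ip_Cauchy_Schwarz)
          also have "\<dots> \<le> (C1 * (min 1 (real j * \<tau> * real m)) ^ Suc k * nrm p) * nrm u"
            unfolding Q_def using \<tau> by (intro mult_right_mono C1(2) m) auto
          finally show "\<bar>ip (ad Q (Ct (real j * \<tau>)) (Suc k) p) u\<bar> \<le> (C1 * (min 1 (real j * \<tau> * real m)) ^ Suc k * nrm p) * nrm u" .
        qed (use Y0 in auto)
        also have "\<dots> = X * Y * ((min 1 (real j * \<epsilon>)) ^ Suc k / real j ^ Suc k)"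
          unfolding X_def \<epsilon>_def by (simp only: mult.assoc[of "real j" \<tau> "real m"] times_divide_eq_left times_divide_eq_right mult_ac)
        finally show ?thesis .
      qed
      have "ip (ad Q (HJ J) (Suc k) p) u = (\<Sum>j<J. e j * ip (ad Q (Ct (real j * \<tau>)) (Suc k) p) u)"
        unfolding HJ_def[abs_def] by (rule ad_lincomb)
      also have "\<dots> \<le> (\<Sum>j<J. X * Y * ((min 1 (real j * \<epsilon>)) ^ Suc k / real j ^ Suc k))"
        by (intro sum_mono t)
      also have "\<dots> \<le> (\<Sum>j\<le>J. X * Y * ((min 1 (real j * \<epsilon>)) ^ Suc k / real j ^ Suc k))"
        using X0 Y0 \<epsilon> by (intro sum_mono2) (auto intro!: mult_nonneg_nonneg divide_nonneg_nonneg)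
      also have "\<dots> = (\<Sum>j=1..J. X * Y * ((min 1 (real j * \<epsilon>)) ^ Suc k / real j ^ Suc k))"
      proof (rule sum.mono_neutral_right)
        show "\<forall>i\<in>{..J} - {1..J}. X * Y * ((min 1 (real i * \<epsilon>)) ^ Suc k / real i ^ Suc k) = 0"
          by (auto simp: not_le Suc_le_eq)
      qed auto
      also have "\<dots> = X * Y * (\<Sum>j=1..J. (min 1 (real j * \<epsilon>)) ^ Suc k / real j ^ Suc k)"
        by (simp only: sum_distrib_left)
      also have "\<dots> \<le> X * Y * (4 * \<epsilon> ^ k)"
        using X0 Y0 by (intro mult_left_mono sum_min_power_le[OF \<epsilon> k]) auto
      finally show ?thesis .
    qed
    have "ip u u \<le> X * Y * (4 * \<epsilon> ^ k)"
      by (intro tendsto_upperbound[OF lim2] always_eventually allI bd) simp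
    hence "nrm u * nrm u \<le> (C * M * \<epsilon> ^ k * nrm p) * nrm u"
      unfolding nrm_sq[symmetric] X_def Y_def C_def by (simp add: power2_eq_square mult_ac)
    hence 1: "nrm u \<le> C * M * \<epsilon> ^ k * nrm p"
    proof (cases "nrm u = 0")
      case True
      have "0 \<le> C * M * \<epsilon> ^ k * nrm p" using \<open>C \<ge> 0\<close> M0 \<epsilon> by simp
      thus ?thesis using True by simp
    next
      case False
      hence "nrm u > 0" using nrm_nonneg[of u] by linarith
      thus ?thesis using \<open>nrm u * nrm u \<le> (C * M * \<epsilon> ^ k * nrm p) * nrm u\<close> by simp
    qed
    have "\<epsilon> \<le> real m / real n"
    proof -
      have "\<epsilon> = (pi / R) * (real m / real n)" unfolding \<epsilon>_def \<tau>_def by simp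
      also have "\<dots> \<le> 1 * (real m / real n)" using R4 pi_less_4 by (intro mult_right_mono) auto
      finally show ?thesis by simp
    qed
    hence "C * M * \<epsilon> ^ k * nrm p \<le> C * M * (real m / real n) ^ k * nrm p"
      using \<open>C \<ge> 0\<close> M0 \<epsilon> by (intro mult_right_mono mult_left_mono power_mono) auto
    with 1 show ?thesis unfolding u_def Q_def by linarith
  qed
  ultimately show thesis by (rule that)
qed

text \<open>For \<open>n * \<rho> < 8\<close> the factor to be gained is at most
  \<open>9 ^ k\<close> and the norm bound of the multiplier suffices. Otherwise the separating
  degree satisfies \<open>m \<le> 8 / \<rho> \<le> n\<close>, so all degrees remain multiples of
  \<open>n\<close>, and the factor \<open>(Q x - Q y)^(k+1)\<close> in the commutator kernel is
  divided out.\<close>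

lemma kernel_localization_1d:
  assumes k: "1 \<le> k"
  obtains C where "C \<ge> 0" and "\<And>f M n x y. \<lbrakk>1 \<le> n; -1 \<le> x; x \<le> 1; -1 \<le> y; y \<le> 1; cutoff_family (Suc k) f M\<rbrakk>
    \<Longrightarrow> \<bar>\<Sum>\<nu>\<le>2 * n. f 0 (real \<nu> / real n) * poly (en \<nu>) x * poly (en \<nu>) y\<bar> * (sqrt (wn n x) * sqrt (wn n y))
        * (1 + real n * \<bar>arccos x - arccos y\<bar>) ^ k \<le> C * M * real n"
proof -
  obtain C1 where C1: "C1 \<ge> 0" "\<And>f M n m p. \<lbrakk>1 \<le> n; 1 \<le> m;
      degree p + Suc k * m \<le> (2 * k + 4) * n; cutoff_family (Suc k) f M\<rbrakk>
    \<Longrightarrow> nrm (ad (cheb m) (\<lambda>\<nu>. f 0 (real \<nu> / real n)) (Suc k) p) \<le> C1 * M * (real m / real n) ^ k * nrm p"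
    by (rule cutoff_commutator[OF k]) blast
  obtain C0 where C0: "C0 > 0" "\<And>n N q L x y. \<lbrakk>1 \<le> n; N \<le> (2*k+4) * n; degree q \<le> (2*k+4) * n; 0 \<le> L;
      -1 \<le> x; x \<le> 1; -1 \<le> y; y \<le> 1; nrm q \<le> L * nrm (ker N y)\<rbrakk>
      \<Longrightarrow> \<bar>poly q x\<bar> * (sqrt (wn n x) * sqrt (wn n y)) \<le> C0 * real n * L"
    using kernel_pointwise[of "2*k+4"] by auto
  define C where "C = C0 * 2 ^ Suc k * 9 ^ k + 8 ^ Suc k * C0 * C1 * 9 ^ k"
  have "C \<ge> 0" unfolding C_def using C0 C1 by simp
  moreover have "\<bar>\<Sum>\<nu>\<le>2 * n. f 0 (real \<nu> / real n) * poly (en \<nu>) x * poly (en \<nu>) y\<bar> * (sqrt (wn n x) * sqrt (wn n y))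
        * (1 + real n * \<bar>arccos x - arccos y\<bar>) ^ k \<le> C * M * real n"
    if n: "1 \<le> n" and x: "-1 \<le> x" "x \<le> 1" and y: "-1 \<le> y" "y \<le> 1"
      and cf: "cutoff_family (Suc k) f M" for f M n x y
  proof -
    have M0: "0 \<le> M" by (rule cutoff_familyD(6)[OF cf])
    have n0: "real n \<ge> 1" using n by simp
    define h where "h \<nu> = f 0 (real \<nu> / real n)" for \<nu>
    \<comment> \<open>\<open>2 * n\<close> for the support of the symbol, and
      \<open>n \<ge> m\<close> for each of the \<open>k + 1\<close> multiplications by the Chebyshev
      polynomial in \<open>ad_ker\<close>.\<close>
    define N where "N = (k + 3) * n"
    define \<Lambda> where "\<Lambda> = Mult h (ker N y)"
    define \<rho> where "\<rho> = \<bar>arccos x - arccos y\<bar>"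
    define w where "w = sqrt (wn n x) * sqrt (wn n y)"
    have w0: "0 \<le> w" unfolding w_def using wn_pos[OF n x] wn_pos[OF n y] by simp
    have h0: "h \<nu> = 0" if "2 * n < \<nu>" for \<nu>
    proof -
      have "2 * real n \<le> real \<nu>" using that by linarith
      hence "2 \<le> real \<nu> / real n" using n0 by (simp add: field_simps)
      thus ?thesis unfolding h_def by (intro cutoff_familyD(4)[OF cf]) auto
    qed
    have \<Lambda>x: "poly \<Lambda> x = (\<Sum>\<nu>\<le>2 * n. f 0 (real \<nu> / real n) * poly (en \<nu>) x * poly (en \<nu>) y)"
      unfolding \<Lambda>_def by (subst poly_Mult_ker[of "2*n"]) (use h0 in \<open>auto simp: N_def h_def\<close>)
    have "\<bar>poly \<Lambda> x\<bar> * w * (1 + real n * \<rho>) ^ k \<le> C * M * real n"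
    proof (cases "real n * \<rho> < 8")
      case True
      have "nrm \<Lambda> \<le> 2 ^ Suc k * M * nrm (ker N y)"
        unfolding \<Lambda>_def
      proof (rule nrm_Mult)
        fix \<nu>
        show "\<bar>h \<nu>\<bar> \<le> 2 ^ Suc k * M"
          unfolding h_def using cutoff_deriv_bound[OF cf, of "real \<nu> / real n" "Suc k"] by simp
      qed (use M0 in simp)
      hence "\<bar>poly \<Lambda> x\<bar> * w \<le> C0 * real n * (2 ^ Suc k * M)"
        unfolding w_def
      proof (intro C0(2)[of n N, OF n _ _ _ x y])
        show "N \<le> (2 * k + 4) * n" unfolding N_def by (intro mult_right_mono) auto
        thus "degree \<Lambda> \<le> (2 * k + 4) * n"
          unfolding \<Lambda>_def using degree_Mult[of h "ker N y"] degree_ker[of N y] by linarith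
      qed (use M0 in auto)
      moreover have "(1 + real n * \<rho>) ^ k \<le> 9 ^ k"
        using True n0 by (intro power_mono) (auto simp: \<rho>_def)
      ultimately have "\<bar>poly \<Lambda> x\<bar> * w * (1 + real n * \<rho>) ^ k \<le> (C0 * real n * (2 ^ Suc k * M)) * 9 ^ k"
        by (rule mult_mono) (use C0(1) M0 n0 in \<open>auto simp: \<rho>_def\<close>)
      also have "\<dots> = (C0 * 2 ^ Suc k * 9 ^ k) * (M * real n)" by simp
      also have "\<dots> \<le> C * (M * real n)"
        unfolding C_def using C0 C1 M0 by (intro mult_right_mono) auto
      finally show ?thesis by (simp add: mult_ac)
    next
      case False
      hence \<rho>8: "8 \<le> real n * \<rho>" by simp
      have \<rho>0: "\<rho> > 0" using \<rho>8 n0 by (cases "\<rho> = 0") (auto simp: \<rho>_def)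
      obtain m :: nat where m: "1 \<le> m" "real m \<le> 8 / \<rho>" "1/8 \<le> \<bar>cos (real m * arccos x) - cos (real m * arccos y)\<bar>"
        unfolding \<rho>_def
        by (rule cos_separation[of "arccos x" "arccos y"]) (use x y \<rho>0 in \<open>auto simp: arccos_lbound arccos_ubound \<rho>_def\<close>)
      have "8 / \<rho> \<le> real n" using \<rho>8 \<rho>0 by (simp add: field_simps)
      hence "real m \<le> real n" using m by linarith
      hence mn: "m \<le> n" by simp
      define Q where "Q = cheb m"
      have dQ: "degree Q \<le> m" unfolding Q_def by (rule degree_cheb)
      have Qx: "poly Q x = cos (real m * arccos x)" "poly Q y = cos (real m * arccos y)"
        unfolding Q_def using poly_cheb_cos[of m "arccos x"] poly_cheb_cos[of m "arccos y"] x y by (simp_all add: cos_arccos)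
      define q where "q = ad Q h (Suc k) (ker N y)"
      have sm: "Suc k * m \<le> Suc k * n" using mn by (intro mult_left_mono) auto
      have sQ: "Suc k * degree Q \<le> Suc k * n" using dQ mn by (intro mult_left_mono) auto
      have "ad Q h (Suc k) (1 * ker N y) = smult (poly 1 y) ((Q - [:poly Q y:]) ^ Suc k * Mult h (ker N y))"
      proof (rule ad_ker[where L="2*n"])
        have "2 * n + Suc k * n = N" unfolding N_def by (simp add: algebra_simps)
        thus "2 * n + degree (1::real poly) + Suc k * degree Q \<le> N" using sQ by simp
      qed (rule h0)
      hence "q = (Q - [:poly Q y:]) ^ Suc k * \<Lambda>" unfolding q_def \<Lambda>_def by simp
      hence qx: "\<bar>poly q x\<bar> = \<bar>poly Q x - poly Q y\<bar> ^ Suc k * \<bar>poly \<Lambda> x\<bar>"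
        by (simp add: abs_mult power_abs del: power_Suc)
      have degs: "N + Suc k * n = (2 * k + 4) * n" unfolding N_def by (simp add: algebra_simps)
      have nq: "nrm q \<le> C1 * M * (real m / real n) ^ k * nrm (ker N y)"
        unfolding q_def Q_def h_def[abs_def]
        by (rule C1(2)[OF n m(1) _ cf]) (use degs sm degree_ker[of N y] in auto)
      have "\<bar>poly q x\<bar> * w \<le> C0 * real n * (C1 * M * (real m / real n) ^ k)"
        unfolding w_def
      proof (rule C0(2)[of n N, OF n _ _ _ x y nq])
        show "N \<le> (2 * k + 4) * n" using degs by simp
        show "degree q \<le> (2 * k + 4) * n"
          using degree_ad[of Q h "Suc k" "ker N y"] degree_ker[of N y] sQ degs unfolding q_def by linarith
      qed (use C1 M0 in auto)
      hence 1: "(\<bar>poly Q x - poly Q y\<bar> ^ Suc k * \<bar>poly \<Lambda> x\<bar>) * w \<le> C0 * real n * (C1 * M * (real m / real n) ^ k)"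
        unfolding qx .
      have "(1/8) ^ Suc k * (\<bar>poly \<Lambda> x\<bar> * w) \<le> \<bar>poly Q x - poly Q y\<bar> ^ Suc k * (\<bar>poly \<Lambda> x\<bar> * w)"
        using m(3) w0 unfolding Qx by (intro mult_right_mono power_mono) auto
      with 1 have "(1/8) ^ Suc k * (\<bar>poly \<Lambda> x\<bar> * w) \<le> C0 * real n * (C1 * M * (real m / real n) ^ k)"
        unfolding mult.assoc by (rule order.trans[rotated])
      hence "8 ^ Suc k * ((1/8) ^ Suc k * (\<bar>poly \<Lambda> x\<bar> * w)) \<le> 8 ^ Suc k * (C0 * real n * (C1 * M * (real m / real n) ^ k))"
        by (intro mult_left_mono) auto
      moreover have "8 ^ Suc k * ((1/8) ^ Suc k * (\<bar>poly \<Lambda> x\<bar> * w)) = \<bar>poly \<Lambda> x\<bar> * w"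
        unfolding mult.assoc[symmetric] power_mult_distrib[symmetric] by simp
      ultimately have 2: "\<bar>poly \<Lambda> x\<bar> * w \<le> 8 ^ Suc k * (C0 * real n * (C1 * M * (real m / real n) ^ k))" by linarith
      have mr: "real m / real n * (1 + real n * \<rho>) \<le> 9"
      proof -
        have "real m / real n * (1 + real n * \<rho>) \<le> (8 / \<rho>) / real n * (1 + real n * \<rho>)"
          using m(2) n0 \<rho>0 by (intro mult_right_mono divide_right_mono) auto
        also have "\<dots> = 8 / (real n * \<rho>) + 8" using n0 \<rho>0 by (simp add: field_simps)
        also have "\<dots> \<le> 9" using \<rho>8 by (simp add: divide_le_eq)
        finally show ?thesis .
      qed
      have "\<bar>poly \<Lambda> x\<bar> * w * (1 + real n * \<rho>) ^ k
         \<le> 8 ^ Suc k * (C0 * real n * (C1 * M * (real m / real n) ^ k)) * (1 + real n * \<rho>) ^ k"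
        using 2 \<rho>0 n0 by (intro mult_right_mono) auto
      also have "\<dots> = 8 ^ Suc k * (C0 * real n * (C1 * M * (real m / real n * (1 + real n * \<rho>)) ^ k))"
        unfolding power_mult_distrib by (simp only: mult_ac)
      also have "\<dots> \<le> 8 ^ Suc k * (C0 * real n * (C1 * M * 9 ^ k))"
        using mr C0 C1 M0 n0 \<rho>0 by (intro mult_left_mono power_mono) auto
      also have "\<dots> = (8 ^ Suc k * C0 * C1 * 9 ^ k) * (M * real n)" by (simp only: mult_ac)
      also have "\<dots> \<le> C * (M * real n)"
        unfolding C_def using C0 C1 M0 by (intro mult_right_mono) auto
      finally show ?thesis by (simp add: mult_ac)
    qed
    thus ?thesis unfolding \<Lambda>x w_def \<rho>_def .
  qed
  ultimately show thesis by (rule that)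
qed

text \<open>The multiplier whose symbol is the sign of the terms has the sum of absolute values as
  its kernel at \<open>(x, y)\<close>, and its norm is at most 1. The result serves the coordinates
  from which no decay is extracted.\<close>

lemma abs_kernel_bound_1d:
  obtains C where "C > 0" and "\<And>n x y. \<lbrakk>1 \<le> n; -1 \<le> x; x \<le> 1; -1 \<le> y; y \<le> 1\<rbrakk>
    \<Longrightarrow> (\<Sum>\<nu>\<le>2 * n. \<bar>poly (en \<nu>) x * poly (en \<nu>) y\<bar>) * (sqrt (wn n x) * sqrt (wn n y)) \<le> C * real n"
proof -
  obtain C0 where C0: "C0 > 0" "\<And>n N q L x y. \<lbrakk>1 \<le> n; N \<le> 2 * n; degree q \<le> 2 * n; 0 \<le> L;
      -1 \<le> x; x \<le> 1; -1 \<le> y; y \<le> 1; nrm q \<le> L * nrm (ker N y)\<rbrakk>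
      \<Longrightarrow> \<bar>poly q x\<bar> * (sqrt (wn n x) * sqrt (wn n y)) \<le> C0 * real n * L"
    using kernel_pointwise[of 2] by auto
  have "(\<Sum>\<nu>\<le>2 * n. \<bar>poly (en \<nu>) x * poly (en \<nu>) y\<bar>) * (sqrt (wn n x) * sqrt (wn n y)) \<le> C0 * real n"
    if n: "1 \<le> n" and x: "-1 \<le> x" "x \<le> 1" and y: "-1 \<le> y" "y \<le> 1" for n x y
  proof -
    define h where "h \<nu> = (if \<nu> \<le> 2 * n then sgn (poly (en \<nu>) x * poly (en \<nu>) y) else 0)" for \<nu>
    define q where "q = Mult h (ker (2 * n) y)"
    have "poly q x = (\<Sum>\<nu>\<le>2 * n. h \<nu> * poly (en \<nu>) x * poly (en \<nu>) y)"
      unfolding q_def by (rule poly_Mult_ker) (auto simp: h_def)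
    also have "\<dots> = (\<Sum>\<nu>\<le>2 * n. \<bar>poly (en \<nu>) x * poly (en \<nu>) y\<bar>)"
      by (intro sum.cong) (auto simp: h_def abs_sgn mult_ac)
    finally have qx: "\<bar>poly q x\<bar> = (\<Sum>\<nu>\<le>2 * n. \<bar>poly (en \<nu>) x * poly (en \<nu>) y\<bar>)"
      by (simp add: sum_nonneg)
    have "nrm q \<le> 1 * nrm (ker (2 * n) y)"
      unfolding q_def by (rule nrm_Mult) (auto simp: h_def abs_sgn_eq)
    hence "\<bar>poly q x\<bar> * (sqrt (wn n x) * sqrt (wn n y)) \<le> C0 * real n * 1"
    proof (intro C0(2)[of n "2 * n", OF n _ _ _ x y])
      show "degree q \<le> 2 * n"
        unfolding q_def using degree_Mult[of h "ker (2 * n) y"] degree_ker[of "2 * n" y] by linarith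
    qed auto
    thus ?thesis unfolding qx by simp
  qed
  thus thesis using C0(1) that by blast
qed

end

section \<open>Partial derivatives on the orthant\<close>

lemma at_within_Ici_neq_bot:
  fixes s :: real
  assumes "0 \<le> s"
  shows "at s within {0..} \<noteq> bot"
proof -
  have "at_right s \<le> at s within {0..}" by (rule at_le) (use assms in auto)
  moreover have "at_right s \<noteq> bot" by simp
  ultimately show ?thesis by (auto simp: bot_unique)
qed

lemma coord_upd_nth [simp]: "coord_upd t l s $ j = (if j = l then s else t $ j)"
  by (simp add: coord_upd_def)

lemma coord_upd_coord_upd [simp]: "coord_upd (coord_upd t l s) l u = coord_upd t l u"
  by (simp add: vec_eq_iff)

lemma coord_upd_same [simp]: "coord_upd t l (t $ l) = t"
  by (simp add: vec_eq_iff)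

lemma coord_upd_orthant: "\<lbrakk>t \<in> orthant; 0 \<le> s\<rbrakk> \<Longrightarrow> coord_upd t l s \<in> orthant"
  by (simp add: orthant_def)

lemma pd_0 [simp]: "pd l 0 f = f" by (simp add: pd_def)
lemma pd_Suc: "pd l (Suc m) f = partial_deriv l (pd l m f)" by (simp add: pd_def)

lemma Ck_orthant_continuous: "Ck_orthant m f \<Longrightarrow> continuous_on orthant f"
  by (cases m) auto

lemma Ck_orthant_pd: "\<lbrakk>Ck_orthant (m + r) f\<rbrakk> \<Longrightarrow> Ck_orthant r (pd l m f)"
proof (induction m arbitrary: r)
  case (Suc m)
  have "Ck_orthant (Suc r) (pd l m f)" using Suc.IH[of "Suc r"] Suc.prems by simp
  thus ?case by (simp add: pd_Suc)
qed simp

lemma pd_has_derivative: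
  assumes "Ck_orthant N f" "m < N" "t \<in> orthant" "0 \<le> s"
  shows "((\<lambda>s. pd l m f (coord_upd t l s)) has_vector_derivative pd l (Suc m) f (coord_upd t l s)) (at s within {0..})"
proof -
  obtain r where "N = m + Suc r" using assms(2) less_iff_Suc_add by auto
  hence "Ck_orthant (Suc r) (pd l m f)" using Ck_orthant_pd[of m "Suc r" f l] assms(1) by simp
  hence "has_partial_on_orthant l (pd l m f)" by simp
  hence "(\<lambda>u. pd l m f (coord_upd (coord_upd t l s) l u)) differentiable (at (coord_upd t l s $ l) within {0..})"
    unfolding has_partial_on_orthant_def using coord_upd_orthant[OF assms(3,4)] by blast
  thus ?thesis by (simp add: vector_derivative_works pd_Suc partial_deriv_def)
qed

lemma pd_continuous:
  assumes "Ck_orthant N f" "m \<le> N"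
  shows "continuous_on orthant (pd l m f)"
  using Ck_orthant_continuous Ck_orthant_pd[of m "N - m" f l] assms by auto

lemma continuous_on_coord_upd: "continuous_on S (\<lambda>s. coord_upd t l s)"
proof -
  have "continuous_on S (\<lambda>s. if j = l then s else t $ j)" for j
    by (cases "j = l") (auto intro!: continuous_intros)
  thus ?thesis unfolding coord_upd_def by (rule continuous_on_vec_lambda)
qed

lemma pd_continuous_coord:
  assumes "Ck_orthant N f" "m \<le> N" "t \<in> orthant"
  shows "continuous_on {0..} (\<lambda>s. pd l m f (coord_upd t l s))"
  by (rule continuous_on_compose2[OF pd_continuous[OF assms(1,2)] continuous_on_coord_upd])
     (use assms coord_upd_orthant in auto)

lemma supp_zero:
  assumes "supp_orthant f \<subseteq> cube 0 2" "t \<in> orthant" "t \<notin> cube 0 2"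
  shows "f t = 0"
proof (rule ccontr)
  assume "f t \<noteq> 0"
  hence "t \<in> closure {t \<in> orthant. f t \<noteq> 0}"
    using assms(2) by (intro closure_subset[THEN subsetD]) simp
  thus False using assms(1,3) unfolding supp_orthant_def by blast
qed

text \<open>Some coordinate \<open>i\<close> exceeds 2, and this persists when the coordinate
  \<open>l\<close> moves by less than \<open>\<delta>\<close>, whether or not \<open>l = i\<close>;
  so the lower derivative is 0 near \<open>t\<close> along the line.\<close>

lemma pd_zero_outside:
  assumes supp: "supp_orthant f \<subseteq> cube 0 2"
  shows "\<lbrakk>t \<in> orthant; t \<notin> cube 0 2\<rbrakk> \<Longrightarrow> pd l m f t = 0"
proof (induction m arbitrary: t)
  case 0
  thus ?case using supp_zero[OF supp] by simp
next
  case (Suc m)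
  obtain i where i: "t $ i > 2" using Suc.prems unfolding cube_def orthant_def by (auto simp: not_le)
  have tl: "0 \<le> t $ l" using Suc.prems by (simp add: orthant_def)
  let ?g = "\<lambda>s. pd l m f (coord_upd t l s)"
  define \<delta> where "\<delta> = t $ i - 2"
  have z: "?g s = 0" if "s \<in> {0..}" "dist s (t $ l) < \<delta>" for s
  proof (rule Suc.IH)
    show "coord_upd t l s \<in> orthant" using coord_upd_orthant Suc.prems that by auto
    have "coord_upd t l s $ i > 2"
      using that i by (auto simp: \<delta>_def dist_real_def)
    thus "coord_upd t l s \<notin> cube 0 2" unfolding cube_def by (auto simp: not_le intro!: exI[of _ i])
  qed
  have "((\<lambda>s. 0::complex) has_vector_derivative 0) (at (t $ l) within {0..})" by simp
  hence "(?g has_vector_derivative 0) (at (t $ l) within {0..})"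
    by (rule has_vector_derivative_transform_within[where d=\<delta>]) (use tl i z in \<open>auto simp: \<delta>_def\<close>)
  hence "vector_derivative ?g (at (t $ l) within {0..}) = 0"
    by (rule vector_derivative_within[OF at_within_Ici_neq_bot[OF tl]])
  thus ?case by (simp add: pd_Suc partial_deriv_def)
qed

text \<open>The hypotheses of the theorem on the cutoff function, for
  \<open>N = 3 * k - 1\<close>.\<close>

definition smooth_cutoff :: "nat \<Rightarrow> (real^'d \<Rightarrow> complex) \<Rightarrow> bool" where
  "smooth_cutoff N A \<longleftrightarrow> Ck_orthant N A \<and> supp_orthant A \<subseteq> cube 0 2 \<and>
     (\<forall>l. \<forall>t \<in> cube 0 2. t $ l = 0 \<longrightarrow> (\<forall>m \<in> {1..N}. pd l m A t = 0))"

lemma compact_cube: "compact (cube a b :: (real^'d) set)"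
proof -
  have "(cube a b :: (real^'d) set) = cbox (\<chi> j. a) (\<chi> j. b)" by (auto simp: cube_def mem_box_cart)
  thus ?thesis by simp
qed

text \<open>The supremum of reals in \<open>sup_norm_orthant\<close> is an upper bound only for a
  bounded function; boundedness comes from compactness of the cube and vanishing outside it.\<close>

lemma pd_le_sup_norm:
  assumes "Ck_orthant N f" "supp_orthant f \<subseteq> cube 0 2" "m \<le> N" "t \<in> orthant"
  shows "norm (pd l m f t) \<le> sup_norm_orthant (pd l m f)"
proof -
  have sub: "cube 0 2 \<subseteq> orthant" by (auto simp: cube_def orthant_def)
  have "compact (pd l m f ` cube 0 2)"
    by (rule compact_continuous_image[OF continuous_on_subset[OF pd_continuous[OF assms(1,3)] sub] compact_cube])
  then obtain B where B: "\<And>t. t \<in> cube 0 2 \<Longrightarrow> norm (pd l m f t) \<le> B"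
    by (meson bounded_iff compact_imp_bounded imageI)
  have "norm (pd l m f t) \<le> max B 0" if "t \<in> orthant" for t
    using B[of t] pd_zero_outside[OF assms(2) that, of l m] by (cases "t \<in> cube 0 2") auto
  hence "bdd_above ((\<lambda>t. norm (pd l m f t)) ` orthant)" by (intro bdd_aboveI2)
  thus ?thesis unfolding sup_norm_orthant_def by (rule cSUP_upper[OF assms(4)])
qed

text \<open>Separates the coordinate \<open>l\<close>; the others are kept as a \<open>PiE\<close>
  set, to which \<open>prod_sum_PiE\<close> applies when the sum over them is factored.\<close>

lemma vec_grid_bij:
  fixes l :: "'d::finite"
  shows "(\<Sum>\<nu>\<in>{\<nu> :: nat^'d. \<forall>i. \<nu> $ i \<le> L}. F \<nu>) =
    (\<Sum>g\<in>PiE (UNIV - {l}) (\<lambda>_. {..L}). \<Sum>m\<le>L. F (\<chi> j. if j = l then m else g j))"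
    (is "_ = ?R")
    and "finite {\<nu> :: nat^'d. \<forall>i. \<nu> $ i \<le> L}"
proof -
  let ?P = "PiE (UNIV - {l}) (\<lambda>_. {..L}) \<times> {..L}"
  let ?S = "{\<nu> :: nat^'d. \<forall>i. \<nu> $ i \<le> L}"
  define to where "to = (\<lambda>(g, m). (\<chi> j. if j = l then m else g j) :: nat^'d)"
  define from' where "from' = (\<lambda>\<nu> :: nat^'d. (restrict (\<lambda>j. \<nu> $ j) (UNIV - {l}), \<nu> $ l))"
  have fin: "finite ?P" by (intro finite_cartesian_product finite_PiE) auto
  have 1: "to (from' \<nu>) = \<nu>" for \<nu> by (simp add: to_def from'_def vec_eq_iff)
  have 2: "from' \<nu> \<in> ?P" if "\<nu> \<in> ?S" for \<nu> using that by (auto simp: from'_def)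
  have 3: "from' (to p) = p" if "p \<in> ?P" for p
    using that by (auto simp: to_def from'_def fun_eq_iff PiE_def extensional_def)
  have 4: "to p \<in> ?S" if "p \<in> ?P" for p
    using that by (auto simp: to_def PiE_def Pi_def)
  have "?S \<subseteq> to ` ?P" using 1 2 by (metis (no_types, lifting) imageI subsetI)
  thus "finite ?S" using fin finite_surj by blast
  have "(\<Sum>\<nu>\<in>?S. F \<nu>) = (\<Sum>p\<in>?P. F (to p))"
    by (rule sum.reindex_bij_witness[of _ to from']) (use 1 2 3 4 in auto)
  also have "\<dots> = ?R" unfolding to_def by (simp add: sum.cartesian_product split_def)
  finally show "(\<Sum>\<nu>\<in>?S. F \<nu>) = ?R" .
qed

lemma W_eq_prod:
  assumes "\<And>j. \<alpha> $ j \<ge> - 1/2" and "\<And>j. \<beta> $ j \<ge> - 1/2"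
  shows "W \<alpha> \<beta> n x = (\<Prod>j\<in>UNIV. jacobi_param.wn (\<alpha> $ j) (\<beta> $ j) n (x $ j))"
  unfolding W_def
proof (rule prod.cong[OF refl])
  fix j
  interpret jacobi_param "\<alpha> $ j" "\<beta> $ j" by unfold_locales (use assms in auto)
  show "(1 - x $ j + 1 / (real n)\<^sup>2) powr (\<alpha> $ j + 1/2) * (1 + x $ j + 1 / (real n)\<^sup>2) powr (\<beta> $ j + 1/2) = wn n (x $ j)"
    by (simp add: wn_def)
qed

lemma real_sqrt_prod: "finite S \<Longrightarrow> sqrt (\<Prod>j\<in>S. f j) = (\<Prod>j\<in>S. sqrt (f j))"
  by (induction S rule: finite_induct) (auto simp: real_sqrt_mult)

section \<open>Localization in several variables\<close>

text \<open>\<open>\<phi>\<close> will be the real or the imaginary part. All coordinates but \<open>l\<close> are summed in absolute value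
  by means of the Christoffel function.\<close>

lemma directional_bound:
  fixes \<alpha> \<beta> :: "real^'d" and l :: 'd
  assumes ab: "\<And>j. \<alpha> $ j \<ge> - 1/2" "\<And>j. \<beta> $ j \<ge> - 1/2" and k: "1 \<le> k"
  obtains C where "C \<ge> 0"
    and "\<And>(A :: real^'d \<Rightarrow> complex) \<phi> n x y. \<lbrakk>smooth_cutoff (3 * k - 1) A; bounded_linear \<phi>; \<And>z. \<bar>\<phi> z\<bar> \<le> norm z; 1 \<le> n; x \<in> cube (-1) 1; y \<in> cube (-1) 1\<rbrakk> \<Longrightarrow>
      \<bar>\<phi> (Lambda_kernel A \<alpha> \<beta> n x y)\<bar> * (sqrt (W \<alpha> \<beta> n x) * sqrt (W \<alpha> \<beta> n y))
        * (1 + real n * \<bar>arccos (x $ l) - arccos (y $ l)\<bar>) ^ k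
      \<le> C * sup_norm_orthant (pd l (3 * k - 1) A) * real n ^ CARD('d)"
proof -
  have jp: "jacobi_param (\<alpha> $ i) (\<beta> $ i)" for i by unfold_locales (use ab in auto)
  define wj where "wj i n t = jacobi_param.wn (\<alpha> $ i) (\<beta> $ i) n t" for i n t
  define e where "e i \<nu> t = poly (jacobi_param.en (\<alpha> $ i) (\<beta> $ i) \<nu>) t" for i \<nu> t
  have pe: "jacobi_normalized \<nu> (\<alpha> $ i) (\<beta> $ i) t = e i \<nu> t" for i \<nu> t
    unfolding e_def by (rule jacobi_param.poly_en[OF jp, symmetric])
  define P where "P i C \<longleftrightarrow> C > 0 \<and> (\<forall>n x y. 1 \<le> n \<longrightarrow> -1 \<le> x \<longrightarrow> x \<le> 1 \<longrightarrow> -1 \<le> y \<longrightarrow> y \<le> 1 \<longrightarrow>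
      (\<Sum>\<nu>\<le>2 * n. \<bar>e i \<nu> x * e i \<nu> y\<bar>) * (sqrt (wj i n x) * sqrt (wj i n y)) \<le> C * real n)" for i C
  have "\<exists>C. P i C" for i
    unfolding P_def e_def wj_def by (rule jacobi_param.abs_kernel_bound_1d[OF jp[of i]]) blast
  hence "\<exists>Ca. \<forall>i. P i (Ca i)" by (intro choice allI)
  then obtain Ca where P: "\<And>i. P i (Ca i)" by blast
  have Ca: "Ca i > 0" "\<lbrakk>1 \<le> n; -1 \<le> x; x \<le> 1; -1 \<le> y; y \<le> 1\<rbrakk> \<Longrightarrow>
      (\<Sum>\<nu>\<le>2 * n. \<bar>e i \<nu> x * e i \<nu> y\<bar>) * (sqrt (wj i n x) * sqrt (wj i n y)) \<le> Ca i * real n" for i n x y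
    using P[of i] unfolding P_def by blast+
  obtain C1 where C1: "C1 \<ge> 0" "\<And>f M n x y. \<lbrakk>1 \<le> n; -1 \<le> x; x \<le> 1; -1 \<le> y; y \<le> 1; cutoff_family (Suc k) f M\<rbrakk>
    \<Longrightarrow> \<bar>\<Sum>\<nu>\<le>2 * n. f 0 (real \<nu> / real n) * e l \<nu> x * e l \<nu> y\<bar> * (sqrt (wj l n x) * sqrt (wj l n y))
        * (1 + real n * \<bar>arccos x - arccos y\<bar>) ^ k \<le> C1 * M * real n"
    unfolding e_def wj_def by (rule jacobi_param.kernel_localization_1d[OF jp[of l] k]) blast
  define C where "C = C1 * 2 ^ (2 * k - 2) * (\<Prod>i\<in>UNIV - {l}. Ca i)"
  have "C \<ge> 0" unfolding C_def using C1(1) less_imp_le[OF Ca(1)] by (intro mult_nonneg_nonneg prod_nonneg) auto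
  moreover have "\<bar>\<phi> (Lambda_kernel A \<alpha> \<beta> n x y)\<bar> * (sqrt (W \<alpha> \<beta> n x) * sqrt (W \<alpha> \<beta> n y))
        * (1 + real n * \<bar>arccos (x $ l) - arccos (y $ l)\<bar>) ^ k
      \<le> C * sup_norm_orthant (pd l (3 * k - 1) A) * real n ^ CARD('d)"
    if A: "smooth_cutoff (3 * k - 1) A"
      and \<phi>: "bounded_linear \<phi>" "\<And>z. \<bar>\<phi> z\<bar> \<le> norm z" and n: "1 \<le> n"
      and xc: "x \<in> cube (-1) 1" and yc: "y \<in> cube (-1) 1"
    for A :: "real^'d \<Rightarrow> complex" and \<phi> n x y
  proof -
    interpret \<phi>: bounded_linear \<phi> by (rule \<phi>(1))
    have Ck: "Ck_orthant (3 * k - 1) A" and supp: "supp_orthant A \<subseteq> cube 0 2"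
      and van: "\<forall>t \<in> cube 0 2. t $ l = 0 \<longrightarrow> (\<forall>m \<in> {1..3 * k - 1}. pd l m A t = 0)"
      using A unfolding smooth_cutoff_def by blast+
    define S where "S = {\<nu> :: nat^'d. \<forall>i. \<nu> $ i \<le> 2 * n}"
    define p where "p i m = e i m (x $ i) * e i m (y $ i)" for i m
    define M where "M = sup_norm_orthant (pd l (3 * k - 1) A)"
    define wt where "wt i = sqrt (wj i n (x $ i)) * sqrt (wj i n (y $ i))" for i
    define pt where "pt \<nu> = (\<chi> j. real (\<nu> $ j) / real n)" for \<nu> :: "nat^'d"
    define D where "D = (1 + real n * \<bar>arccos (x $ l) - arccos (y $ l)\<bar>) ^ k"
    have n0: "real n > 0" using n by simp
    have x: "-1 \<le> x $ i" "x $ i \<le> 1" and y: "-1 \<le> y $ i" "y $ i \<le> 1" for i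
      using xc yc by (auto simp: cube_def)
    have wt0: "0 < wt i" for i unfolding wt_def wj_def
      using jacobi_param.wn_pos[OF jp n x] jacobi_param.wn_pos[OF jp n y] by simp
    have D0: "0 \<le> D" unfolding D_def by simp
    have pto: "pt \<nu> \<in> orthant" for \<nu> unfolding pt_def orthant_def by simp
    have jprod: "jacobi_prod \<alpha> \<beta> \<nu> x * jacobi_prod \<alpha> \<beta> \<nu> y = (\<Prod>i\<in>UNIV. p i (\<nu> $ i))" for \<nu>
      unfolding jacobi_prod_def p_def pe prod.distrib ..
    have "Lambda_kernel A \<alpha> \<beta> n x y = (\<Sum>\<^sub>\<infinity>\<nu>\<in>S. A (pt \<nu>) * complex_of_real (\<Prod>i\<in>UNIV. p i (\<nu> $ i)))"
      unfolding Lambda_kernel_def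
    proof (rule infsum_cong_neutral)
      fix \<nu> :: "nat^'d" assume "\<nu> \<in> UNIV - S"
      then obtain i where "2 * n < \<nu> $ i" unfolding S_def by (auto simp: not_le)
      hence "2 * real n < real (\<nu> $ i)" by linarith
      hence "2 < pt \<nu> $ i" unfolding pt_def using n0 by (simp add: field_simps)
      hence "pt \<nu> \<notin> cube 0 2" unfolding cube_def by (auto simp: not_le intro!: exI[of _ i])
      hence "A (pt \<nu>) = 0" using supp_zero[OF supp pto] by blast
      thus "A (\<chi> j. real (\<nu> $ j) / real n) * complex_of_real (jacobi_prod \<alpha> \<beta> \<nu> x) * complex_of_real (jacobi_prod \<alpha> \<beta> \<nu> y) = 0"
        by (simp add: pt_def)
    qed (auto simp: jprod[symmetric] pt_def)
    also have "\<dots> = (\<Sum>\<nu>\<in>S. A (pt \<nu>) * complex_of_real (\<Prod>i\<in>UNIV. p i (\<nu> $ i)))"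
      unfolding S_def by (rule infsum_finite[OF vec_grid_bij(2)])
    finally have L: "Lambda_kernel A \<alpha> \<beta> n x y = (\<Sum>\<nu>\<in>S. A (pt \<nu>) * complex_of_real (\<Prod>i\<in>UNIV. p i (\<nu> $ i)))" .
    have \<phi>c: "\<phi> (z * complex_of_real c) = \<phi> z * c" for z c
    proof -
      have "z * complex_of_real c = c *\<^sub>R z" by (simp add: scaleR_conv_of_real)
      thus ?thesis by (simp add: \<phi>.scaleR)
    qed
    have "\<phi> (Lambda_kernel A \<alpha> \<beta> n x y) = (\<Sum>\<nu>\<in>S. \<phi> (A (pt \<nu>)) * (\<Prod>i\<in>UNIV. p i (\<nu> $ i)))"
      unfolding L \<phi>.sum \<phi>c ..
    also have "\<dots> = (\<Sum>g\<in>PiE (UNIV - {l}) (\<lambda>_. {..2*n}). \<Sum>m\<le>2*n.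
        \<phi> (A (pt (\<chi> j. if j = l then m else g j))) * (\<Prod>i\<in>UNIV. p i ((\<chi> j. if j = l then m else g j) $ i)))"
      unfolding S_def by (rule vec_grid_bij(1))
    also have "\<dots> = (\<Sum>g\<in>PiE (UNIV - {l}) (\<lambda>_. {..2*n}). (\<Prod>i\<in>UNIV - {l}. p i (g i)) *
        (\<Sum>m\<le>2*n. \<phi> (A (pt (\<chi> j. if j = l then m else g j))) * p l m))"
    proof (rule sum.cong[OF refl], unfold sum_distrib_left, rule sum.cong[OF refl])
      fix g :: "'d \<Rightarrow> nat" and m
      have "(\<Prod>i\<in>UNIV. p i ((\<chi> j. if j = l then m else g j) $ i)) = p l m * (\<Prod>i\<in>UNIV - {l}. p i (g i))"
        by (subst prod.remove[of _ l]) (auto intro!: prod.cong)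
      thus "\<phi> (A (pt (\<chi> j. if j = l then m else g j))) * (\<Prod>i\<in>UNIV. p i ((\<chi> j. if j = l then m else g j) $ i))
        = (\<Prod>i\<in>UNIV - {l}. p i (g i)) * (\<phi> (A (pt (\<chi> j. if j = l then m else g j))) * p l m)" by simp
    qed
    finally have eq: "\<phi> (Lambda_kernel A \<alpha> \<beta> n x y) = (\<Sum>g\<in>PiE (UNIV - {l}) (\<lambda>_. {..2*n}). (\<Prod>i\<in>UNIV - {l}. p i (g i)) *
        (\<Sum>m\<le>2*n. \<phi> (A (pt (\<chi> j. if j = l then m else g j))) * p l m))" .
    define T where "T = C1 * (2 ^ (2 * k - 2) * M) * real n"
    have inner: "\<bar>\<Sum>m\<le>2*n. \<phi> (A (pt (\<chi> j. if j = l then m else g j))) * p l m\<bar> * wt l * D \<le> T"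
      if g: "g \<in> PiE (UNIV - {l}) (\<lambda>_. {..2*n})" for g
    proof -
      define t where "t = pt (\<chi> j. if j = l then 0 else g j)"
      have to: "t \<in> orthant" unfolding t_def by (rule pto)
      have tl: "t $ l = 0" unfolding t_def pt_def by simp
      have tc: "t \<in> cube 0 2" unfolding cube_def
      proof (intro CollectI allI conjI)
        fix j show "0 \<le> t $ j" using to by (simp add: orthant_def)
        show "t $ j \<le> 2"
        proof (cases "j = l")
          case False
          hence "g j \<le> 2 * n" using g by (auto simp: PiE_def Pi_def)
          hence "real (g j) \<le> 2 * real n" by linarith
          thus ?thesis using False n0 by (simp add: t_def pt_def field_simps)
        qed (simp add: tl)
      qed
      \<comment> \<open>The real-valued restriction of the derivatives to the line through
        \<open>t\<close> in direction \<open>l\<close>; it forms a cutoff family with the bound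
        \<open>M\<close> for every \<open>g\<close>.\<close>
      define f where "f r s = \<phi> (pd l r A (coord_upd t l s))" for r s
      have fd: "(f r has_real_derivative f (Suc r) s) (at s within {0..})" if "r < 3 * k - 1" "0 \<le> s" for r s
        unfolding f_def[abs_def] has_real_derivative_iff_has_vector_derivative
        by (rule \<phi>.has_vector_derivative[OF pd_has_derivative[OF Ck that(1) to that(2)]])
      have fc: "continuous_on {0..} (f r)" if "r \<le> 3 * k - 1" for r
        unfolding f_def[abs_def] by (rule \<phi>.continuous_on[OF pd_continuous_coord[OF Ck that to]])
      have f0: "f r 0 = 0" if "1 \<le> r" "r \<le> 3 * k - 1" for r
      proof -
        have "coord_upd t l 0 = t" using coord_upd_same[of t l] tl by simp
        thus ?thesis unfolding f_def using van tc tl that by (simp add: \<phi>.zero)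
      qed
      have f2: "f r s = 0" if r: "r \<le> 3 * k - 1" and s: "2 \<le> s" for r s
      proof -
        have gt: "f r u = 0" if "2 < u" for u
        proof -
          have "coord_upd t l u \<notin> cube 0 2" using that unfolding cube_def by (auto simp: not_le intro!: exI[of _ l])
          moreover have "coord_upd t l u \<in> orthant" using to that by (intro coord_upd_orthant) auto
          ultimately show ?thesis unfolding f_def using pd_zero_outside[OF supp] by (simp add: \<phi>.zero)
        qed
        \<comment> \<open>For \<open>s = 2\<close> the point may still lie in the cube, so the value
          is obtained by continuity from \<open>s > 2\<close>.\<close>
        have "continuous_on (closure {2<..}) (\<lambda>u. \<bar>f r u\<bar>)"
          using continuous_on_subset[OF fc[OF r], of "{2..}"] by (intro continuous_on_rabs) auto
        moreover have "s \<in> closure {2<..}" using s by simp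
        ultimately have "\<bar>f r s\<bar> \<le> 0" by (rule continuous_le_on_closure) (simp add: gt)
        thus ?thesis by simp
      qed
      have fM: "\<bar>f (3 * k - 1) s\<bar> \<le> M" if "0 \<le> s" for s
        unfolding f_def M_def using \<phi>(2) pd_le_sup_norm[OF Ck supp order.refl coord_upd_orthant[OF to that]]
        by (rule order.trans)
      have "cutoff_family (3 * k - 1) f M"
        unfolding cutoff_family_def using fd fc f0 f2 fM by simp
      \<comment> \<open>Since \<open>k \<ge> 1\<close>, the order \<open>k + 1\<close> is at most
        \<open>3 * k - 1\<close>; the difference is the exponent \<open>2 * k - 2\<close>.\<close>
      from cutoff_family_lower[OF this, of "Suc k"]
      have cf: "cutoff_family (Suc k) f (2 ^ (2 * k - 2) * M)" using k by simp
      have "\<bar>\<Sum>\<nu>\<le>2 * n. f 0 (real \<nu> / real n) * e l \<nu> (x $ l) * e l \<nu> (y $ l)\<bar> * (sqrt (wj l n (x $ l)) * sqrt (wj l n (y $ l)))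
        * (1 + real n * \<bar>arccos (x $ l) - arccos (y $ l)\<bar>) ^ k \<le> C1 * (2 ^ (2 * k - 2) * M) * real n"
        by (rule C1(2)[OF n x y cf])
      moreover have "f 0 (real m / real n) = \<phi> (A (pt (\<chi> j. if j = l then m else g j)))" for m
      proof -
        have "coord_upd t l (real m / real n) = pt (\<chi> j. if j = l then m else g j)"
          by (simp add: vec_eq_iff t_def pt_def)
        thus ?thesis by (simp add: f_def)
      qed
      ultimately show ?thesis unfolding T_def wt_def D_def p_def by (simp add: mult.assoc)
    qed
    let ?G = "PiE (UNIV - {l}) (\<lambda>_. {..2*n})"
    have "\<bar>\<phi> (Lambda_kernel A \<alpha> \<beta> n x y)\<bar> * (wt l * D) \<le> (\<Sum>g\<in>?G. (\<Prod>i\<in>UNIV - {l}. \<bar>p i (g i)\<bar>) *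
        \<bar>\<Sum>m\<le>2*n. \<phi> (A (pt (\<chi> j. if j = l then m else g j))) * p l m\<bar>) * (wt l * D)"
      unfolding eq using wt0[of l] D0
      by (intro mult_right_mono order.trans[OF sum_abs]) (auto simp: abs_mult abs_prod)
    also have "\<dots> = (\<Sum>g\<in>?G. (\<Prod>i\<in>UNIV - {l}. \<bar>p i (g i)\<bar>) *
        (\<bar>\<Sum>m\<le>2*n. \<phi> (A (pt (\<chi> j. if j = l then m else g j))) * p l m\<bar> * wt l * D))"
      by (simp add: sum_distrib_right mult.assoc)
    also have "\<dots> \<le> (\<Sum>g\<in>?G. (\<Prod>i\<in>UNIV - {l}. \<bar>p i (g i)\<bar>) * T)"
      by (intro sum_mono mult_left_mono inner prod_nonneg) auto
    also have "\<dots> = (\<Prod>i\<in>UNIV - {l}. \<Sum>m\<le>2*n. \<bar>p i m\<bar>) * T"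
      by (subst prod_sum_PiE) (auto simp: sum_distrib_right)
    finally have b1: "\<bar>\<phi> (Lambda_kernel A \<alpha> \<beta> n x y)\<bar> * (wt l * D) \<le> (\<Prod>i\<in>UNIV - {l}. \<Sum>m\<le>2*n. \<bar>p i m\<bar>) * T" .
    have M0: "0 \<le> M"
    proof -
      have "(0 :: real^'d) \<in> orthant" by (simp add: orthant_def)
      from pd_le_sup_norm[OF Ck supp order.refl this, of l] show ?thesis
        unfolding M_def by (meson norm_ge_zero order_trans)
    qed
    have T0: "0 \<le> T" unfolding T_def using C1(1) M0 by simp
    have "\<bar>\<phi> (Lambda_kernel A \<alpha> \<beta> n x y)\<bar> * (\<Prod>i\<in>UNIV. wt i) * D
      = (\<bar>\<phi> (Lambda_kernel A \<alpha> \<beta> n x y)\<bar> * (wt l * D)) * (\<Prod>i\<in>UNIV - {l}. wt i)"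
      by (subst prod.remove[of UNIV l]) auto
    also have "\<dots> \<le> ((\<Prod>i\<in>UNIV - {l}. \<Sum>m\<le>2*n. \<bar>p i m\<bar>) * T) * (\<Prod>i\<in>UNIV - {l}. wt i)"
      using less_imp_le[OF wt0] by (intro mult_right_mono b1 prod_nonneg) auto
    also have "\<dots> = (\<Prod>i\<in>UNIV - {l}. (\<Sum>m\<le>2*n. \<bar>p i m\<bar>) * wt i) * T"
      by (simp add: prod.distrib)
    also have "\<dots> \<le> (\<Prod>i\<in>UNIV - {l}. Ca i * real n) * T"
    proof (intro mult_right_mono T0 prod_mono conjI)
      fix i
      show "0 \<le> (\<Sum>m\<le>2*n. \<bar>p i m\<bar>) * wt i" using less_imp_le[OF wt0[of i]] by (intro mult_nonneg_nonneg sum_nonneg) auto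
      show "(\<Sum>m\<le>2*n. \<bar>p i m\<bar>) * wt i \<le> Ca i * real n"
        unfolding p_def wt_def by (rule Ca(2)[OF n x y])
    qed
    also have "\<dots> = C * M * (real n ^ card (UNIV - {l}) * real n)"
      unfolding T_def C_def by (simp add: prod.distrib mult_ac)
    also have "real n ^ card (UNIV - {l}) * real n = real n ^ CARD('d)"
    proof -
      have e: "CARD('d) = Suc (card (UNIV - {l}))" by (simp add: card_Suc_Diff1)
      show ?thesis unfolding e power_Suc by (rule mult.commute)
    qed
    finally have "\<bar>\<phi> (Lambda_kernel A \<alpha> \<beta> n x y)\<bar> * (\<Prod>i\<in>UNIV. wt i) * D \<le> C * M * real n ^ CARD('d)" .
    moreover have "(\<Prod>i\<in>UNIV. wt i) = sqrt (W \<alpha> \<beta> n x) * sqrt (W \<alpha> \<beta> n y)"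
      unfolding W_eq_prod[OF ab] wt_def wj_def by (simp add: real_sqrt_prod prod.distrib)
    ultimately show ?thesis unfolding D_def M_def by simp
  qed
  ultimately show thesis by (rule that)
qed

lemma kernel_localization:
  fixes \<alpha> \<beta> :: "real^'d"
  assumes ab: "\<And>j. \<alpha> $ j \<ge> - 1/2" "\<And>j. \<beta> $ j \<ge> - 1/2" and k: "1 \<le> k"
  shows "\<exists>c :: ('d \<Rightarrow> real) \<Rightarrow> real. \<forall>A :: real^'d \<Rightarrow> complex. smooth_cutoff (3 * k - 1) A \<longrightarrow>
      (\<forall>n::nat. n \<ge> 1 \<longrightarrow> (\<forall>x \<in> cube (-1) 1. \<forall>y \<in> cube (-1) 1.
      norm (Lambda_kernel A \<alpha> \<beta> n x y) \<le>
        c (\<lambda>l. sup_norm_orthant (pd l (3 * k - 1) A)) * real n ^ CARD('d) /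
          (sqrt (W \<alpha> \<beta> n x) * sqrt (W \<alpha> \<beta> n y)) * (1 + real n * rho x y) powr (- real k)))"
proof -
  have "\<exists>C\<ge>0. \<forall>(A :: real^'d \<Rightarrow> complex) \<phi> n x y. smooth_cutoff (3 * k - 1) A \<and> bounded_linear \<phi> \<and> (\<forall>z. \<bar>\<phi> z\<bar> \<le> norm z) \<and> 1 \<le> n \<and> x \<in> cube (-1) 1 \<and> y \<in> cube (-1) 1 \<longrightarrow>
      \<bar>\<phi> (Lambda_kernel A \<alpha> \<beta> n x y)\<bar> * (sqrt (W \<alpha> \<beta> n x) * sqrt (W \<alpha> \<beta> n y))
        * (1 + real n * \<bar>arccos (x $ l) - arccos (y $ l)\<bar>) ^ k
      \<le> C * sup_norm_orthant (pd l (3 * k - 1) A) * real n ^ CARD('d)" for l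
    by (rule directional_bound[OF ab k, of l]) blast
  then obtain C where C: "\<And>l. C l \<ge> 0" "\<And>l (A :: real^'d \<Rightarrow> complex) \<phi> n x y. \<lbrakk>smooth_cutoff (3 * k - 1) A; bounded_linear \<phi>; \<forall>z. \<bar>\<phi> z\<bar> \<le> norm z; 1 \<le> n; x \<in> cube (-1) 1; y \<in> cube (-1) 1\<rbrakk> \<Longrightarrow>
      \<bar>\<phi> (Lambda_kernel A \<alpha> \<beta> n x y)\<bar> * (sqrt (W \<alpha> \<beta> n x) * sqrt (W \<alpha> \<beta> n y))
        * (1 + real n * \<bar>arccos (x $ l) - arccos (y $ l)\<bar>) ^ k
      \<le> C l * sup_norm_orthant (pd l (3 * k - 1) A) * real n ^ CARD('d)"
    by metis
  \<comment> \<open>The coordinate that attains \<open>rho x y\<close> varies with the points, so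
    the constants of all directions are added, with absolute values to keep every summand
    nonnegative. The factor 2 accounts for real and imaginary part.\<close>
  define c where "c g = 2 * (\<Sum>l\<in>UNIV. C l * \<bar>g l\<bar>)" for g :: "'d \<Rightarrow> real"
  show ?thesis
  proof (intro exI[of _ c] allI impI ballI)
    fix A :: "real^'d \<Rightarrow> complex" and n :: nat and x y :: "real^'d"
    assume A: "smooth_cutoff (3 * k - 1) A" and n: "n \<ge> 1" and x: "x \<in> cube (-1) 1" and y: "y \<in> cube (-1) 1"
    define g where "g l = sup_norm_orthant (pd l (3 * k - 1) A)" for l
    define w where "w = sqrt (W \<alpha> \<beta> n x) * sqrt (W \<alpha> \<beta> n y)"
    define D where "D = 1 + real n * rho x y"
    have "rho x y \<in> range (\<lambda>j. \<bar>arccos (x $ j) - arccos (y $ j)\<bar>)"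
      unfolding rho_def by (rule Max_in) auto
    then obtain l where l: "rho x y = \<bar>arccos (x $ l) - arccos (y $ l)\<bar>" by auto
    have D: "D \<ge> 1" unfolding D_def l by simp
    have w: "w > 0"
    proof -
      have jp: "jacobi_param (\<alpha> $ i) (\<beta> $ i)" for i by unfold_locales (use ab in auto)
      have "0 < W \<alpha> \<beta> n z" if "z \<in> cube (-1) 1" for z
        unfolding W_eq_prod[OF ab]
        by (intro prod_pos jacobi_param.wn_pos[OF jp n]) (use that in \<open>auto simp: cube_def\<close>)
      thus ?thesis unfolding w_def using x y by simp
    qed
    have 1: "\<bar>\<phi> (Lambda_kernel A \<alpha> \<beta> n x y)\<bar> * w * D ^ k \<le> C l * g l * real n ^ CARD('d)"
      if "bounded_linear \<phi>" "\<forall>z. \<bar>\<phi> z\<bar> \<le> norm z" for \<phi>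
      using C(2)[OF A that n x y, of l] unfolding w_def D_def l g_def .
    let ?\<Lambda> = "Lambda_kernel A \<alpha> \<beta> n x y"
    have "norm ?\<Lambda> * (w * D ^ k) \<le> (\<bar>Re ?\<Lambda>\<bar> + \<bar>Im ?\<Lambda>\<bar>) * (w * D ^ k)"
      using w D by (intro mult_right_mono cmod_le) auto
    also have "\<dots> \<le> 2 * (C l * g l * real n ^ CARD('d))"
      using 1[OF bounded_linear_Re] 1[OF bounded_linear_Im] abs_Re_le_cmod abs_Im_le_cmod
      by (simp add: distrib_right mult.assoc)
    also have "\<dots> = 2 * (C l * g l) * real n ^ CARD('d)" by simp
    also have "\<dots> \<le> c g * real n ^ CARD('d)"
    proof (rule mult_right_mono)
      have "C l * g l \<le> C l * \<bar>g l\<bar>" using C(1)[of l] by (intro mult_left_mono) auto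
      also have "\<dots> \<le> (\<Sum>l\<in>UNIV. C l * \<bar>g l\<bar>)"
        using C(1) by (intro member_le_sum) auto
      finally show "2 * (C l * g l) \<le> c g" unfolding c_def by simp
    qed simp
    finally have 2: "norm ?\<Lambda> * (w * D ^ k) \<le> c g * real n ^ CARD('d)" .
    have "D powr (- real k) = 1 / D ^ k" using D by (simp add: powr_minus powr_realpow divide_inverse)
    moreover have "0 < w * D ^ k" using w D by simp
    ultimately have "norm ?\<Lambda> \<le> c g * real n ^ CARD('d) / w * D powr (- real k)"
      using 2 by (simp add: pos_le_divide_eq)
    thus "norm ?\<Lambda> \<le> c (\<lambda>l. sup_norm_orthant (pd l (3 * k - 1) A)) * real n ^ CARD('d) /
          (sqrt (W \<alpha> \<beta> n x) * sqrt (W \<alpha> \<beta> n y)) * (1 + real n * rho x y) powr (- real k)"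
      unfolding w_def D_def g_def[abs_def] .
  qed
qed

theorem theorem4p1:
  fixes \<alpha> \<beta> :: "real^'d"
  assumes "\<And>j. \<alpha> $ j \<ge> - 1/2" and "\<And>j. \<beta> $ j \<ge> - 1/2"
  shows
    "(\<forall>k::nat. k \<ge> 1 \<longrightarrow>
       (\<exists>c :: ('d \<Rightarrow> real) \<Rightarrow> real. \<forall>A :: real^'d \<Rightarrow> complex.
          Ck_orthant (3 * k - 1) A \<and> supp_orthant A \<subseteq> cube 0 2 \<and>
          (\<forall>l. \<forall>t \<in> cube 0 2. t $ l = 0 \<longrightarrow> (\<forall>m \<in> {1..3 * k - 1}. pd l m A t = 0)) \<longrightarrow>
          (\<forall>n::nat. n \<ge> 1 \<longrightarrow> (\<forall>x \<in> cube (-1) 1. \<forall>y \<in> cube (-1) 1.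
             norm (Lambda_kernel A \<alpha> \<beta> n x y) \<le>
               c (\<lambda>l. sup_norm_orthant (pd l (3 * k - 1) A)) * real n ^ CARD('d) /
                 (sqrt (W \<alpha> \<beta> n x) * sqrt (W \<alpha> \<beta> n y)) *
                 (1 + real n * rho x y) powr (- real k)))))
     \<and>
     (\<forall>A :: real^'d \<Rightarrow> complex. admissible A \<longrightarrow>
       (\<forall>k::real. k > 0 \<longrightarrow>
         (\<exists>c::real. \<forall>n::nat. n \<ge> 1 \<longrightarrow> (\<forall>x \<in> cube (-1) 1. \<forall>y \<in> cube (-1) 1.
             norm (Lambda_kernel A \<alpha> \<beta> n x y) \<le>
               c * real n ^ CARD('d) /
                 (sqrt (W \<alpha> \<beta> n x) * sqrt (W \<alpha> \<beta> n y)) *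
                 (1 + real n * rho x y) powr (- k)))))"
proof (intro conjI allI impI, goal_cases)
  case (1 k)
  from kernel_localization[OF assms this] show ?case unfolding smooth_cutoff_def .
next
  case (2 A k)
  \<comment> \<open>An integer order above \<open>k\<close> suffices, because the base
    \<open>1 + n * rho x y\<close> is at least 1.\<close>
  define K where "K = nat \<lceil>k\<rceil>"
  have K: "1 \<le> K" "k \<le> real K" unfolding K_def using 2(2) by linarith+
  have "smooth_cutoff (3 * K - 1) A"
    using 2(1) unfolding admissible_def smooth_cutoff_def by (auto simp: cube_def orthant_def)
  then obtain c0 where c0: "\<And>n x y. \<lbrakk>1 \<le> n; x \<in> cube (-1) 1; y \<in> cube (-1) 1\<rbrakk> \<Longrightarrow>
      norm (Lambda_kernel A \<alpha> \<beta> n x y) \<le> c0 * real n ^ CARD('d) /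
          (sqrt (W \<alpha> \<beta> n x) * sqrt (W \<alpha> \<beta> n y)) * (1 + real n * rho x y) powr (- real K)"
    using kernel_localization[OF assms K(1)] by blast
  \<comment> \<open>The sign of \<open>c0\<close> is unknown; the absolute value is taken so that
    the weaker decay can be substituted.\<close>
  have "norm (Lambda_kernel A \<alpha> \<beta> n x y) \<le> \<bar>c0\<bar> * real n ^ CARD('d) /
                 (sqrt (W \<alpha> \<beta> n x) * sqrt (W \<alpha> \<beta> n y)) * (1 + real n * rho x y) powr (- k)"
    if n: "n \<ge> 1" and x: "x \<in> cube (-1) 1" and y: "y \<in> cube (-1) 1" for n x y
  proof -
    define v where "v = real n ^ CARD('d) / (sqrt (W \<alpha> \<beta> n x) * sqrt (W \<alpha> \<beta> n y))"
    have "0 \<le> W \<alpha> \<beta> n z" for z unfolding W_def by (intro prod_nonneg) auto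
    hence v: "0 \<le> v" unfolding v_def by simp
    have "rho x y \<in> range (\<lambda>j. \<bar>arccos (x $ j) - arccos (y $ j)\<bar>)"
      unfolding rho_def by (rule Max_in) auto
    hence "0 \<le> rho x y" by auto
    hence D: "1 \<le> 1 + real n * rho x y" by simp
    have "norm (Lambda_kernel A \<alpha> \<beta> n x y) \<le> c0 * v * (1 + real n * rho x y) powr (- real K)"
      using c0[OF n x y] unfolding v_def times_divide_eq_right .
    also have "\<dots> \<le> \<bar>c0\<bar> * v * (1 + real n * rho x y) powr (- real K)"
      using v by (intro mult_right_mono) auto
    also have "\<dots> \<le> \<bar>c0\<bar> * v * (1 + real n * rho x y) powr (- k)"
      using v K D by (intro mult_left_mono powr_mono) auto
    finally show ?thesis by (simp add: v_def)
  qed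
  thus ?case by blast
qed

end
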